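(* $\mathrm{MC}^*(\cap,+,-)\in\mathrm P$.
   Context: For $k\ge1$ let $\mathbb N_\infty^k=\mathbb N^k\cup\{\infty\}$ (natural numbers include $0$). Addition on $\mathbb N^k$ is componentwise, and $\infty+m=m+\infty=\infty+\infty=\infty$ for $m\in\mathbb N^k$. Subtraction is partial: for $a,b\in\mathbb N^k$, $a-b$ is defined (componentwise) iff $a_i-b_i\in\mathbb N$ for all $i$; $\infty-m=\infty$ for $m\in\mathbb N^k$; $m-\infty$ and $\infty-\infty$ are undefined. For $A,B\subseteq\mathbb N_\infty^k$: $A\cap B$, $A\cup B$ usual, $A+B=\{a+b:a\in A,b\in B\}$, $A-B=\{a-b: a\in A,b\in B, a-b \text{ defined}\}$, $\overline A=\mathbb N_\infty^k\setminus A$. For $\emptyset\ne\mathcal O\subseteq\{\cup,\cap,\overline{\phantom{c}},+,-\}$, an $\mathcal O$-circuit over $\mathbb N_\infty^k$ is a finite acyclic directed multigraph $C=(V,E,g_C,\alpha)$ with gates of indegree $0,1,2$, a designated output gate $g_C$, input gates labeled by elements of $\mathbb N_\infty^k$, indegree-$1$ gates labeled $\overline{\phantom{c}}$ (only if $\overline{\phantom{c}}\in\mathcal O$), indegree-$2$ gates labeled by operations in $\mathcal O\setminus\{\overline{\phantom{c}}\}$; result sets $I(g)$ are defined inductively ($\{\alpha(g)\}$ for inputs, complement of the predecessor's set, or $I(g_1)\sigma I(g_2)$ with predecessors $g_1\le g_2$), and $I(C)=I(g_C)$. Circuits are encoded as bit strings listing gates in reverse topological order with labels and predecessor lists, numbers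 in binary. $\mathrm{MC}^*(\mathcal O)$ is the set of all $(C,b)$ such that for some $k\ge1$, $C$ is an $\mathcal O$-circuit over $\mathbb N_\infty^k$, $b\in\mathbb N_\infty^k$, and $b\in I(C)$. *)

theory Defs
  imports Main
begin

datatype elem = Fin "nat list" | Infty

definition dimset :: "nat \<Rightarrow> elem set" where
  "dimset k = insert Infty {Fin v | v. length v = k}"

fun elem_add :: "elem \<Rightarrow> elem \<Rightarrow> elem" where
  "elem_add (Fin u) (Fin v) = Fin (map2 (+) u v)"
| "elem_add _ _ = Infty"

fun elem_sub :: "elem \<Rightarrow> elem \<Rightarrow> elem option" where
  "elem_sub (Fin u) (Fin v) =
     (if length u = length v \<and> list_all2 (\<ge>) u v then Some (Fin (map2 (-) u v)) else None)"
| "elem_sub Infty (Fin v) = Some Infty"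
| "elem_sub _ Infty = None"

definition set_add :: "elem set \<Rightarrow> elem set \<Rightarrow> elem set" where
  "set_add A B = {elem_add a b | a b. a \<in> A \<and> b \<in> B}"

definition set_sub :: "elem set \<Rightarrow> elem set \<Rightarrow> elem set" where
  "set_sub A B = {c | a b c. a \<in> A \<and> b \<in> B \<and> elem_sub a b = Some c}"

datatype op = OUnion | OInter | OCompl | OPlus | OMinus

datatype gate = GIn elem | GCompl nat | GBin op nat nat

text \<open>A circuit is (output gate index, list of gates). Gates are listed in reverse
  topological order: every predecessor of gate i has an index strictly larger than i.
  For a binary gate GBin op j l, j is the first and l the second operand.\<close>
type_synonym circuit = "nat \<times> gate list"

fun binop :: "op \<Rightarrow> elem set \<Rightarrow> elem set \<Rightarrow> elem set" where
  "binop OUnion A B = A \<union> B"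
| "binop OInter A B = A \<inter> B"
| "binop OPlus A B = set_add A B"
| "binop OMinus A B = set_sub A B"
| "binop OCompl A B = {}"

function gval :: "nat \<Rightarrow> gate list \<Rightarrow> nat \<Rightarrow> elem set" where
  "gval k gs i =
    (if i < length gs then
      (case gs ! i of
         GIn a \<Rightarrow> {a}
       | GCompl j \<Rightarrow> (if i < j then dimset k - gval k gs j else {})
       | GBin f j l \<Rightarrow> (if i < j \<and> i < l then binop f (gval k gs j) (gval k gs l) else {}))
     else {})"
  by pat_completeness auto
termination
  by (relation "measure (\<lambda>(k, gs, i). length gs - i)") auto

definition wf_gate :: "op set \<Rightarrow> nat \<Rightarrow> nat \<Rightarrow> nat \<Rightarrow> gate \<Rightarrow> bool" where
  "wf_gate Ops k n i g =
    (case g of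
       GIn a \<Rightarrow> a \<in> dimset k
     | GCompl j \<Rightarrow> OCompl \<in> Ops \<and> i < j \<and> j < n
     | GBin f j l \<Rightarrow> f \<in> Ops \<and> f \<noteq> OCompl \<and> i < j \<and> j < n \<and> i < l \<and> l < n)"

definition is_circuit :: "op set \<Rightarrow> nat \<Rightarrow> circuit \<Rightarrow> bool" where
  "is_circuit Ops k C =
    (fst C < length (snd C) \<and>
     (\<forall>i < length (snd C). wf_gate Ops k (length (snd C)) i (snd C ! i)))"

definition circ_val :: "nat \<Rightarrow> circuit \<Rightarrow> elem set" where
  "circ_val k C = gval k (snd C) (fst C)"

definition S0 :: "bool list" where "S0 = [False, False, False, False]"
definition S1 :: "bool list" where "S1 = [False, False, False, True]"
definition SComma :: "bool list" where "SComma = [False, False, True, False]"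
definition SOpen :: "bool list" where "SOpen = [False, False, True, True]"
definition SClose :: "bool list" where "SClose = [False, True, False, False]"
definition SInf :: "bool list" where "SInf = [False, True, False, True]"
definition SIn :: "bool list" where "SIn = [False, True, True, False]"
definition SCmp :: "bool list" where "SCmp = [False, True, True, True]"
definition SUn :: "bool list" where "SUn = [True, False, False, False]"
definition SIs :: "bool list" where "SIs = [True, False, False, True]"
definition SPl :: "bool list" where "SPl = [True, False, True, False]"
definition SMi :: "bool list" where "SMi = [True, False, True, True]"
definition SEnd :: "bool list" where "SEnd = [True, True, False, False]"
definition SSep :: "bool list" where "SSep = [True, True, False, True]"

function nat_bin :: "nat \<Rightarrow> bool list" where
  "nat_bin n = (if n < 2 then (if n = 0 then S0 else S1)
                else nat_bin (n div 2) @ (if n mod 2 = 0 then S0 else S1))"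
  by pat_completeness auto
termination by (relation "measure id") auto

fun enc_elem :: "elem \<Rightarrow> bool list" where
  "enc_elem Infty = SInf"
| "enc_elem (Fin v) = SOpen @ concat (map (\<lambda>x. nat_bin x @ SComma) v) @ SClose"

fun op_sym :: "op \<Rightarrow> bool list" where
  "op_sym OUnion = SUn" | "op_sym OInter = SIs" | "op_sym OPlus = SPl"
| "op_sym OMinus = SMi" | "op_sym OCompl = SCmp"

fun enc_gate :: "gate \<Rightarrow> bool list" where
  "enc_gate (GIn a) = SIn @ enc_elem a"
| "enc_gate (GCompl j) = SCmp @ nat_bin j @ SEnd"
| "enc_gate (GBin f j l) = (op_sym f) @ nat_bin j @ SComma @ nat_bin l @ SEnd"

definition enc_circuit :: "circuit \<Rightarrow> bool list" where
  "enc_circuit C = nat_bin (fst C) @ SSep @ concat (map enc_gate (snd C)) @ SSep"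

definition enc_instance :: "circuit \<Rightarrow> elem \<Rightarrow> bool list" where
  "enc_instance C b = enc_circuit C @ enc_elem b"

definition MC_star :: "op set \<Rightarrow> bool list set" where
  "MC_star Ops = {enc_instance C b | C b k.
      k \<ge> 1 \<and> is_circuit Ops k C \<and> b \<in> dimset k \<and> b \<in> circ_val k C}"

datatype move = MLeft | MRight | MStay

text \<open>States 0..<tm_nstates, start state 0; tape symbols 0..<tm_nsyms, 0 = blank,
  input bit False is symbol 1, True is symbol 2.\<close>
record tm =
  tm_nstates :: nat
  tm_nsyms :: nat
  tm_delta :: "nat \<Rightarrow> nat \<Rightarrow> nat \<times> nat \<times> move"
  tm_accept :: nat
  tm_reject :: nat

definition valid_tm :: "tm \<Rightarrow> bool" where
  "valid_tm M =
    (tm_nsyms M \<ge> 3 \<and> tm_accept M < tm_nstates M \<and> tm_reject M < tm_nstates M \<and>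
     tm_accept M \<noteq> tm_reject M \<and>
     (\<forall>q s. q < tm_nstates M \<and> s < tm_nsyms M \<longrightarrow>
        (case tm_delta M q s of (q', s', d) \<Rightarrow> q' < tm_nstates M \<and> s' < tm_nsyms M)))"

text \<open>Configuration: (state, cells left of head in reverse order, cells from head on).\<close>
type_synonym config = "nat \<times> nat list \<times> nat list"

definition tm_step :: "tm \<Rightarrow> config \<Rightarrow> config" where
  "tm_step M c = (case c of (q, ls, rs) \<Rightarrow>
     if q = tm_accept M \<or> q = tm_reject M then c else
     (let s = (case rs of [] \<Rightarrow> 0 | x # _ \<Rightarrow> x);
          rs' = (case rs of [] \<Rightarrow> [] | _ # xs \<Rightarrow> xs) in
      case tm_delta M q s of (q', s', d) \<Rightarrow>
        (case d of
           MStay \<Rightarrow> (q', ls, s' # rs')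
         | MRight \<Rightarrow> (q', s' # ls, rs')
         | MLeft \<Rightarrow> (case ls of [] \<Rightarrow> (q', [], 0 # s' # rs')
                          | l # ls' \<Rightarrow> (q', ls', l # s' # rs')))))"

definition tm_init :: "bool list \<Rightarrow> config" where
  "tm_init w = (0, [], map (\<lambda>b. if b then 2 else 1) w)"

definition decides_in_time :: "tm \<Rightarrow> bool list set \<Rightarrow> (nat \<Rightarrow> nat) \<Rightarrow> bool" where
  "decides_in_time M L T =
    (\<forall>w. \<exists>t \<le> T (length w).
       (let q = fst ((tm_step M ^^ t) (tm_init w)) in
        (q = tm_accept M \<or> q = tm_reject M) \<and> (q = tm_accept M \<longleftrightarrow> w \<in> L)))"

definition in_P :: "bool list set \<Rightarrow> bool" where
  "in_P L = (\<exists>M c d. valid_tm M \<and> decides_in_time M L (\<lambda>n. c * n ^ d + c))"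

end

theory Submission
  imports Defs
begin

text \<open>Inputs are singletons, and \<open>\<inter>\<close>, \<open>+\<close>, \<open>-\<close> preserve the property of having at most one
  element. Since \<open>+\<close> at most doubles the components, a circuit with \<open>n\<close> gates whose input
  components are below \<open>2 ^ D\<close> only produces components below \<open>2 ^ (D + n)\<close>, so all gates
  can be evaluated one after the other with numbers of polynomially many bits.

  To obtain a Turing machine, the decision procedure is written as a functional program
  over booleans, pairs and lists. These data are binary trees; functions on them that are
  computed in polynomial time by a machine with three stacks are closed under composition,
  pairing, case distinction and folds whose accumulator grows by a polynomial amount per
  step. A machine with three stacks is simulated by one tape with three tracks.\<close>

section \<open>Programs over three stacks\<close>

text \<open>A fold of a polynomial-time function need not be polynomial-time, since its accumulator
  may double in every step; hence the growth per step may depend on the context and the list entry,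
  but not on the accumulator. Evaluation obeys this for every bit string, because each gate value is
  cut to as many components, and each component to as many digits, as a list of length
  \<open>2 * length w\<close> has entries. On a genuine instance nothing is lost: input components
  have at most \<open>length w\<close> digits, and each of the at most \<open>length w\<close> gates
  adds at most one more digit. The dimension \<open>k\<close> is not part of the input. Without
  complement, gate values do not depend on it, and it can be taken to be \<open>1\<close> or the
  length of an occurring vector, so it is at most \<open>length w\<close> as well. Trees are written
  in preorder, which is self-delimiting, so several of them can lie on one stack without separators.
  Of the three stacks, \<open>RD\<close> carries the data, \<open>RA\<close> parks saved trees and
  loop counters, and \<open>RB\<close> is scratch space.\<close>

datatype sym = SLeaf | SNode | SMark

datatype reg = RA | RB | RD

datatype com =
  SKIP
| HALT bool
| PUSH reg sym
| SEQ com com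
| IF reg com com
| LOOP reg com com

type_synonym stacks = "reg \<Rightarrow> sym list"

definition top :: "'a list \<Rightarrow> 'a option" where
  "top xs = (case xs of [] \<Rightarrow> None | x # _ \<Rightarrow> Some x)"

lemma top_simps [simp]: "top [] = None" "top (x # xs) = Some x"
  by (simp_all add: top_def)

datatype action = Nop | Psh reg sym | Pp reg

fun act :: "com list \<Rightarrow> action" where
  "act (PUSH r a # k) = Psh r a"
| "act (IF r c d # k) = Pp r"
| "act (LOOP r c d # k) = Pp r"
| "act _ = Nop"

fun nxt :: "com list \<Rightarrow> sym option \<Rightarrow> com list" where
  "nxt [] _ = []"
| "nxt (SKIP # k) _ = k"
| "nxt (HALT b # k) _ = HALT b # k"
| "nxt (PUSH r a # k) _ = k"
| "nxt (SEQ c d # k) _ = c # d # k"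
| "nxt (IF r c d # k) (Some SLeaf) = c # k"
| "nxt (IF r c d # k) (Some SNode) = d # k"
| "nxt (IF r c d # k) _ = k"
| "nxt (LOOP r c d # k) (Some SLeaf) = c # LOOP r c d # k"
| "nxt (LOOP r c d # k) (Some SNode) = d # LOOP r c d # k"
| "nxt (LOOP r c d # k) _ = k"

fun step :: "com list \<times> stacks \<Rightarrow> com list \<times> stacks" where
  "step (l, s) = (case act l of
     Nop \<Rightarrow> (nxt l None, s)
   | Psh r a \<Rightarrow> (nxt l None, s(r := a # s r))
   | Pp r \<Rightarrow> (nxt l (top (s r)), s(r := tl (s r))))"

text \<open>Over-approximates the nonempty control stacks reachable from \<open>[c]\<close>.
  Sequences and loops only append a fixed remainder to the control stacks of their parts, so the
  list is finite and can serve as the finite control of a Turing machine.\<close>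

primrec conts :: "com \<Rightarrow> com list list" where
  "conts SKIP = [[SKIP]]"
| "conts (HALT b) = [[HALT b]]"
| "conts (PUSH r a) = [[PUSH r a]]"
| "conts (SEQ c d) = [SEQ c d] # map (\<lambda>l. l @ [d]) (conts c) @ conts d"
| "conts (IF r c d) = [IF r c d] # conts c @ conts d"
| "conts (LOOP r c d) = [LOOP r c d] # map (\<lambda>l. l @ [LOOP r c d]) (conts c @ conts d)"

lemma conts_self: "[c] \<in> set (conts c)"
  by (cases c) auto

lemma conts_nonempty: "l \<in> set (conts c) \<Longrightarrow> l \<noteq> []"
  by (induction c arbitrary: l) auto

lemma nxt_append: "l \<noteq> [] \<Longrightarrow> nxt (l @ k) a = nxt l a @ k"
proof (cases l)
  case (Cons c l')
  then show ?thesis by (cases "(l, a)" rule: nxt.cases) auto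
qed simp

text \<open>Needed for the state set of the machine to be closed under transitions. In the sequence
  and loop cases \<open>nxt\<close> acts on the part above the appended remainder, because it only
  inspects the top command.\<close>

lemma nxt_conts: "l \<in> set (conts c) \<Longrightarrow> nxt l a = [] \<or> nxt l a \<in> set (conts c)"
proof (induction c arbitrary: l)
  case (SEQ c d)
  from SEQ.prems consider "l = [SEQ c d]" | l' where "l = l' @ [d]" "l' \<in> set (conts c)"
    | "l \<in> set (conts d)" by auto
  then show ?case
  proof cases
    case 1
    then show ?thesis using conts_self[of c] by (auto simp: image_iff intro!: bexI[of _ "[c]"])
  next
    case 2
    then have "nxt l a = nxt l' a @ [d]" using nxt_append conts_nonempty by blast
    then show ?thesis using SEQ.IH(1)[OF 2(2)] conts_self[of d] by auto
  next
    case 3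
    then show ?thesis using SEQ.IH(2)[OF 3] by auto
  qed
next
  case (IF r c d)
  from IF.prems consider "l = [IF r c d]" | "l \<in> set (conts c)" | "l \<in> set (conts d)" by auto
  then show ?case
  proof cases
    case 1
    then show ?thesis using conts_self by (cases "(l, a)" rule: nxt.cases) auto
  qed (use IF.IH in auto)
next
  case (LOOP r c d)
  from LOOP.prems consider "l = [LOOP r c d]"
    | l' where "l = l' @ [LOOP r c d]" "l' \<in> set (conts c) \<or> l' \<in> set (conts d)"
    by auto
  then show ?case
  proof cases
    case 1
    then show ?thesis using conts_self[of c] conts_self[of d]
      by (cases "(l, a)" rule: nxt.cases)
        (auto simp: image_iff intro!: bexI[of _ "[c]"] bexI[of _ "[d]"])
  next
    case 2
    then have "nxt l a = nxt l' a @ [LOOP r c d]" using nxt_append conts_nonempty by blast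
    moreover have "nxt l' a = [] \<or> nxt l' a \<in> set (conts c) \<or> nxt l' a \<in> set (conts d)"
      using LOOP.IH 2 by blast
    ultimately show ?thesis by auto
  qed
qed auto

section \<open>Simulation by a single tape\<close>

text \<open>Cell \<open>i \<ge> 0\<close> of the tape holds the \<open>i\<close>-th entries of the three stacks, counted
  from the bottom. A stack is addressed by walking right to its first free cell; since
  all cells passed on the way are non-blank, the way back ends at the blank cell \<open>-1\<close>.\<close>

type_synonym cell = "reg \<Rightarrow> sym option"

datatype phase = Scan | Return | Look

type_synonym tconf = "(com list \<times> phase) \<times> int \<times> (int \<Rightarrow> cell)"

text \<open>\<open>Look\<close> is entered one cell left of the first free one. If the track is
  empty there, the stack was empty and the head is on cell -1, so one move right brings it back to
  cell 0; otherwise this cell holds the top entry.\<close>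

fun delta :: "com list \<times> phase \<Rightarrow> cell \<Rightarrow> (com list \<times> phase) \<times> cell \<times> move" where
  "delta (l, Scan) x = (case act l of
     Nop \<Rightarrow> ((nxt l None, Scan), x, MStay)
   | Psh r a \<Rightarrow> if x r \<noteq> None then ((l, Scan), x, MRight)
       else ((nxt l None, Return), x(r := Some a), MLeft)
   | Pp r \<Rightarrow> if x r \<noteq> None then ((l, Scan), x, MRight) else ((l, Look), x, MLeft))"
| "delta (l, Return) x =
     (if x \<noteq> (\<lambda>_. None) then ((l, Return), x, MLeft) else ((l, Scan), x, MRight))"
| "delta (l, Look) x = (case act l of
     Pp r \<Rightarrow> if x r = None then ((nxt l None, Scan), x, MRight)
       else ((nxt l (x r), Return), x(r := None), MLeft)
   | _ \<Rightarrow> ((l, Look), x, MStay))"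

fun shift :: "move \<Rightarrow> int" where
  "shift MLeft = -1" | "shift MRight = 1" | "shift MStay = 0"

fun tstep :: "tconf \<Rightarrow> tconf" where
  "tstep (q, p, f) = (case delta q (f p) of (q', x, m) \<Rightarrow> (q', p + shift m, f(p := x)))"

definition nth_opt :: "'a list \<Rightarrow> nat \<Rightarrow> 'a option" where
  "nth_opt xs i = (if i < length xs then Some (xs ! i) else None)"

definition tape :: "stacks \<Rightarrow> int \<Rightarrow> cell" where
  "tape s i = (\<lambda>r. if i < 0 then None else nth_opt (rev (s r)) (nat i))"

lemma tape_None_iff: "tape s i r = None \<longleftrightarrow> i < 0 \<or> i \<ge> int (length (s r))"
  by (auto simp: tape_def nth_opt_def)

lemma tape_push: "tape (s(r := a # s r)) = (tape s)(int (length (s r)) := (tape s (int (length (s r))))(r := Some a))"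
proof (intro ext)
  fix i r'
  show "tape (s(r := a # s r)) i r' = ((tape s)(int (length (s r)) := (tape s (int (length (s r))))(r := Some a))) i r'"
    by (cases "i < 0"; cases "r' = r"; cases "nat i < length (s r)"; cases "i = int (length (s r))")
      (auto simp: tape_def nth_opt_def nth_append)
qed

lemma tape_pop: "s r = a # x \<Longrightarrow> tape (s(r := x)) = (tape s)(int (length x) := (tape s (int (length x)))(r := None))"
proof (intro ext)
  fix i r'
  assume "s r = a # x"
  then show "tape (s(r := x)) i r' = ((tape s)(int (length x) := (tape s (int (length x)))(r := None))) i r'"
    by (cases "i < 0"; cases "r' = r"; cases "nat i < length x"; cases "i = int (length x)")
      (auto simp: tape_def nth_opt_def nth_append)
qed

lemma tape_top: "s r = a # x \<Longrightarrow> tape s (int (length x)) r = Some a"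
  by (simp add: tape_def nth_opt_def nth_append)

lemma tstep_return:
  assumes "\<And>i. 0 \<le> i \<Longrightarrow> i < int n \<Longrightarrow> f i \<noteq> (\<lambda>_. None)" "f (-1) = (\<lambda>_. None)"
  shows "(tstep ^^ Suc n) ((l, Return), int n - 1, f) = ((l, Scan), 0, f)"
  using assms
proof (induction n)
  case 0
  then show ?case by (simp add: fun_upd_idem)
next
  case (Suc n)
  have "f (int n) \<noteq> (\<lambda>_. None)" using Suc.prems by simp
  then have "tstep ((l, Return), int (Suc n) - 1, f) = ((l, Return), int n - 1, f)"
    by (simp add: fun_upd_idem)
  then show ?case using Suc by (simp only: funpow_Suc_right[of "Suc n"] o_apply) simp
qed

lemma tstep_scan:
  assumes "act l = Psh r a \<or> act l = Pp r" "\<And>i. 0 \<le> i \<Longrightarrow> i < int n \<Longrightarrow> f i r \<noteq> None"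
  shows "(tstep ^^ n) ((l, Scan), 0, f) = ((l, Scan), int n, f)"
  using assms(2)
proof (induction n)
  case (Suc n)
  have "f (int n) r \<noteq> None" using Suc.prems by simp
  then show ?case using Suc assms(1) by (auto simp: fun_upd_idem)
qed simp

text \<open>At worst the head walks to the top of one stack and back, so a command costs a number of
  moves linear in the stack height. The head ends on cell 0 in phase \<open>Scan\<close>, ready for
  the next command.\<close>

lemma tstep_step:
  assumes "\<And>r. length (s r) \<le> m" "step (l, s) = (l', s')"
  shows "\<exists>t \<le> 2 * m + 3. (tstep ^^ t) ((l, Scan), 0, tape s) = ((l', Scan), 0, tape s')"
proof (cases "act l")
  case Nop
  then have "(tstep ^^ 1) ((l, Scan), 0, tape s) = ((l', Scan), 0, tape s')"
    using assms by (simp add: fun_upd_idem)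
  moreover have "1 \<le> 2 * m + 3" by simp
  ultimately show ?thesis by blast
next
  case (Psh r a)
  let ?n = "length (s r)"
  have sc: "(tstep ^^ ?n) ((l, Scan), 0, tape s) = ((l, Scan), int ?n, tape s)"
    by (rule tstep_scan[where r = r and a = a]) (auto simp: Psh tape_None_iff)
  have none: "tape s (int ?n) r = None" by (simp add: tape_None_iff)
  have s': "s' = s(r := a # s r)" and l': "l' = nxt l None" using assms(2) Psh by auto
  have st: "tstep ((l, Scan), int ?n, tape s) = ((l', Return), int ?n - 1, tape s')"
    using none Psh by (simp add: s' l' tape_push)
  have re: "(tstep ^^ Suc ?n) ((l', Return), int ?n - 1, tape s') = ((l', Scan), 0, tape s')"
  proof (rule tstep_return)
    fix i assume "0 \<le> i" "i < int ?n"
    then have "tape s' i r \<noteq> None" by (simp add: tape_None_iff s')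
    then show "tape s' i \<noteq> (\<lambda>_. None)" by metis
  qed (simp add: tape_def)
  have "(tstep ^^ (Suc ?n + (1 + ?n))) ((l, Scan), 0, tape s) = ((l', Scan), 0, tape s')"
    using sc st re by (simp only: funpow_add o_apply) simp
  moreover have "Suc ?n + (1 + ?n) \<le> 2 * m + 3" using assms(1)[of r] by simp
  ultimately show ?thesis by blast
next
  case (Pp r)
  let ?n = "length (s r)"
  have sc: "(tstep ^^ ?n) ((l, Scan), 0, tape s) = ((l, Scan), int ?n, tape s)"
    by (rule tstep_scan[where r = r and a = undefined]) (auto simp: Pp tape_None_iff)
  have none: "tape s (int ?n) r = None" by (simp add: tape_None_iff)
  have st: "tstep ((l, Scan), int ?n, tape s) = ((l, Look), int ?n - 1, tape s)"
    using none Pp by (simp add: fun_upd_idem)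
  have s': "s' = s(r := tl (s r))" and l': "l' = nxt l (top (s r))" using assms(2) Pp by auto
  show ?thesis
  proof (cases "s r")
    case Nil
    then have "tape s (-1) r = None" by (simp add: tape_def)
    then have "tstep ((l, Look), int ?n - 1, tape s) = ((l', Scan), 0, tape s')"
      using Nil Pp by (simp add: s' l' fun_upd_idem)
    then have "(tstep ^^ (1 + (1 + ?n))) ((l, Scan), 0, tape s) = ((l', Scan), 0, tape s')"
      using sc st by (simp only: funpow_add o_apply) simp
    moreover have "1 + (1 + ?n) \<le> 2 * m + 3" using Nil by simp
    ultimately show ?thesis by blast
  next
    case (Cons a x)
    have s'': "s' = s(r := x)" using s' Cons by simp
    have pos: "int ?n - 1 = int (length x)" using Cons by simp
    have lk: "tstep ((l, Look), int ?n - 1, tape s) = ((l', Return), int (length x) - 1, tape s')"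
      unfolding pos using Cons Pp by (simp add: s'' l' tape_top tape_pop[of s r a x, OF Cons])
    have re: "(tstep ^^ Suc (length x)) ((l', Return), int (length x) - 1, tape s')
        = ((l', Scan), 0, tape s')"
    proof (rule tstep_return)
      fix i assume "0 \<le> i" "i < int (length x)"
      then have "tape s' i r \<noteq> None" by (simp add: tape_None_iff s'')
      then show "tape s' i \<noteq> (\<lambda>_. None)" by metis
    qed (simp add: tape_def)
    have "(tstep ^^ (Suc (length x) + (1 + (1 + ?n)))) ((l, Scan), 0, tape s) = ((l', Scan), 0, tape s')"
      using sc st lk re by (simp only: funpow_add o_apply) simp
    moreover have "Suc (length x) + (1 + (1 + ?n)) \<le> 2 * m + 3"
      using assms(1)[of r] Cons by simp
    ultimately show ?thesis by blast
  qed
qed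

lemma step_length: "step (l, s) = (l', s') \<Longrightarrow> length (s' r) \<le> Suc (length (s r))"
  by (auto split: action.splits)

text \<open>Every step raises a stack by at most one entry, so \<open>m + n\<close> bounds all
  heights during \<open>n\<close> steps.\<close>

lemma tstep_steps:
  assumes "\<And>r. length (s r) \<le> m" "(step ^^ n) (l, s) = (l', s')"
  shows "\<exists>t \<le> n * (2 * (m + n) + 3). (tstep ^^ t) ((l, Scan), 0, tape s) = ((l', Scan), 0, tape s')"
  using assms
proof (induction n arbitrary: l s m)
  case 0
  then show ?case by simp
next
  case (Suc n)
  obtain l1 s1 where 1: "step (l, s) = (l1, s1)" by fastforce
  have "(step ^^ n) (l1, s1) = (l', s')"
    using Suc.prems(2) 1 by (simp only: funpow_Suc_right o_apply)
  moreover have "length (s1 r) \<le> Suc m" for r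
    using step_length[OF 1, of r] Suc.prems(1)[of r] by simp
  ultimately obtain t where t: "t \<le> n * (2 * (Suc m + n) + 3)"
    "(tstep ^^ t) ((l1, Scan), 0, tape s1) = ((l', Scan), 0, tape s')"
    using Suc.IH[of s1 "Suc m" l1] by blast
  obtain u where u: "u \<le> 2 * m + 3" "(tstep ^^ u) ((l, Scan), 0, tape s) = ((l1, Scan), 0, tape s1)"
    using tstep_step[OF Suc.prems(1) 1] by blast
  have "(tstep ^^ (t + u)) ((l, Scan), 0, tape s) = ((l', Scan), 0, tape s')"
    using t u by (simp add: funpow_add)
  moreover have "t + u \<le> Suc n * (2 * (m + Suc n) + 3)"
    using t(1) u(1) by (simp add: algebra_simps)
  ultimately show ?case by blast
qed

section \<open>Turing machines in the numeric format\<close>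

fun sym_num :: "sym option \<Rightarrow> nat" where
  "sym_num None = 0" | "sym_num (Some SLeaf) = 1" | "sym_num (Some SNode) = 2" | "sym_num (Some SMark) = 3"

definition num_sym :: "nat \<Rightarrow> sym option" where
  "num_sym n = (if n = 0 then None else if n = 1 then Some SLeaf else if n = 2 then Some SNode else Some SMark)"

lemma num_sym_sym_num [simp]: "num_sym (sym_num x) = x"
  by (cases x rule: sym_num.cases) (auto simp: num_sym_def)

lemma sym_num_less: "sym_num x < 4"
  by (cases x rule: sym_num.cases) auto

text \<open>Input bits are the symbols 1 and 2, hence appear as \<open>SLeaf\<close> and \<open>SNode\<close> in track \<open>RA\<close>.\<close>

definition cell_num :: "cell \<Rightarrow> nat" where
  "cell_num g = sym_num (g RA) + 4 * sym_num (g RB) + 16 * sym_num (g RD)"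

definition num_cell :: "nat \<Rightarrow> cell" where
  "num_cell n r = num_sym (case r of RA \<Rightarrow> n mod 4 | RB \<Rightarrow> n div 4 mod 4 | RD \<Rightarrow> n div 16)"

lemma num_cell_cell_num [simp]: "num_cell (cell_num g) = g"
proof
  fix r
  have m: "(a + 4 * k) mod 4 = a" "(a + 4 * k) div 4 = k" if "a < 4" for a k :: nat
    using that by auto
  have eq: "cell_num g = sym_num (g RA) + 4 * (sym_num (g RB) + 4 * sym_num (g RD))"
    by (simp add: cell_num_def)
  have "cell_num g div 16 = cell_num g div 4 div 4"
    by (simp only: div_mult2_eq[symmetric]) simp
  also have "\<dots> = sym_num (g RD)"
    by (simp only: eq m sym_num_less)
  moreover have "cell_num g mod 4 = sym_num (g RA)" "cell_num g div 4 mod 4 = sym_num (g RB)"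
    by (simp_all only: eq m sym_num_less)
  ultimately show "num_cell (cell_num g) r = g r"
    by (cases r) (simp_all add: num_cell_def)
qed

lemma cell_num_less: "cell_num g < 64"
  using sym_num_less[of "g RA"] sym_num_less[of "g RB"] sym_num_less[of "g RD"]
  by (simp add: cell_num_def)

lemma cell_num_blank [simp]: "cell_num (\<lambda>_. None) = 0"
  by (simp add: cell_num_def)

text \<open>The start state comes first because \<open>tm_init\<close> uses state 0; it recurs in
  the product, and \<open>state_num\<close> takes the least index. The empty control stack and the
  two halting ones are included so that the list is closed under \<open>delta\<close> and contains
  the accepting and the rejecting state.\<close>

definition tm_states :: "com \<Rightarrow> (com list \<times> phase) list" where
  "tm_states c = ([c], Scan) # List.product ([] # [HALT True] # [HALT False] # conts c) [Scan, Return, Look]"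

text \<open>States outside of the list are junk and mapped to 0.\<close>

definition state_num :: "com \<Rightarrow> com list \<times> phase \<Rightarrow> nat" where
  "state_num c q = (if q \<in> set (tm_states c)
     then LEAST i. i < length (tm_states c) \<and> tm_states c ! i = q else 0)"

lemma state_num_nth:
  assumes "q \<in> set (tm_states c)"
  shows "state_num c q < length (tm_states c)" "tm_states c ! state_num c q = q"
proof -
  have "\<exists>i. i < length (tm_states c) \<and> tm_states c ! i = q"
    using assms by (auto simp: in_set_conv_nth)
  from LeastI_ex[OF this]
  show "state_num c q < length (tm_states c)" "tm_states c ! state_num c q = q"
    using assms by (auto simp: state_num_def)
qed

lemma state_num_less: "state_num c q < length (tm_states c)"
  using state_num_nth(1)[of q c] by (cases "q \<in> set (tm_states c)") (auto simp: state_num_def tm_states_def)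

lemma state_num_start: "state_num c ([c], Scan) = 0"
  by (auto simp: state_num_def tm_states_def intro: Least_eq_0)

definition com_tm :: "com \<Rightarrow> tm" where
  "com_tm c = \<lparr>tm_nstates = length (tm_states c), tm_nsyms = 64,
     tm_delta = (\<lambda>q s. case delta (tm_states c ! q) (num_cell s) of
        (q', x, m) \<Rightarrow> (state_num c q', cell_num x, m)),
     tm_accept = state_num c ([HALT True], Scan), tm_reject = state_num c ([HALT False], Scan)\<rparr>"

lemma HALT_states: "([HALT b], Scan) \<in> set (tm_states c)"
  by (cases b) (auto simp: tm_states_def)

lemma valid_com_tm: "valid_tm (com_tm c)"
proof -
  have "state_num c ([HALT True], Scan) \<noteq> state_num c ([HALT False], Scan)"
    using state_num_nth(2)[OF HALT_states[of True c]] state_num_nth(2)[OF HALT_states[of False c]]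
    by (metis Pair_inject com.inject(1) list.inject)
  then show ?thesis
    by (simp add: valid_tm_def com_tm_def state_num_less cell_num_less split: prod.split)
qed

section \<open>Correspondence between list tapes and integer-indexed tapes\<close>

definition nth_blank :: "nat list \<Rightarrow> nat \<Rightarrow> nat" where
  "nth_blank xs i = (if i < length xs then xs ! i else 0)"

lemma nth_blank_simps [simp]:
  "nth_blank [] i = 0" "nth_blank (x # xs) 0 = x" "nth_blank (x # xs) (Suc i) = nth_blank xs i"
  by (auto simp: nth_blank_def)

text \<open>Cells beyond the ends of both lists count as blank. This agrees with
  \<open>tm_step\<close>, which supplies a blank when moving left from an empty list; so the tape is
  infinite in both directions and cell -1 is available as an end marker.\<close>

fun represents :: "com \<Rightarrow> config \<Rightarrow> tconf \<Rightarrow> bool" where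
  "represents c (n, ls, rs) (q, p, f) \<longleftrightarrow> q \<in> set (tm_states c) \<and> n = state_num c q \<and>
     (\<forall>i. nth_blank rs i = cell_num (f (p + int i))) \<and>
     (\<forall>i. nth_blank ls i = cell_num (f (p - 1 - int i)))"

lemma delta_states:
  assumes "q \<in> set (tm_states c)" "delta q x = (q', y, m)"
  shows "q' \<in> set (tm_states c)"
proof -
  obtain l ph where q: "q = (l, ph)" by fastforce
  have ph: "ph' \<in> {Scan, Return, Look}" for ph' by (cases ph') auto
  have mem: "(k, ph') \<in> set (tm_states c)" if "k = l \<or> k = nxt l a" for k a ph'
  proof -
    have "l \<in> set ([] # [HALT True] # [HALT False] # conts c)"
      using assms(1) conts_self[of c] unfolding q tm_states_def by auto
    then have "nxt l a \<in> set ([] # [HALT True] # [HALT False] # conts c)"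
      using nxt_conts[of l c a] by auto
    then have "k \<in> set ([] # [HALT True] # [HALT False] # conts c)"
      using that \<open>l \<in> _\<close> by blast
    then show ?thesis using ph[of ph'] unfolding tm_states_def by auto
  qed
  obtain k ph' where q': "q' = (k, ph')" by fastforce
  have "\<exists>a. k = l \<or> k = nxt l a"
    using assms(2) unfolding q q' by (cases ph) (auto split: action.splits if_splits)
  then show ?thesis using mem q' by blast
qed

lemma represents_step:
  assumes "represents c cf (q, p, f)"
  shows "represents c (tm_step (com_tm c) cf) (tstep (q, p, f))"
proof -
  obtain n ls rs where cf: "cf = (n, ls, rs)" by (cases cf)
  have q: "q \<in> set (tm_states c)" and n: "n = state_num c q"
    and rs: "\<And>i. nth_blank rs i = cell_num (f (p + int i))"
    and ls: "\<And>i. nth_blank ls i = cell_num (f (p - 1 - int i))"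
    using assms by (auto simp: cf)
  show ?thesis
  proof (cases "n = tm_accept (com_tm c) \<or> n = tm_reject (com_tm c)")
    case True
    then have "q = ([HALT True], Scan) \<or> q = ([HALT False], Scan)"
      using state_num_nth(2)[OF q] state_num_nth(2)[OF HALT_states[of True c]]
        state_num_nth(2)[OF HALT_states[of False c]] n
      by (metis com_tm_def tm.select_convs(4,5))
    \<comment> \<open>\<open>tm_step\<close> freezes halting states. On the other side
      \<open>HALT\<close> reproduces itself under \<open>nxt\<close> and leaves cell and head alone,
      so both machines stand still.\<close>
    then have "tstep (q, p, f) = (q, p, f)" by auto
    then show ?thesis using True assms by (auto simp: tm_step_def cf simp del: tstep.simps)
  next
    case False
    obtain q' x m where d: "delta q (f p) = (q', x, m)" using prod_cases3 by blast
    have q': "q' \<in> set (tm_states c)" using delta_states[OF q d] .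
    define s where "s = (case rs of [] \<Rightarrow> 0 | x # _ \<Rightarrow> x)"
    define rs' where "rs' = (case rs of [] \<Rightarrow> [] | _ # xs \<Rightarrow> xs)"
    have s: "s = cell_num (f p)" using rs[of 0] by (auto simp: s_def split: list.splits)
    have rs': "nth_blank rs' i = cell_num (f (p + 1 + int i))" for i
      using rs[of "Suc i"] by (auto simp: rs'_def algebra_simps split: list.splits)
    have del: "tm_delta (com_tm c) n s = (state_num c q', cell_num x, m)"
      using d by (simp add: com_tm_def n s state_num_nth(2)[OF q])
    have upd: "nth_blank (cell_num x # rs') i = cell_num ((f(p := x)) (p + int i))" for i
      using rs'[of "i - 1"] by (cases i) (auto simp: algebra_simps)
    have ls': "nth_blank ls i = cell_num ((f(p := x)) (p - 1 - int i))" for i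
      using ls[of i] by simp
    show ?thesis
    proof (cases m)
      case MStay
      then have "tm_step (com_tm c) cf = (state_num c q', ls, cell_num x # rs')"
        using False del by (simp add: tm_step_def cf s_def[symmetric] rs'_def[symmetric])
      then show ?thesis using q' d MStay upd ls' by simp
    next
      case MRight
      then have "tm_step (com_tm c) cf = (state_num c q', cell_num x # ls, rs')"
        using False del by (simp add: tm_step_def cf s_def[symmetric] rs'_def[symmetric])
      moreover have "nth_blank (cell_num x # ls) i = cell_num ((f(p := x)) (p + 1 - 1 - int i))" for i
        using ls'[of "i - 1"] by (cases i) (auto simp: algebra_simps)
      ultimately show ?thesis using q' d MRight rs' by simp
    next
      case MLeft
      define h where "h = (case ls of [] \<Rightarrow> 0 | x # _ \<Rightarrow> x)"
      define t where "t = (case ls of [] \<Rightarrow> [] | _ # xs \<Rightarrow> xs)"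
      have "tm_step (com_tm c) cf = (state_num c q', t, h # cell_num x # rs')"
        using False del MLeft
        by (simp add: tm_step_def cf s_def[symmetric] rs'_def[symmetric] h_def t_def split: list.splits)
      moreover have "nth_blank t i = cell_num ((f(p := x)) (p - 1 - 1 - int i))" for i
        using ls'[of "Suc i"] by (auto simp: t_def algebra_simps split: list.splits)
      moreover have "h = cell_num (f (p - 1))"
        using ls[of 0] by (auto simp: h_def split: list.splits)
      then have "nth_blank (h # cell_num x # rs') i = cell_num ((f(p := x)) (p - 1 + int i))" for i
        using upd[of "i - 1"] by (cases i) (auto simp: algebra_simps)
      ultimately show ?thesis using q' d MLeft by simp
    qed
  qed
qed

lemma represents_steps:
  assumes "represents c cf tc"
  shows "represents c ((tm_step (com_tm c) ^^ t) cf) ((tstep ^^ t) tc)"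
proof (induction t)
  case 0
  then show ?case using assms by simp
next
  case (Suc t)
  obtain q p f where "(tstep ^^ t) tc = (q, p, f)" by (cases "(tstep ^^ t) tc")
  then show ?case using represents_step[of c _ q p f] Suc by simp
qed

definition bit_sym :: "bool \<Rightarrow> sym" where
  "bit_sym b = (if b then SNode else SLeaf)"

text \<open>The input needs no preparation: with the bottom of a stack at cell 0, the written tape
  already is the stack in track \<open>RA\<close>, its last bit on top, whence the reversal.\<close>

definition init_stacks :: "bool list \<Rightarrow> stacks" where
  "init_stacks w = (\<lambda>r. if r = RA then rev (map bit_sym w) else [])"

lemma represents_init: "represents c (tm_init w) (([c], Scan), 0, tape (init_stacks w))"
proof -
  have "([c], Scan) \<in> set (tm_states c)" by (simp add: tm_states_def)
  moreover have "cell_num (tape (init_stacks w) (- 1 - int i)) = 0" for i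
    by (simp add: tape_def)
  moreover have "nth_blank (map (\<lambda>b. if b then 2 else 1) w) i = cell_num (tape (init_stacks w) (int i))" for i
    by (auto simp: tape_def init_stacks_def nth_blank_def nth_opt_def cell_num_def bit_sym_def)
  ultimately show ?thesis by (simp add: tm_init_def state_num_start)
qed

theorem com_tm_decides:
  assumes "\<And>w. \<exists>n \<le> T (length w). \<exists>s. (step ^^ n) ([c], init_stacks w) = ([HALT (w \<in> L)], s)"
  shows "decides_in_time (com_tm c) L (\<lambda>m. T m * (2 * (m + T m) + 3))"
  unfolding decides_in_time_def
proof
  fix w
  obtain n s where n: "n \<le> T (length w)" "(step ^^ n) ([c], init_stacks w) = ([HALT (w \<in> L)], s)"
    using assms by blast
  have "length (init_stacks w r) \<le> length w" for r by (simp add: init_stacks_def)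
  then obtain t where t: "t \<le> n * (2 * (length w + n) + 3)"
    "(tstep ^^ t) (([c], Scan), 0, tape (init_stacks w)) = (([HALT (w \<in> L)], Scan), 0, tape s)"
    using tstep_steps[OF _ n(2)] by blast
  have "n * (2 * (length w + n) + 3) \<le> T (length w) * (2 * (length w + T (length w)) + 3)"
    using n(1) by (intro mult_mono) auto
  then have "t \<le> T (length w) * (2 * (length w + T (length w)) + 3)" using t(1) by linarith
  moreover have "fst ((tm_step (com_tm c) ^^ t) (tm_init w)) = state_num c ([HALT (w \<in> L)], Scan)"
    using represents_steps[OF represents_init[of c w], of t] unfolding t(2)
    by (cases "(tm_step (com_tm c) ^^ t) (tm_init w)") simp
  moreover have "tm_accept (com_tm c) \<noteq> tm_reject (com_tm c)"
    using valid_com_tm[of c] by (simp add: valid_tm_def)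
  ultimately show "\<exists>t \<le> T (length w) * (2 * (length w + T (length w)) + 3).
       let q = fst ((tm_step (com_tm c) ^^ t) (tm_init w)) in
        (q = tm_accept (com_tm c) \<or> q = tm_reject (com_tm c)) \<and> (q = tm_accept (com_tm c) \<longleftrightarrow> w \<in> L)"
    by (intro exI[of _ t]) (cases "w \<in> L"; simp add: com_tm_def Let_def)
qed

section \<open>Polynomial bounds\<close>

text \<open>Through \<open>polyb_le\<close> this is the class of functions bounded by a polynomial,
  monotone or not, so crude upper bounds are admissible everywhere.\<close>

inductive polyb :: "(nat \<Rightarrow> nat) \<Rightarrow> bool" where
  polyb_const: "polyb (\<lambda>_. c)"
| polyb_id: "polyb (\<lambda>n. n)"
| polyb_add: "polyb f \<Longrightarrow> polyb g \<Longrightarrow> polyb (\<lambda>n. f n + g n)"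
| polyb_mult: "polyb f \<Longrightarrow> polyb g \<Longrightarrow> polyb (\<lambda>n. f n * g n)"
| polyb_le: "polyb g \<Longrightarrow> (\<And>n. f n \<le> g n) \<Longrightarrow> polyb f"

lemma polyb_Suc: "polyb f \<Longrightarrow> polyb (\<lambda>n. Suc (f n))"
  using polyb_add[OF polyb_const[of 1]] by simp

lemma polyb_comp: "polyb f \<Longrightarrow> polyb g \<Longrightarrow> polyb (\<lambda>n. f (g n))"
proof (induction f rule: polyb.induct)
  case (polyb_le h f)
  then show ?case by (intro polyb.polyb_le[of "\<lambda>n. h (g n)" "\<lambda>n. f (g n)"]) auto
qed (auto intro: polyb_const polyb_add polyb_mult)

lemmas polyb_rules = polyb_const polyb_id polyb_add polyb_mult polyb_Suc

text \<open>Composing time bounds requires monotonicity: the second program receives an intermediate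
  result whose size is only known to lie below a bound.\<close>

lemma polyb_mono_majorant:
  assumes "polyb f"
  obtains g where "polyb g" "mono g" "\<And>n. f n \<le> g n"
proof -
  have "\<exists>g. polyb g \<and> mono g \<and> (\<forall>n. f n \<le> g n)"
    using assms
  proof (induction f rule: polyb.induct)
    case (polyb_const c)
    then show ?case using polyb.polyb_const[of c] by (intro exI[of _ "\<lambda>_. c"]) (auto simp: mono_def)
  next
    case polyb_id
    then show ?case using polyb.polyb_id by (intro exI[of _ "\<lambda>n. n"]) (auto simp: mono_def)
  next
    case (polyb_add f g)
    then obtain f' g' where "polyb f'" "mono f'" "\<forall>n. f n \<le> f' n" "polyb g'" "mono g'" "\<forall>n. g n \<le> g' n"
      by blast
    then show ?case
      by (intro exI[of _ "\<lambda>n. f' n + g' n"]) (auto simp: mono_def intro!: polyb.polyb_add add_mono)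
  next
    case (polyb_mult f g)
    then obtain f' g' where "polyb f'" "mono f'" "\<forall>n. f n \<le> f' n" "polyb g'" "mono g'" "\<forall>n. g n \<le> g' n"
      by blast
    then show ?case
      by (intro exI[of _ "\<lambda>n. f' n * g' n"]) (auto simp: mono_def intro!: polyb.polyb_mult mult_mono)
  next
    case (polyb_le g f)
    then show ?case by (meson order_trans)
  qed
  then show thesis using that by blast
qed

lemma polyb_monomial:
  assumes "polyb f"
  shows "\<exists>c d. \<forall>n. f n \<le> c * n ^ d + c"
proof -
  \<comment> \<open>The base \<open>Suc n\<close> is at least 1, so exponents can be raised to a
    common value; for base \<open>n\<close> this would fail at 0.\<close>
  have "\<exists>c d. \<forall>n. f n \<le> c * Suc n ^ d"
    using assms
  proof (induction f rule: polyb.induct)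
    case (polyb_const c)
    show ?case by (intro exI[of _ c] exI[of _ 0]) simp
  next
    case polyb_id
    show ?case by (intro exI[of _ 1] exI[of _ 1]) simp
  next
    case (polyb_add f g)
    then obtain c d c' d' where 1: "\<And>n. f n \<le> c * Suc n ^ d" "\<And>n. g n \<le> c' * Suc n ^ d'" by blast
    have "f n + g n \<le> (c + c') * Suc n ^ (d + d')" for n
    proof -
      have "c * Suc n ^ d \<le> c * Suc n ^ (d + d')" "c' * Suc n ^ d' \<le> c' * Suc n ^ (d + d')"
        by (intro mult_left_mono power_increasing; simp)+
      then show ?thesis using 1[of n] unfolding distrib_right by linarith
    qed
    then show ?case by blast
  next
    case (polyb_mult f g)
    then obtain c d c' d' where 1: "\<And>n. f n \<le> c * Suc n ^ d" "\<And>n. g n \<le> c' * Suc n ^ d'" by blast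
    have "f n * g n \<le> (c * c') * Suc n ^ (d + d')" for n
      using mult_mono[OF 1(1)[of n] 1(2)[of n]] by (simp add: power_add mult_ac)
    then show ?case by blast
  next
    case (polyb_le g f)
    then show ?case by (meson order_trans)
  qed
  then obtain c d where 1: "\<And>n. f n \<le> c * Suc n ^ d" by blast
  have "Suc n ^ d \<le> 2 ^ d * n ^ d + 2 ^ d" for n
  proof (cases n)
    case 0
    then show ?thesis by (simp add: Suc_leI trans_le_add2)
  next
    case (Suc m)
    then have "Suc n ^ d \<le> (2 * n) ^ d" by (intro power_mono) auto
    then show ?thesis by (simp add: power_mult_distrib)
  qed
  then have "f n \<le> (c * 2 ^ d) * n ^ d + c * 2 ^ d" for n
    using order_trans[OF 1[of n] mult_le_mono2[of "Suc n ^ d" "2 ^ d * n ^ d + 2 ^ d" c]]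
    by (simp add: algebra_simps)
  then show ?thesis by blast
qed

section \<open>Timed execution of stack programs\<close>

text \<open>The step count \<open>m\<close> is chosen before the continuation \<open>k\<close>, so
  executions compose in front of any continuation; \<open>n\<close> is only an upper bound, so costs
  can be rounded up.\<close>

definition runs :: "com \<Rightarrow> stacks \<Rightarrow> nat \<Rightarrow> stacks \<Rightarrow> bool" where
  "runs c s n s' \<longleftrightarrow> (\<exists>m \<le> n. \<forall>k. (step ^^ m) (c # k, s) = (k, s'))"

definition mk :: "sym list \<Rightarrow> sym list \<Rightarrow> sym list \<Rightarrow> stacks" where
  "mk a b d r = (case r of RA \<Rightarrow> a | RB \<Rightarrow> b | RD \<Rightarrow> d)"

lemma mk_simps [simp]: "mk a b d RA = a" "mk a b d RB = b" "mk a b d RD = d"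
  "(mk a b d)(RA := x) = mk x b d" "(mk a b d)(RB := x) = mk a x d" "(mk a b d)(RD := x) = mk a b x"
  by (auto simp: mk_def fun_eq_iff split: reg.split)

lemma runs_mono: "runs c s m s' \<Longrightarrow> m \<le> n \<Longrightarrow> runs c s n s'"
  unfolding runs_def by (meson order_trans)

lemma runs_first:
  assumes "\<And>k. step (c # k, s) = (c' # k, s')" "runs c' s' n s''"
  shows "runs c s (Suc n) s''"
proof -
  obtain m where m: "m \<le> n" "\<And>k. (step ^^ m) (c' # k, s') = (k, s'')"
    using assms(2) by (auto simp: runs_def)
  have "(step ^^ Suc m) (c # k, s) = (k, s'')" for k
    using m assms(1) by (simp only: funpow_Suc_right o_apply)
  then show ?thesis using m(1) unfolding runs_def by (meson Suc_le_mono)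
qed

lemma runs_single: "(\<And>k. step (c # k, s) = (k, s')) \<Longrightarrow> runs c s 1 s'"
  unfolding runs_def by (intro exI[of _ 1]) auto

lemma runs_then:
  assumes "\<And>k. step (c # k, s) = (c' # c'' # k, s1)" "runs c' s1 m s2" "runs c'' s2 n s3"
  shows "runs c s (Suc (m + n)) s3"
proof -
  obtain i j where m: "i \<le> m" "\<And>k. (step ^^ i) (c' # k, s1) = (k, s2)"
    "j \<le> n" "\<And>k. (step ^^ j) (c'' # k, s2) = (k, s3)"
    using assms(2,3) by (auto simp: runs_def)
  have "(step ^^ ((j + i) + 1)) (c # k, s) = (k, s3)" for k
    unfolding funpow_add o_apply using m assms(1) by simp
  moreover have "j + i + 1 \<le> Suc (m + n)" using m by simp
  ultimately show ?thesis unfolding runs_def by blast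
qed

lemma runs_SEQ: "runs c s m s' \<Longrightarrow> runs d s' n s'' \<Longrightarrow> runs (SEQ c d) s (Suc (m + n)) s''"
  by (rule runs_then) auto

lemma runs_SKIP: "runs SKIP s 1 s"
  by (rule runs_single) auto

lemma runs_PUSH:
  "runs (PUSH RA x) (mk a b d) 1 (mk (x # a) b d)"
  "runs (PUSH RB x) (mk a b d) 1 (mk a (x # b) d)"
  "runs (PUSH RD x) (mk a b d) 1 (mk a b (x # d))"
  by (rule runs_single; simp)+

lemma runs_IF:
  "runs c (mk a b d) n s \<Longrightarrow> runs (IF RD c e) (mk a b (SLeaf # d)) (Suc n) s"
  "runs e (mk a b d) n s \<Longrightarrow> runs (IF RD c e) (mk a b (SNode # d)) (Suc n) s"
  by (rule runs_first; simp)+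

lemma runs_LOOP:
  "runs c (mk a b d) m s \<Longrightarrow> runs (LOOP RA c e) s n s' \<Longrightarrow> runs (LOOP RA c e) (mk (SLeaf # a) b d) (Suc (m + n)) s'"
  "runs e (mk a b d) m s \<Longrightarrow> runs (LOOP RA c e) s n s' \<Longrightarrow> runs (LOOP RA c e) (mk (SNode # a) b d) (Suc (m + n)) s'"
  "runs c (mk a b d) m s \<Longrightarrow> runs (LOOP RB c e) s n s' \<Longrightarrow> runs (LOOP RB c e) (mk a (SLeaf # b) d) (Suc (m + n)) s'"
  "runs e (mk a b d) m s \<Longrightarrow> runs (LOOP RB c e) s n s' \<Longrightarrow> runs (LOOP RB c e) (mk a (SNode # b) d) (Suc (m + n)) s'"
  by (rule runs_then; auto)+

lemma runs_LOOP_exit: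
  "runs (LOOP RA c e) (mk (SMark # a) b d) 1 (mk a b d)"
  "runs (LOOP RB c e) (mk a (SMark # b) d) 1 (mk a b d)"
  "runs (LOOP RA c e) (mk [] b d) 1 (mk [] b d)"
  by (rule runs_single; simp)+

text \<open>A step pushes at most one symbol, so every time bound yields a size bound for the
  result.\<close>

lemma runs_size:
  assumes "runs c s n s'"
  shows "length (s' RD) \<le> length (s RD) + n"
proof -
  obtain m where m: "m \<le> n" "(step ^^ m) ([c], s) = ([], s')" using assms by (auto simp: runs_def)
  have "(step ^^ m) (l, s) = (l', s') \<Longrightarrow> length (s' RD) \<le> length (s RD) + m" for l l' s'
  proof (induction m arbitrary: l' s')
    case (Suc m)
    obtain l1 s1 where 1: "(step ^^ m) (l, s) = (l1, s1)" by fastforce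
    then show ?case using Suc.IH[OF 1] Suc.prems step_length[of l1 s1 l' s' RD] by simp
  qed simp
  from this[OF m(2)] m(1) show ?thesis by simp
qed

section \<open>Trees on the stack\<close>

datatype tree = Leaf | Node tree tree

primrec code :: "tree \<Rightarrow> sym list" where
  "code Leaf = [SLeaf]"
| "code (Node l r) = SNode # code l @ code r"

lemma code_symbols: "x \<in> set (code t) \<Longrightarrow> x = SLeaf \<or> x = SNode"
  by (induction t) auto

abbreviation pop_tree_body :: com where
  "pop_tree_body \<equiv> IF RD (PUSH RA SLeaf) (SEQ (PUSH RA SNode) (SEQ (PUSH RB SLeaf) (PUSH RB SLeaf)))"

text \<open>\<open>RB\<close> holds, in unary, the number of subtrees still to be moved.\<close>

definition save :: com where
  "save = SEQ (PUSH RA SMark) (SEQ (PUSH RB SMark) (SEQ (PUSH RB SLeaf) (LOOP RB pop_tree_body SKIP)))"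

text \<open>Stated with the rest of the loop as a premise and an arbitrary count \<open>b\<close>
  underneath, so that the induction handles both subtrees of a node: a node uses up one unit of
  \<open>RB\<close> and adds two, a leaf uses up one. The factor 8 covers one round per
  symbol.\<close>

lemma runs_save_loop:
  "runs (LOOP RB pop_tree_body SKIP) (mk (rev (code t) @ a) b d) n s \<Longrightarrow>
   runs (LOOP RB pop_tree_body SKIP) (mk a (SLeaf # b) (code t @ d)) (8 * length (code t) + n) s"
proof (induction t arbitrary: a b d n)
  case Leaf
  have "runs (LOOP RB pop_tree_body SKIP) (mk a (SLeaf # b) (SLeaf # d)) (Suc (Suc 1 + n)) s"
    by (rule runs_LOOP runs_IF runs_PUSH)+ (use Leaf in simp)
  from runs_mono[OF this, of "8 * length (code Leaf) + n"] show ?case by simp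
next
  case (Node l r)
  have "runs (LOOP RB pop_tree_body SKIP) (mk (rev (code l) @ SNode # a) (SLeaf # b) (code r @ d))
      (8 * length (code r) + n) s"
    by (rule Node.IH(2)) (use Node.prems in simp)
  from Node.IH(1)[OF this]
  have 1: "runs (LOOP RB pop_tree_body SKIP) (mk (SNode # a) (SLeaf # SLeaf # b) (code l @ code r @ d))
      (8 * length (code l) + (8 * length (code r) + n)) s" .
  have "runs (LOOP RB pop_tree_body SKIP) (mk a (SLeaf # b) (SNode # code l @ code r @ d))
     (Suc (Suc (Suc (1 + Suc (1 + 1))) + (8 * length (code l) + (8 * length (code r) + n)))) s"
    by (rule runs_LOOP runs_IF runs_PUSH runs_SEQ 1)+
  from runs_mono[OF this, of "8 * length (code (Node l r)) + n"] show ?case by simp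
qed

text \<open>A generous common bound for the programs that move trees, so that their costs can be
  added and rounded up uniformly.\<close>

abbreviation lin :: "nat \<Rightarrow> nat" where
  "lin n \<equiv> 40 * n + 40"

lemma runs_save: "runs save (mk a b (code t @ d)) (lin (length (code t))) (mk (rev (code t) @ SMark # a) b d)"
proof -
  have "runs save (mk a b (code t @ d)) (Suc (1 + Suc (1 + Suc (1 + (8 * length (code t) + 1)))))
     (mk (rev (code t) @ SMark # a) b d)"
    unfolding save_def
    by (rule runs_SEQ runs_PUSH runs_save_loop runs_LOOP_exit)+
  then show ?thesis by (rule runs_mono) simp
qed

definition restore :: com where
  "restore = LOOP RA (PUSH RD SLeaf) (PUSH RD SNode)"

lemma runs_restore:
  "set xs \<subseteq> {SLeaf, SNode} \<Longrightarrow> runs restore (mk (xs @ SMark # a) b d) (lin (length xs)) (mk a b (rev xs @ d))"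
proof (induction xs arbitrary: d)
  case Nil
  show ?case unfolding restore_def by (rule runs_mono, simp, rule runs_LOOP_exit) simp
next
  case (Cons x xs)
  have 1: "runs (LOOP RA (PUSH RD SLeaf) (PUSH RD SNode)) (mk (xs @ SMark # a) b (x # d)) (lin (length xs)) (mk a b (rev xs @ x # d))"
    using Cons by (simp add: restore_def)
  have "runs (LOOP RA (PUSH RD SLeaf) (PUSH RD SNode)) (mk (x # xs @ SMark # a) b d) (Suc (1 + lin (length xs))) (mk a b (rev xs @ x # d))"
  proof (cases "x = SLeaf")
    case True
    then show ?thesis by (simp only:) (rule runs_LOOP runs_PUSH 1[simplified True])+
  next
    case False
    then have "x = SNode" using Cons.prems by auto
    then show ?thesis by (simp only:) (rule runs_LOOP runs_PUSH 1[simplified \<open>x = SNode\<close>])+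
  qed
  from runs_mono[OF this, of "lin (length (x # xs))"] show ?case by (simp add: restore_def)
qed

lemma runs_restore_code:
  "runs restore (mk (rev (code t) @ SMark # a) b d) (lin (length (code t))) (mk a b (code t @ d))"
  using runs_restore[of "rev (code t)" a b d] code_symbols by auto

definition drop_top :: com where
  "drop_top = SEQ save (LOOP RA SKIP SKIP)"

lemma runs_discard:
  "set xs \<subseteq> {SLeaf, SNode} \<Longrightarrow> runs (LOOP RA SKIP SKIP) (mk (xs @ SMark # a) b d) (lin (length xs)) (mk a b d)"
proof (induction xs)
  case Nil
  show ?case by (rule runs_mono, simp, rule runs_LOOP_exit) simp
next
  case (Cons x xs)
  have 1: "runs (LOOP RA SKIP SKIP) (mk (xs @ SMark # a) b d) (lin (length xs)) (mk a b d)"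
    using Cons by simp
  have "runs (LOOP RA SKIP SKIP) (mk (x # xs @ SMark # a) b d) (Suc (1 + lin (length xs))) (mk a b d)"
  proof (cases "x = SLeaf")
    case True
    then show ?thesis by (simp only:) (rule runs_LOOP runs_SKIP 1)+
  next
    case False
    then have "x = SNode" using Cons.prems by auto
    then show ?thesis by (simp only:) (rule runs_LOOP runs_SKIP 1)+
  qed
  from runs_mono[OF this, of "lin (length (x # xs))"] show ?case by (simp add: restore_def)
qed

lemma runs_drop_top: "runs drop_top (mk a b (code t @ d)) (2 * lin (length (code t)) + 1) (mk a b d)"
proof -
  have "runs drop_top (mk a b (code t @ d)) (Suc (lin (length (code t)) + lin (length (rev (code t))))) (mk a b d)"
    unfolding drop_top_def
    by (rule runs_SEQ runs_save runs_discard)+ (use code_symbols in auto)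
  then show ?thesis by (rule runs_mono) simp
qed

abbreviation copy_loop :: com where
  "copy_loop \<equiv> LOOP RA (SEQ (PUSH RD SLeaf) (PUSH RB SLeaf)) (SEQ (PUSH RD SNode) (PUSH RB SNode))"

lemma runs_copy_loop:
  "set xs \<subseteq> {SLeaf, SNode} \<Longrightarrow> runs copy_loop (mk (xs @ SMark # a) b d) (lin (length xs)) (mk a (rev xs @ b) (rev xs @ d))"
proof (induction xs arbitrary: b d)
  case Nil
  show ?case by (rule runs_mono, simp, rule runs_LOOP_exit) simp
next
  case (Cons x xs)
  have 1: "runs copy_loop (mk (xs @ SMark # a) (x # b) (x # d)) (lin (length xs)) (mk a (rev xs @ x # b) (rev xs @ x # d))"
    using Cons by simp
  have "runs copy_loop (mk (x # xs @ SMark # a) b d) (Suc (Suc (1 + 1) + lin (length xs))) (mk a (rev xs @ x # b) (rev xs @ x # d))"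
  proof (cases "x = SLeaf")
    case True
    then show ?thesis by (simp only:) (rule runs_LOOP runs_SEQ runs_PUSH 1[simplified True])+
  next
    case False
    then have "x = SNode" using Cons.prems by auto
    then show ?thesis by (simp only:) (rule runs_LOOP runs_SEQ runs_PUSH 1[simplified \<open>x = SNode\<close>])+
  qed
  from runs_mono[OF this, of "lin (length (x # xs))"] show ?case by (simp add: restore_def)
qed

abbreviation back_loop :: com where
  "back_loop \<equiv> LOOP RB (PUSH RA SLeaf) (PUSH RA SNode)"

lemma runs_back_loop:
  "set xs \<subseteq> {SLeaf, SNode} \<Longrightarrow> runs back_loop (mk a (xs @ SMark # b) d) (lin (length xs)) (mk (rev xs @ a) b d)"
proof (induction xs arbitrary: a)
  case Nil
  show ?case by (rule runs_mono, simp, rule runs_LOOP_exit) simp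
next
  case (Cons x xs)
  have 1: "runs back_loop (mk (x # a) (xs @ SMark # b) d) (lin (length xs)) (mk (rev xs @ x # a) b d)"
    using Cons by simp
  have "runs back_loop (mk a (x # xs @ SMark # b) d) (Suc (1 + lin (length xs))) (mk (rev xs @ x # a) b d)"
  proof (cases "x = SLeaf")
    case True
    then show ?thesis by (simp only:) (rule runs_LOOP runs_PUSH 1[simplified True])+
  next
    case False
    then have "x = SNode" using Cons.prems by auto
    then show ?thesis by (simp only:) (rule runs_LOOP runs_PUSH 1[simplified \<open>x = SNode\<close>])+
  qed
  from runs_mono[OF this, of "lin (length (x # xs))"] show ?case by (simp add: restore_def)
qed

text \<open>\<open>copy_loop\<close> empties the saved tree onto \<open>RD\<close> and
  \<open>RB\<close> at once. Moving the copy directly from \<open>RB\<close> to \<open>RD\<close>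
  would reverse it, so it goes through \<open>RA\<close> once more.\<close>

definition dup :: com where
  "dup = SEQ save (SEQ (PUSH RB SMark) (SEQ copy_loop (SEQ (PUSH RA SMark) (SEQ back_loop restore))))"

lemma runs_dup:
  "runs dup (mk a b (code t @ d)) (5 * lin (length (code t))) (mk a b (code t @ code t @ d))"
proof -
  let ?n = "lin (length (code t))"
  have syms: "set (code t) \<subseteq> {SLeaf, SNode}" "set (rev (code t)) \<subseteq> {SLeaf, SNode}"
    using code_symbols by auto
  have c: "runs copy_loop (mk (rev (code t) @ SMark # a) (SMark # b) d) ?n (mk a (code t @ SMark # b) (code t @ d))"
    using runs_copy_loop[OF syms(2)] by simp
  have bk: "runs back_loop (mk (SMark # a) (code t @ SMark # b) (code t @ d)) ?n (mk (rev (code t) @ SMark # a) b (code t @ d))"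
    by (rule runs_back_loop[OF syms(1)])
  have "runs dup (mk a b (code t @ d)) (Suc (?n + Suc (1 + Suc (?n + Suc (1 + Suc (?n + ?n)))))) (mk a b (code t @ code t @ d))"
    unfolding dup_def
    by (rule runs_SEQ runs_save runs_PUSH c bk runs_restore_code)+
  then show ?thesis by (rule runs_mono) simp
qed

section \<open>Polynomial-time functions on encodable types\<close>

class enc =
  fixes tr :: "'a \<Rightarrow> tree"

instantiation bool :: enc begin
definition "tr b = (if b then Node Leaf Leaf else Leaf)"
instance ..
end

instantiation prod :: (enc, enc) enc begin
definition "tr x = Node (tr (fst x)) (tr (snd x))"
instance ..
end

primrec list_tree :: "'a::enc list \<Rightarrow> tree" where
  "list_tree [] = Leaf"
| "list_tree (x # xs) = Node (tr x) (list_tree xs)"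

instantiation list :: (enc) enc begin
definition "tr = (list_tree :: 'a list \<Rightarrow> tree)"
instance ..
end

abbreviation cd :: "'a::enc \<Rightarrow> sym list" where "cd x \<equiv> code (tr x)"

definition sz :: "'a::enc \<Rightarrow> nat" where "sz x = length (cd x)"

lemma tr_simps [simp]: "tr True = Node Leaf Leaf" "tr False = Leaf" "tr (a, b) = Node (tr a) (tr b)"
  "tr [] = Leaf" "tr (x # xs) = Node (tr x) (tr xs)"
  by (simp_all add: tr_bool_def tr_prod_def tr_list_def)

lemma sz_simps [simp]: "sz True = 3" "sz False = 1" "sz (a, b) = Suc (sz a + sz b)"
  "sz [] = 1" "sz (x # xs) = Suc (sz x + sz xs)"
  by (simp_all add: sz_def)

lemma sz_bool: "sz (b :: bool) \<le> 3"
  by (cases b) auto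

lemma sz_fst: "sz (fst x) \<le> sz x" and sz_snd: "sz (snd x) \<le> sz x"
  by (cases x; simp)+

lemma length_le_sz: "length xs \<le> sz xs"
  by (induction xs) auto

text \<open>The remaining contents \<open>a\<close>, \<open>b\<close>, \<open>d\<close> of the stacks are arbitrary and preserved,
  so that programs can be run while other data is saved below.\<close>

definition FP :: "('a::enc \<Rightarrow> 'b::enc) \<Rightarrow> bool" where
  "FP f \<longleftrightarrow> (\<exists>c p. polyb p \<and>
     (\<forall>x a b d. runs c (mk a b (cd x @ d)) (p (sz x)) (mk a b (cd (f x) @ d))))"

lemma FP_I:
  "polyb p \<Longrightarrow> (\<And>x a b d. runs c (mk a b (cd x @ d)) (p (sz x)) (mk a b (cd (f x) @ d))) \<Longrightarrow> FP f"
  unfolding FP_def by blast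

lemma FP_E:
  assumes "FP f"
  obtains c p where "polyb p" "mono p"
    "\<And>x a b d. runs c (mk a b (cd x @ d)) (p (sz x)) (mk a b (cd (f x) @ d))"
    "\<And>x. sz (f x) \<le> p (sz x)"
proof -
  obtain c q where q: "polyb q"
    "\<And>x a b d. runs c (mk a b (cd x @ d)) (q (sz x)) (mk a b (cd (f x) @ d))"
    using assms unfolding FP_def by blast
  \<comment> \<open>The output is no longer than input plus running time, so a majorant of
    \<open>n + q n\<close> serves both as time and as size bound.\<close>
  obtain g where g: "polyb g" "mono g" "\<And>n. n + q n \<le> g n"
    using polyb_mono_majorant[OF polyb_add[OF polyb_id q(1)]] by blast
  show thesis
  proof (rule that[of g c])
    show "polyb g" "mono g" by fact+
    show "runs c (mk a b (cd x @ d)) (g (sz x)) (mk a b (cd (f x) @ d))" for x a b d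
      using runs_mono[OF q(2)] g(3)[of "sz x"] by auto
    show "sz (f x) \<le> g (sz x)" for x
      using runs_size[OF q(2)[of "[]" "[]" x "[]"]] g(3)[of "sz x"] by (simp add: sz_def)
  qed
qed

lemma FP_size:
  assumes "FP f"
  obtains p where "polyb p" "mono p" "\<And>x. sz (f x) \<le> p (sz x)"
  using FP_E[OF assms] by metis

lemma FP_cong_tr: "FP f \<Longrightarrow> (\<And>x. tr (g x) = tr (f x)) \<Longrightarrow> FP g"
  unfolding FP_def by simp

lemma FP_id: "FP (\<lambda>x. x)"
  by (rule FP_I[of "\<lambda>_. 1" SKIP]) (auto intro: polyb_const runs_SKIP[simplified])

lemma FP_comp:
  assumes "FP g" "FP f"
  shows "FP (\<lambda>x. g (f x))"
proof -
  obtain c p where c: "polyb p" "mono p"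
    "\<And>x a b d. runs c (mk a b (cd x @ d)) (p (sz x)) (mk a b (cd (f x) @ d))"
    "\<And>x. sz (f x) \<le> p (sz x)" using FP_E[OF assms(2)] by metis
  obtain e q where e: "polyb q" "mono q"
    "\<And>x a b d. runs e (mk a b (cd x @ d)) (q (sz x)) (mk a b (cd (g x) @ d))"
    "\<And>x. sz (g x) \<le> q (sz x)" using FP_E[OF assms(1)] by metis
  show ?thesis
  proof (rule FP_I[of "\<lambda>n. Suc (p n + q (p n))" "SEQ c e"])
    show "polyb (\<lambda>n. Suc (p n + q (p n)))"
      by (intro polyb_rules polyb_comp[OF e(1)] c(1))
    show "runs (SEQ c e) (mk a b (cd x @ d)) (Suc (p (sz x) + q (p (sz x)))) (mk a b (cd (g (f x)) @ d))" for x a b d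
      by (rule runs_SEQ[OF c(3) runs_mono[OF e(3)]]) (rule monoD[OF e(2) c(4)])
  qed
qed

fun push_all :: "sym list \<Rightarrow> com" where
  "push_all [] = SKIP"
| "push_all (x # xs) = SEQ (push_all xs) (PUSH RD x)"

lemma runs_push_all: "runs (push_all xs) (mk a b d) (Suc (2 * length xs)) (mk a b (xs @ d))"
proof (induction xs)
  case Nil
  then show ?case using runs_SKIP by simp
next
  case (Cons x xs)
  have "runs (push_all (x # xs)) (mk a b d) (Suc (Suc (2 * length xs) + 1)) (mk a b (x # xs @ d))"
    unfolding push_all.simps by (rule runs_SEQ Cons runs_PUSH)+
  then show ?case by simp
qed

lemma FP_const: "FP (\<lambda>_. k)"
proof (rule FP_I)
  show "polyb (\<lambda>n. Suc ((2 * lin n + 1) + Suc (2 * length (cd k))))"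
    by (intro polyb_rules)
  show "runs (SEQ drop_top (push_all (cd k))) (mk a b (cd x @ d))
      (Suc ((2 * lin (sz x) + 1) + Suc (2 * length (cd k)))) (mk a b (cd k @ d))" for x a b d
    unfolding sz_def by (rule runs_SEQ runs_drop_top runs_push_all)+
qed

lemma FP_fst: "FP fst"
proof (rule FP_I)
  show "polyb (\<lambda>n. Suc (Suc (lin n + Suc ((2 * lin n + 1) + lin n))))"
    by (intro polyb_rules)
  fix x :: "'a \<times> 'b" and a b d
  obtain u v where x: "x = (u, v)" by fastforce
  \<comment> \<open>The outer \<open>IF\<close> only pops the leading \<open>SNode\<close>; the
    first tree is then parked on \<open>RA\<close> while the second is dropped.\<close>
  have "runs (IF RD SKIP (SEQ save (SEQ drop_top restore))) (mk a b (SNode # cd u @ cd v @ d))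
     (Suc (Suc (lin (sz u) + Suc ((2 * lin (sz v) + 1) + lin (sz u))))) (mk a b (cd u @ d))"
    unfolding sz_def by (rule runs_IF runs_SEQ runs_save runs_drop_top runs_restore_code)+
  then show "runs (IF RD SKIP (SEQ save (SEQ drop_top restore))) (mk a b (cd x @ d))
     (Suc (Suc (lin (sz x) + Suc ((2 * lin (sz x) + 1) + lin (sz x))))) (mk a b (cd (fst x) @ d))"
    unfolding x by simp (erule runs_mono, simp)
qed

lemma FP_snd: "FP snd"
proof (rule FP_I)
  show "polyb (\<lambda>n. Suc (2 * lin n + 1))"
    by (intro polyb_rules)
  fix x :: "'a \<times> 'b" and a b d
  obtain u v where x: "x = (u, v)" by fastforce
  have "runs (IF RD SKIP drop_top) (mk a b (SNode # cd u @ cd v @ d))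
     (Suc (2 * lin (sz u) + 1)) (mk a b (cd v @ d))"
    unfolding sz_def by (rule runs_IF runs_drop_top)+
  then show "runs (IF RD SKIP drop_top) (mk a b (cd x @ d)) (Suc (2 * lin (sz x) + 1)) (mk a b (cd (snd x) @ d))"
    unfolding x by simp (erule runs_mono, simp)
qed

lemma FP_fst_of: "FP f \<Longrightarrow> FP (\<lambda>x. fst (f x))" and FP_snd_of: "FP f \<Longrightarrow> FP (\<lambda>x. snd (f x))"
  by (rule FP_comp[OF FP_fst] FP_comp[OF FP_snd]; assumption)+

lemma FP_Pair:
  assumes "FP f" "FP g"
  shows "FP (\<lambda>x. (f x, g x))"
proof -
  obtain c p where c: "polyb p" "mono p"
    "\<And>x a b d. runs c (mk a b (cd x @ d)) (p (sz x)) (mk a b (cd (f x) @ d))"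
    "\<And>x. sz (f x) \<le> p (sz x)" using FP_E[OF assms(1)] by metis
  obtain e q where e: "polyb q" "mono q"
    "\<And>x a b d. runs e (mk a b (cd x @ d)) (q (sz x)) (mk a b (cd (g x) @ d))"
    "\<And>x. sz (g x) \<le> q (sz x)" using FP_E[OF assms(2)] by metis
  let ?c = "SEQ dup (SEQ c (SEQ save (SEQ e (SEQ restore (PUSH RD SNode)))))"
  show ?thesis
  proof (rule FP_I)
    show "polyb (\<lambda>n. Suc (5 * lin n + Suc (p n + Suc (lin (p n) + Suc (q n + Suc (lin (p n) + 1))))))"
      by (intro polyb_rules c(1) e(1))
    fix x a b d
    have "runs ?c (mk a b (cd x @ d))
      (Suc (5 * lin (sz x) + Suc (p (sz x) + Suc (lin (sz (f x)) + Suc (q (sz x) + Suc (lin (sz (f x)) + 1))))))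
      (mk a b (SNode # cd (f x) @ cd (g x) @ d))"
      unfolding sz_def
      by (rule runs_SEQ runs_dup c(3)[unfolded sz_def] runs_save e(3)[unfolded sz_def] runs_restore_code runs_PUSH)+
    then show "runs ?c (mk a b (cd x @ d))
      (Suc (5 * lin (sz x) + Suc (p (sz x) + Suc (lin (p (sz x)) + Suc (q (sz x) + Suc (lin (p (sz x)) + 1))))))
      (mk a b (cd (f x, g x) @ d))"
      using c(4)[of x] by simp (erule runs_mono, simp)
  qed
qed

lemma FP_if:
  assumes "FP h" "FP f" "FP g"
  shows "FP (\<lambda>x. if h x then f x else g x)"
proof -
  obtain c p where c: "polyb p" "mono p"
    "\<And>x a b d. runs c (mk a b (cd x @ d)) (p (sz x)) (mk a b (cd (f x) @ d))"
    "\<And>x. sz (f x) \<le> p (sz x)" using FP_E[OF assms(2)] by metis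
  obtain e q where e: "polyb q" "mono q"
    "\<And>x a b d. runs e (mk a b (cd x @ d)) (q (sz x)) (mk a b (cd (g x) @ d))"
    "\<And>x. sz (g x) \<le> q (sz x)" using FP_E[OF assms(3)] by metis
  obtain i r where i: "polyb r" "mono r"
    "\<And>x a b d. runs i (mk a b (cd x @ d)) (r (sz x)) (mk a b (cd (h x) @ d))"
    "\<And>x. sz (h x) \<le> r (sz x)" using FP_E[OF assms(1)] by metis
  \<comment> \<open>\<open>True\<close> is coded by \<open>SNode\<close>, \<open>SLeaf\<close>,
    \<open>SLeaf\<close>: after the branch on \<open>SNode\<close> two leaves remain, which the two
    \<open>IF RD SKIP SKIP\<close> remove. \<open>False\<close> is a single \<open>SLeaf\<close>,
    already popped by the branch.\<close>
  let ?c = "SEQ dup (SEQ i (IF RD e (SEQ (IF RD SKIP SKIP) (SEQ (IF RD SKIP SKIP) c))))"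
  show ?thesis
  proof (rule FP_I)
    show "polyb (\<lambda>n. Suc (5 * lin n + Suc (r n + Suc (Suc (Suc 1 + Suc (Suc 1 + p n)) + q n))))"
      by (intro polyb_rules c(1) e(1) i(1))
    fix x a b d
    have 1: "runs ?c (mk a b (cd x @ d))
      (Suc (5 * lin (sz x) + Suc (r (sz x) + Suc (Suc (Suc 1 + Suc (Suc 1 + p (sz x)))))))
      (mk a b (cd (f x) @ d))" if "h x"
    proof -
      have 2: "runs i (mk a b (cd x @ d)) (r (sz x)) (mk a b (SNode # SLeaf # SLeaf # d))" for d
        using i(3)[of a b x] that by simp
      show ?thesis
        unfolding sz_def
        by (rule runs_SEQ runs_dup 2[unfolded sz_def] runs_IF runs_SKIP c(3)[unfolded sz_def])+
    qed
    have 2: "runs ?c (mk a b (cd x @ d)) (Suc (5 * lin (sz x) + Suc (r (sz x) + Suc (q (sz x)))))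
      (mk a b (cd (g x) @ d))" if "\<not> h x"
    proof -
      have 2: "runs i (mk a b (cd x @ d)) (r (sz x)) (mk a b (SLeaf # d))" for d
        using i(3)[of a b x] that by simp
      show ?thesis
        unfolding sz_def
        by (rule runs_SEQ runs_dup 2[unfolded sz_def] runs_IF runs_SKIP e(3)[unfolded sz_def])+
    qed
    show "runs ?c (mk a b (cd x @ d))
      (Suc (5 * lin (sz x) + Suc (r (sz x) + Suc (Suc (Suc 1 + Suc (Suc 1 + p (sz x))) + q (sz x)))))
      (mk a b (cd (if h x then f x else g x) @ d))"
      by (cases "h x") (simp_all, (erule runs_mono[OF 1] runs_mono[OF 2], simp)+)
  qed
qed

lemma FP_case_list:
  assumes "FP l" "FP f" "FP (\<lambda>z. g (snd z) (fst (fst z)) (snd (fst z)))"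
  shows "FP (\<lambda>x. case l x of [] \<Rightarrow> f x | y # ys \<Rightarrow> g x y ys)"
proof -
  obtain i r where i: "polyb r" "mono r"
    "\<And>x a b d. runs i (mk a b (cd x @ d)) (r (sz x)) (mk a b (cd (l x) @ d))"
    "\<And>x. sz (l x) \<le> r (sz x)" using FP_E[OF assms(1)] by metis
  obtain c p where c: "polyb p" "mono p"
    "\<And>x a b d. runs c (mk a b (cd x @ d)) (p (sz x)) (mk a b (cd (f x) @ d))"
    "\<And>x. sz (f x) \<le> p (sz x)" using FP_E[OF assms(2)] by metis
  obtain e q where e: "polyb q" "mono q"
    "\<And>z a b d. runs e (mk a b (cd z @ d)) (q (sz z)) (mk a b (cd (g (snd z) (fst (fst z)) (snd (fst z))) @ d))"
    "\<And>z. sz (g (snd z) (fst (fst z)) (snd (fst z))) \<le> q (sz z)" using FP_E[OF assms(3)] by metis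
  \<comment> \<open>Once the \<open>SNode\<close> of a nonempty list is popped, head, tail and
    \<open>x\<close> lie on \<open>RD\<close> in this order. Two new \<open>SNode\<close> symbols
    turn them into the tree of \<open>((y, ys), x)\<close>, the argument expected by the third
    assumption.\<close>
  let ?c = "SEQ dup (SEQ i (IF RD c (SEQ (PUSH RD SNode) (SEQ (PUSH RD SNode) e))))"
  show ?thesis
  proof (rule FP_I)
    show "polyb (\<lambda>n. Suc (5 * lin n + Suc (r n + Suc (p n + Suc (1 + Suc (1 + q (Suc (r n + n))))))))"
      by (intro polyb_rules c(1) polyb_comp[OF e(1)] i(1))
    fix x a b d
    show "runs ?c (mk a b (cd x @ d))
      (Suc (5 * lin (sz x) + Suc (r (sz x) + Suc (p (sz x) + Suc (1 + Suc (1 + q (Suc (r (sz x) + sz x))))))))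
      (mk a b (cd (case l x of [] \<Rightarrow> f x | y # ys \<Rightarrow> g x y ys) @ d))"
    proof (cases "l x")
      case Nil
      have 2: "runs i (mk a b (cd x @ d)) (r (sz x)) (mk a b (SLeaf # d))" for d
        using i(3)[of a b x] Nil by simp
      have "runs ?c (mk a b (cd x @ d)) (Suc (5 * lin (sz x) + Suc (r (sz x) + Suc (p (sz x)))))
          (mk a b (cd (f x) @ d))"
        unfolding sz_def
        by (rule runs_SEQ runs_dup 2[unfolded sz_def] runs_IF runs_SKIP c(3)[unfolded sz_def])+
      from runs_mono[OF this] show ?thesis using Nil by simp
    next
      case (Cons y ys)
      have 2: "runs i (mk a b (cd x @ d)) (r (sz x)) (mk a b (SNode # cd y @ cd ys @ d))" for d
        using i(3)[of a b x] Cons by simp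
      have 3: "runs e (mk a b (SNode # SNode # cd y @ cd ys @ cd x @ d)) (q (Suc (Suc (sz y + sz ys) + sz x)))
          (mk a b (cd (g x y ys) @ d))"
        using e(3)[of a b "((y, ys), x)" d] by simp
      have "runs ?c (mk a b (cd x @ d))
          (Suc (5 * lin (sz x) + Suc (r (sz x) + Suc (Suc (1 + Suc (1 + q (Suc (Suc (sz y + sz ys) + sz x))))))))
          (mk a b (cd (g x y ys) @ d))"
        unfolding sz_def
        by (rule runs_SEQ runs_dup 2[unfolded sz_def] runs_IF runs_PUSH 3[unfolded sz_def])+
      moreover have "q (Suc (Suc (sz y + sz ys) + sz x)) \<le> q (Suc (r (sz x) + sz x))"
        using i(4)[of x] Cons by (intro monoD[OF e(2)]) simp
      ultimately show ?thesis using Cons by simp (erule runs_mono, simp)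
    qed
  qed
qed

lemma FP_let:
  assumes "FP f" "FP (\<lambda>z. g (snd z) (fst z))"
  shows "FP (\<lambda>x. let y = f x in g x y)"
  using FP_comp[OF assms(2) FP_Pair[OF assms(1) FP_id]] by (simp add: Let_def)

lemma FP_case_prod:
  assumes "FP f" "FP (\<lambda>z. g (snd z) (fst (fst z)) (snd (fst z)))"
  shows "FP (\<lambda>x. case f x of (y, z) \<Rightarrow> g x y z)"
  using FP_comp[OF assms(2) FP_Pair[OF assms(1) FP_id]] by (simp add: split_def)

text \<open>A list cell has the same tree as the pair of its head and tail, so pairing already
  computes it.\<close>

lemma FP_Cons:
  assumes "FP f" "FP g"
  shows "FP (\<lambda>x. f x # g x)"
  by (rule FP_cong_tr[OF FP_Pair[OF assms]]) simp

lemma FP_conj: "FP f \<Longrightarrow> FP g \<Longrightarrow> FP (\<lambda>x. f x \<and> g x)"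
  by (rule FP_cong_tr[OF FP_if[of f g "\<lambda>_. False"]]) (auto intro: FP_const)

lemma FP_disj: "FP f \<Longrightarrow> FP g \<Longrightarrow> FP (\<lambda>x. f x \<or> g x)"
  by (rule FP_cong_tr[OF FP_if[of f "\<lambda>_. True" g]]) (auto intro: FP_const)

lemma FP_not: "FP f \<Longrightarrow> FP (\<lambda>x. \<not> f x)"
  by (rule FP_cong_tr[OF FP_if[of f "\<lambda>_. False" "\<lambda>_. True"]]) (auto intro: FP_const)

text \<open>The code of \<open>h x\<close> itself is the loop counter: saved on \<open>RA\<close>,
  it triggers one round of \<open>f\<close> per symbol. The time is polynomial because
  \<open>q\<close> bounds every iterate, hence the cost of every round.\<close>

lemma FP_iterate:
  fixes f :: "'a::enc \<Rightarrow> 'a" and h :: "'c::enc \<Rightarrow> 'b::enc"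
  assumes "FP f" "FP h" "FP g" "polyb q" "\<And>n x. sz ((f ^^ n) x) \<le> q (sz x)"
  shows "FP (\<lambda>x. (f ^^ sz (h x)) (g x))"
proof -
  obtain c p where c: "polyb p" "mono p"
    "\<And>x a b d. runs c (mk a b (cd x @ d)) (p (sz x)) (mk a b (cd (f x) @ d))"
    "\<And>x. sz (f x) \<le> p (sz x)" using FP_E[OF assms(1)] by metis
  have loop: "runs (LOOP RA c c) (mk (xs @ SMark # a) b (cd x @ d)) (Suc (length xs * Suc (p N)))
       (mk a b (cd ((f ^^ length xs) x) @ d))"
    if "set xs \<subseteq> {SLeaf, SNode}" "\<And>n. sz ((f ^^ n) x) \<le> N" for xs a b d x N
    using that
  proof (induction xs arbitrary: x)
    case Nil
    show ?case using runs_LOOP_exit by simp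
  next
    case (Cons y xs)
    have bd: "sz ((f ^^ n) (f x)) \<le> N" for n
      using Cons.prems(2)[of "Suc n"] by (simp only: funpow_Suc_right o_apply)
    have 1: "runs c (mk a b (cd x @ d)) (p N) (mk a b (cd (f x) @ d))" for a b d
      by (rule runs_mono[OF c(3)]) (use Cons.prems(2)[of 0] monoD[OF c(2)] in auto)
    have 2: "runs (LOOP RA c c) (mk (xs @ SMark # a) b (cd (f x) @ d)) (Suc (length xs * Suc (p N)))
       (mk a b (cd ((f ^^ length (y # xs)) x) @ d))"
      using Cons.IH[of "f x"] Cons.prems(1) bd by (simp only: list.size funpow_Suc_right o_apply add_0_right add_Suc_right) simp
    have "runs (LOOP RA c c) (mk (y # xs @ SMark # a) b (cd x @ d)) (Suc (p N + Suc (length xs * Suc (p N))))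
       (mk a b (cd ((f ^^ length (y # xs)) x) @ d))"
    proof (cases "y = SLeaf")
      case True
      then show ?thesis by (simp only:) (rule runs_LOOP 1 2[simplified True])+
    next
      case False
      then have "y = SNode" using Cons.prems by auto
      then show ?thesis by (simp only:) (rule runs_LOOP 1 2[simplified \<open>y = SNode\<close>])+
    qed
    from runs_mono[OF this] show ?case by simp
  qed
  obtain q' where q': "polyb q'" "mono q'" "\<And>n. q n \<le> q' n" using polyb_mono_majorant[OF assms(4)] by blast
  have "FP (\<lambda>z::'b \<times> 'a. (f ^^ sz (fst z)) (snd z))"
  proof (rule FP_I)
    let ?c = "IF RD SKIP (SEQ save (LOOP RA c c))"
    show "polyb (\<lambda>n. Suc (Suc (lin n + Suc (n * Suc (p (q' n))))))"
      by (intro polyb_rules polyb_comp[OF c(1)] q'(1))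
    fix z :: "'b \<times> 'a" and a b d
    obtain u x where z: "z = (u, x)" by fastforce
    have "sz ((f ^^ n) x) \<le> q' (sz z)" for n
      using assms(5)[of n x] q'(3)[of "sz x"] monoD[OF q'(2), of "sz x" "sz z"] unfolding z by simp
    then have "runs (LOOP RA c c) (mk (rev (cd u) @ SMark # a) b (cd x @ d))
        (Suc (length (rev (cd u)) * Suc (p (q' (sz z))))) (mk a b (cd ((f ^^ length (rev (cd u))) x) @ d))"
      using code_symbols by (intro loop) auto
    then have 1: "runs (LOOP RA c c) (mk (rev (cd u) @ SMark # a) b (cd x @ d))
        (Suc (sz u * Suc (p (q' (sz z))))) (mk a b (cd ((f ^^ sz u) x) @ d))"
      by (simp add: sz_def)
    have "runs ?c (mk a b (SNode # cd u @ cd x @ d))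
      (Suc (Suc (lin (length (cd u)) + Suc (sz u * Suc (p (q' (sz z))))))) (mk a b (cd ((f ^^ sz u) x) @ d))"
      by (rule runs_IF runs_SEQ runs_save 1)+
    from runs_mono[OF this, of "Suc (Suc (lin (sz z) + Suc (sz z * Suc (p (q' (sz z))))))"]
    show "runs ?c (mk a b (cd z @ d)) (Suc (Suc (lin (sz z) + Suc (sz z * Suc (p (q' (sz z)))))))
        (mk a b (cd ((f ^^ sz (fst z)) (snd z)) @ d))"
      using mult_le_mono1[of "sz u" "sz z" "Suc (p (q' (sz z)))"]
      by (simp add: z sz_def[symmetric])
  qed
  from FP_comp[OF this FP_Pair[OF assms(2,3)]] show ?thesis by simp
qed

lemma fold_additive_size:
  assumes "\<And>x. x \<in> set xs \<Longrightarrow> sz x \<le> m" "\<And>x acc. sz x \<le> m \<Longrightarrow> sz (g x acc) \<le> sz acc + k"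
  shows "sz (fold g xs acc) \<le> sz acc + length xs * k"
  using assms(1)
proof (induction xs arbitrary: acc)
  case (Cons x xs)
  have "sz (fold g xs (g x acc)) \<le> sz (g x acc) + length xs * k"
    by (rule Cons.IH) (use Cons.prems in simp)
  moreover have "sz (g x acc) \<le> sz acc + k"
    by (rule assms(2)) (use Cons.prems in simp)
  ultimately show ?case by simp
qed simp

lemma sz_member: "x \<in> set xs \<Longrightarrow> sz x \<le> sz xs"
  by (induction xs) auto

lemma sz_drop: "sz (drop n xs) \<le> sz xs"
proof (induction xs arbitrary: n)
  case (Cons x xs)
  then show ?case using le_SucI[OF trans_le_add2[OF Cons[of "n - 1"]]] by (cases n) auto
qed simp

text \<open>The fold is an iteration on triples of remaining list, accumulator and context. Surplus
  rounds do no harm, since \<open>f\<close> is the identity once the list is empty. With growth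
  independent of the accumulator, its size increases linearly in the number of rounds.\<close>

lemma FP_fold:
  fixes g :: "'c::enc \<Rightarrow> 'a::enc \<Rightarrow> 'b::enc \<Rightarrow> 'b"
  assumes "FP (\<lambda>z. g (fst z) (fst (snd z)) (snd (snd z)))" "FP xs" "FP init"
    and "polyb q" "\<And>c x acc. sz (g c x acc) \<le> sz acc + q (sz c + sz x)"
  shows "FP (\<lambda>c. fold (g c) (xs c) (init c))"
proof -
  define f where "f z = (case fst z of [] \<Rightarrow> z | x # r \<Rightarrow> (r, (g (snd (snd z)) x (fst (snd z)), snd (snd z))))"
    for z :: "'a list \<times> 'b \<times> 'c"
  note FP_basic = FP_id FP_fst_of FP_snd_of FP_Pair
  have g': "FP (\<lambda>z. g (a z) (b z) (c z))" if "FP a" "FP b" "FP c"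
    for a :: "'z::enc \<Rightarrow> 'c" and b :: "'z \<Rightarrow> 'a" and c :: "'z \<Rightarrow> 'b"
    using FP_comp[OF assms(1) FP_Pair[OF that(1) FP_Pair[OF that(2,3)]]] by simp
  have f: "FP f"
    unfolding f_def by (intro FP_case_list FP_basic g')
  have iter: "(f ^^ n) (l, acc, c) = (drop n l, fold (g c) (take n l) acc, c)" for n l acc c
  proof (induction n arbitrary: l acc)
    case (Suc n)
    show ?case
    proof (cases l)
      case Nil
      then show ?thesis using Suc[of "[]" acc] by (simp add: f_def)
    next
      case (Cons x r)
      then have "(f ^^ Suc n) (l, acc, c) = (f ^^ n) (r, g c x acc, c)"
        by (simp only: funpow_Suc_right o_apply) (simp add: f_def)
      then show ?thesis using Suc[of r "g c x acc"] Cons by simp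
    qed
  qed simp
  obtain q' where q': "polyb q'" "mono q'" "\<And>n. q n \<le> q' n" using polyb_mono_majorant[OF assms(4)] by blast
  have bound: "sz ((f ^^ n) z) \<le> 2 * sz z + sz z * q' (2 * sz z)" for n z
  proof -
    obtain l acc c where z: "z = (l, acc, c)" by (cases z)
    have "sz (fold (g c) (take n l) acc) \<le> sz acc + length (take n l) * q' (sz c + sz l)"
    proof (rule fold_additive_size[where m = "sz l"])
      fix x :: 'a and acc :: 'b assume "sz x \<le> sz l"
      then have "q (sz c + sz x) \<le> q' (sz c + sz l)"
        using order_trans[OF q'(3) monoD[OF q'(2)]] by simp
      then show "sz (g c x acc) \<le> sz acc + q' (sz c + sz l)"
        using assms(5)[of c x acc] by simp
    qed (use sz_member in_set_takeD in fast)
    also have "\<dots> \<le> sz acc + sz z * q' (2 * sz z)"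
      using length_le_sz[of l] by (intro add_left_mono mult_le_mono monoD[OF q'(2)]) (auto simp: z)
    finally show ?thesis using sz_drop[of n l] by (simp add: z iter)
  qed
  have "FP (\<lambda>c. fst (snd ((f ^^ sz (xs c)) (xs c, init c, c))))"
    by (intro FP_fst_of FP_snd_of FP_iterate[OF f assms(2) _ _ bound] FP_Pair assms FP_id polyb_rules
        polyb_comp[OF q'(1)])
  moreover have "fst (snd ((f ^^ sz (xs c)) (xs c, init c, c))) = fold (g c) (xs c) (init c)" for c
    using length_le_sz[of "xs c"] by (simp add: iter)
  ultimately show ?thesis by simp
qed

section \<open>List functions obtained from folds\<close>

lemma FP_rev: "FP f \<Longrightarrow> FP (\<lambda>x. rev (f x))"
  unfolding rev_conv_fold
  by (rule FP_fold[where q = Suc]) (auto intro!: FP_Cons FP_fst_of FP_snd_of FP_id FP_const polyb_rules)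

lemma FP_append:
  assumes "FP f" "FP g"
  shows "FP (\<lambda>x. f x @ g x)"
proof -
  have eq: "fold (#) l acc = rev l @ acc" for l acc :: "'b list"
    by (induction l arbitrary: acc) auto
  have "FP (\<lambda>x. fold (#) (rev (f x)) (g x))"
    by (rule FP_fold[where q = Suc])
      (auto intro!: assms FP_rev FP_Cons FP_fst_of FP_snd_of FP_id polyb_rules)
  then show ?thesis by (simp add: eq)
qed

lemma FP_map:
  assumes "FP (\<lambda>z. g (fst z) (snd z))" "FP xs"
  shows "FP (\<lambda>c. map (g c) (xs c))"
proof -
  obtain p where p: "polyb p" "mono p" "\<And>z. sz (g (fst z) (snd z)) \<le> p (sz z)"
    using FP_size[OF assms(1)] by blast
  have g: "FP (\<lambda>z. g (fst z) (fst (snd z)))"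
    using FP_comp[OF assms(1) FP_Pair[OF FP_fst FP_fst_of[OF FP_snd]]] by simp
  have bound: "sz (g c x # acc) \<le> sz acc + Suc (p (Suc (sz c + sz x)))" for c x acc
    using p(3)[of "(c, x)"] by simp
  have eq: "fold (\<lambda>x acc. g c x # acc) l acc = rev (map (g c) l) @ acc" for c l acc
    by (induction l arbitrary: acc) auto
  have "FP (\<lambda>c. rev (fold (\<lambda>x acc. g c x # acc) (xs c) []))"
    by (rule FP_rev, rule FP_fold[where q = "\<lambda>n. Suc (p (Suc n))"])
      (intro FP_Cons g FP_snd_of FP_id assms(2) FP_const polyb_rules polyb_comp[OF p(1)] bound)+
  then show ?thesis by (simp add: eq)
qed

lemma FP_list_all:
  assumes "FP (\<lambda>z. P (fst z) (snd z))" "FP xs"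
  shows "FP (\<lambda>c. list_all (P c) (xs c))"
proof -
  have P: "FP (\<lambda>z. P (fst z) (fst (snd z)))"
    using FP_comp[OF assms(1) FP_Pair[OF FP_fst FP_fst_of[OF FP_snd]]] by simp
  have bound: "sz (acc \<and> P c x) \<le> sz acc + (\<lambda>_. 3) (sz c + sz x)" for c x acc
    using sz_bool[of "acc \<and> P c x"] by simp
  have eq: "fold (\<lambda>x acc. acc \<and> P c x) l acc \<longleftrightarrow> acc \<and> list_all (P c) l" for c l acc
    by (induction l arbitrary: acc) auto
  have "FP (\<lambda>c. fold (\<lambda>x acc. acc \<and> P c x) (xs c) True)"
    by (rule FP_fold[OF _ _ _ _ bound]) (intro FP_conj P FP_snd_of FP_id assms(2) FP_const polyb_rules)+
  then show ?thesis by (simp add: eq)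
qed

lemma FP_zip:
  assumes "FP xs" "FP ys"
  shows "FP (\<lambda>c. zip (xs c) (ys c))"
proof -
  \<comment> \<open>One fold traverses both lists: the second is consumed inside the
    accumulator.\<close>
  define g :: "'b \<Rightarrow> ('b \<times> 'c) list \<times> 'c list \<Rightarrow> ('b \<times> 'c) list \<times> 'c list" where
    "g x acc = (case snd acc of [] \<Rightarrow> acc | y # r \<Rightarrow> ((x, y) # fst acc, r))" for x acc
  have bound: "sz (g x acc) \<le> sz acc + (\<lambda>n. n + 3) (sz c + sz x)" for c :: 'a and x acc
    by (cases acc) (auto simp: g_def split: list.split)
  have eq: "fst (fold g l acc) = rev (zip l (snd acc)) @ fst acc" for l acc
  proof (induction l arbitrary: acc)
    case (Cons x l)
    then show ?case by (cases "snd acc") (auto simp: g_def)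
  qed simp
  have "FP (\<lambda>c. rev (fst (fold g (xs c) ([], ys c))))"
    by (rule FP_rev, rule FP_fst_of, rule FP_fold[where q = "\<lambda>n. n + 3", OF _ _ _ _ bound]; (unfold g_def)?)
      (intro FP_case_list FP_Cons FP_Pair FP_fst_of FP_snd_of FP_id assms FP_const polyb_rules)+
  then show ?thesis by (simp add: eq)
qed

text \<open>Indexed by the type, so that polynomial-time equality tests can be assembled along
  products and lists, starting from \<open>bool\<close>.\<close>

definition eq_FP :: "'a::enc itself \<Rightarrow> bool" where
  "eq_FP _ \<longleftrightarrow> FP (\<lambda>z :: 'a \<times> 'a. fst z = snd z)"

lemma FP_eq: "eq_FP TYPE('a::enc) \<Longrightarrow> FP f \<Longrightarrow> FP g \<Longrightarrow> FP (\<lambda>x. (f x :: 'a) = g x)"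
  using FP_comp[OF _ FP_Pair, of "\<lambda>z. fst z = snd z" f g] by (simp add: eq_FP_def)

lemma eq_FP_bool: "eq_FP TYPE(bool)"
proof -
  have "FP (\<lambda>z. if fst z then snd z else \<not> snd z)"
    by (intro FP_if FP_fst_of FP_snd_of FP_id FP_not)
  moreover have "(\<lambda>z. if fst z then snd z else \<not> snd z) = (\<lambda>z. fst z = snd z)" by auto
  ultimately show ?thesis by (simp add: eq_FP_def)
qed

lemma eq_FP_prod:
  assumes "eq_FP TYPE('a::enc)" "eq_FP TYPE('b::enc)"
  shows "eq_FP TYPE('a \<times> 'b)"
proof -
  have "FP (\<lambda>z :: ('a \<times> 'b) \<times> ('a \<times> 'b). fst (fst z) = fst (snd z) \<and> snd (fst z) = snd (snd z))"
    by (intro FP_conj FP_eq assms FP_fst_of FP_snd_of FP_id)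
  then show ?thesis by (simp add: eq_FP_def prod_eq_iff)
qed

lemma eq_FP_list:
  assumes "eq_FP TYPE('a::enc)"
  shows "eq_FP TYPE('a list)"
proof -
  define g :: "'a \<Rightarrow> bool \<times> 'a list \<Rightarrow> bool \<times> 'a list" where
    "g x acc = (case snd acc of [] \<Rightarrow> (False, []) | y # r \<Rightarrow> (fst acc \<and> x = y, r))" for x acc
  have bound: "sz (g x acc) \<le> sz acc + (\<lambda>_. 3) (sz c + sz x)" for c :: "'a list \<times> 'a list" and x acc
    by (cases acc) (auto simp: g_def split: list.split intro!: order_trans[OF sz_bool])
  have eq: "(case fold g l (b, ys) of (b', r) \<Rightarrow> b' \<and> r = []) \<longleftrightarrow> b \<and> l = ys" for l b ys
  proof (induction l arbitrary: b ys)
    case (Cons x l)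
    then show ?case by (cases ys) (auto simp: g_def)
  qed auto
  have "FP (\<lambda>z. case fold g (fst z) (True, snd z) of (b, r) \<Rightarrow> (case r of [] \<Rightarrow> b | _ # _ \<Rightarrow> False))"
    by (intro FP_case_prod FP_case_list FP_fold[where q = "\<lambda>_. 3", OF _ _ _ _ bound]; (unfold g_def)?)
      (intro FP_case_list FP_Pair FP_conj FP_eq assms FP_fst_of FP_snd_of FP_id FP_const polyb_rules)+
  moreover have "(case p of (b, r) \<Rightarrow> (case r of [] \<Rightarrow> b | _ # _ \<Rightarrow> False)) = (case p of (b, r) \<Rightarrow> b \<and> r = [])"
    for p :: "bool \<times> 'a list"
    by (cases p; cases "snd p") auto
  ultimately show ?thesis by (simp add: eq_FP_def eq)
qed

lemmas FP_basic = FP_id FP_const FP_fst_of FP_snd_of FP_Pair FP_Cons FP_if FP_conj FP_disj FP_not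
  FP_case_list FP_case_prod FP_let FP_rev FP_append FP_map FP_list_all FP_zip

section \<open>From program to Turing machine\<close>

abbreviation read_input :: com where
  "read_input \<equiv> LOOP RA (SEQ (push_all (cd False)) (PUSH RD SNode)) (SEQ (push_all (cd True)) (PUSH RD SNode))"

text \<open>The top of \<open>RA\<close> is the last input bit, so adding bits to the front of a
  list in popping order rebuilds \<open>w\<close>; the loop ends on the empty stack. Hence the
  induction that removes bits at the end.\<close>

lemma runs_read_input:
  "runs read_input (mk (rev (map bit_sym w)) [] (cd v @ d)) (12 * length w + 1) (mk [] [] (cd (w @ v) @ d))"
proof (induction w arbitrary: v rule: rev_induct)
  case Nil
  then show ?case using runs_LOOP_exit by simp
next
  case (snoc x w)
  have 1: "runs read_input (mk (rev (map bit_sym w)) [] (SNode # cd x @ cd v @ d)) (12 * length w + 1)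
      (mk [] [] (cd (w @ x # v) @ d))"
    using snoc[of "x # v"] by simp
  have bit: "bit_sym True = SNode" "bit_sym False = SLeaf" by (simp_all add: bit_sym_def)
  have "runs read_input (mk (bit_sym x # rev (map bit_sym w)) [] (cd v @ d))
      (Suc (Suc (Suc (2 * length (cd x)) + 1) + (12 * length w + 1))) (mk [] [] (cd (w @ x # v) @ d))"
  proof (cases x)
    case True
    then have x: "x = True" by simp
    show ?thesis unfolding x bit
      by (rule runs_LOOP runs_SEQ runs_push_all runs_PUSH 1[unfolded x])+
  next
    case False
    then have x: "x = False" by simp
    show ?thesis unfolding x bit
      by (rule runs_LOOP runs_SEQ runs_push_all runs_PUSH 1[unfolded x])+
  qed
  moreover have "length (cd x) \<le> 3" using sz_bool by (simp add: sz_def)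
  ultimately show ?case by simp (erule runs_mono, simp)
qed

lemma sz_bits: "sz (w :: bool list) \<le> 4 * length w + 1"
proof (induction w)
  case (Cons b w)
  then show ?case using sz_bool[of b] by simp
qed simp

theorem in_P_if_FP:
  assumes "FP f" "\<And>w. f w \<longleftrightarrow> w \<in> L"
  shows "in_P L"
proof -
  obtain c p where c: "polyb p" "mono p"
    "\<And>x a b d. runs c (mk a b (cd x @ d)) (p (sz x)) (mk a b (cd (f x) @ d))"
    "\<And>x. sz (f x) \<le> p (sz x)" using FP_E[OF assms(1)] by metis
  define prog where "prog = SEQ (SEQ (push_all (cd ([] :: bool list))) (SEQ read_input c)) (IF RD (HALT False) (HALT True))"
  define T where "T n = Suc (Suc (Suc 2 + (12 * n + 1)) + p (4 * n + 1)) + 3" for n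
  have T: "polyb T"
    unfolding T_def by (intro polyb_rules polyb_comp[OF c(1)])
  have "\<exists>n \<le> T (length w). \<exists>s. (step ^^ n) ([prog], init_stacks w) = ([HALT (w \<in> L)], s)" for w
  proof -
    have init: "init_stacks w = mk (rev (map bit_sym w)) [] []"
      by (auto simp: init_stacks_def mk_def fun_eq_iff split: reg.split)
    have read: "runs read_input (mk (rev (map bit_sym w)) [] (cd ([] :: bool list) @ [])) (12 * length w + 1)
        (mk [] [] (cd w @ []))"
      using runs_read_input[of w "[]" "[]"] by simp
    have "runs (SEQ (push_all (cd ([] :: bool list))) (SEQ read_input c)) (mk (rev (map bit_sym w)) [] [])
       (Suc (Suc (2 * length (cd ([] :: bool list))) + Suc (12 * length w + 1 + p (4 * length w + 1))))
       (mk [] [] (cd (f w) @ []))"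
      by (rule runs_SEQ runs_push_all read runs_mono[OF c(3)] monoD[OF c(2)] sz_bits)+
    then obtain m where m: "m \<le> Suc (Suc (2 * length (cd ([] :: bool list))) + Suc (12 * length w + 1 + p (4 * length w + 1)))"
      "\<And>k. (step ^^ m) (SEQ (push_all (cd ([] :: bool list))) (SEQ read_input c) # k, mk (rev (map bit_sym w)) [] []) = (k, mk [] [] (cd (f w)))"
      unfolding runs_def by auto
    have "(step ^^ (1 + (m + 1))) ([prog], init_stacks w) = step ([IF RD (HALT False) (HALT True)], mk [] [] (cd (f w)))"
      unfolding funpow_add o_apply prog_def init using m(2) by simp
    \<comment> \<open>The code of \<open>True\<close> begins with \<open>SNode\<close>, that of
      \<open>False\<close> with \<open>SLeaf\<close>, so testing one symbol selects the halting
      command.\<close>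
    also have "\<dots> = ([HALT (w \<in> L)], mk [] [] (tl (cd (f w))))"
      using assms(2)[of w] by (cases "w \<in> L") simp_all
    finally show ?thesis using m(1) by (intro exI[of _ "1 + (m + 1)"] exI conjI) (auto simp: T_def)
  qed
  from com_tm_decides[OF this]
  have "decides_in_time (com_tm prog) L (\<lambda>m. T m * (2 * (m + T m) + 3))" .
  moreover have "polyb (\<lambda>m. T m * (2 * (m + T m) + 3))"
    by (intro polyb_rules T)
  then obtain k d where "\<And>n. T n * (2 * (n + T n) + 3) \<le> k * n ^ d + k"
    using polyb_monomial by blast
  ultimately have "decides_in_time (com_tm prog) L (\<lambda>n. k * n ^ d + k)"
    unfolding decides_in_time_def by (meson order_trans)
  then show ?thesis using valid_com_tm unfolding in_P_def by blast
qed

section \<open>The decision procedure\<close>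

type_synonym tok = "bool \<times> bool \<times> bool \<times> bool"

abbreviation "tComma \<equiv> (False, False, True, False) :: tok"
abbreviation "tOpen \<equiv> (False, False, True, True) :: tok"
abbreviation "tClose \<equiv> (False, True, False, False) :: tok"
abbreviation "tInf \<equiv> (False, True, False, True) :: tok"
abbreviation "tIn \<equiv> (False, True, True, False) :: tok"
abbreviation "tInter \<equiv> (True, False, False, True) :: tok"
abbreviation "tPlus \<equiv> (True, False, True, False) :: tok"
abbreviation "tMinus \<equiv> (True, False, True, True) :: tok"
abbreviation "tEnd \<equiv> (True, True, False, False) :: tok"
abbreviation "tSep \<equiv> (True, True, False, True) :: tok"

text \<open>A lexeme is a non-digit token together with the number preceding it, least
  significant bit first. A group is a lexeme starting a gate (or \<open>SSep\<close>) with the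
  lexemes following it.\<close>

type_synonym lexeme = "tok \<times> bool list"
type_synonym group = "lexeme \<times> lexeme list"

section \<open>Lexing and grouping of the input\<close>

definition tok_step :: "bool \<Rightarrow> bool list \<times> tok list \<Rightarrow> bool list \<times> tok list" where
  "tok_step d st = (case fst st of [] \<Rightarrow> ([d], snd st)
     | c # r \<Rightarrow> (case r of [] \<Rightarrow> ([d, c], snd st)
     | b # r' \<Rightarrow> (case r' of [] \<Rightarrow> ([d, c, b], snd st)
     | a # _ \<Rightarrow> ([], (a, b, c, d) # snd st))))"

text \<open>Each head receives the entries passed since the previous head, latest first, and heads
  are also output latest first. Run forwards over tokens, this attaches to a delimiter the digits
  before it, least significant first; run backwards over lexemes, it attaches to a gate symbol the
  lexemes after it, in reading order.\<close>

definition split_heads :: "('a \<Rightarrow> bool) \<Rightarrow> 'a list \<Rightarrow> 'a list \<times> ('a \<times> 'a list) list" where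
  "split_heads P xs =
     fold (\<lambda>x st. if P x then ([], (x, fst st) # snd st) else (x # fst st, snd st)) xs ([], [])"

definition nondigit :: "tok \<Rightarrow> bool" where
  "nondigit t \<longleftrightarrow> fst t \<or> fst (snd t) \<or> fst (snd (snd t))"

definition head_tok :: "tok \<Rightarrow> bool" where
  "head_tok t \<longleftrightarrow> t = tSep \<or> t = tIn \<or> t = tInter \<or> t = tPlus \<or> t = tMinus"

definition parse :: "bool list \<Rightarrow> bool \<times> group list" where
  "parse w = (let T = fold tok_step w ([], []); L = split_heads nondigit (rev (snd T));
       G = split_heads (\<lambda>l. head_tok (fst l)) (map (\<lambda>l. (fst l, map (\<lambda>t. snd (snd (snd t))) (snd l))) (snd L))
     in (fst T = [] \<and> fst L = [] \<and> fst G = [], snd G))"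

definition numeral_ok :: "bool list \<Rightarrow> bool" where
  "numeral_ok ds \<longleftrightarrow> fold (\<lambda>d _. d) ds False \<or> (case ds of [] \<Rightarrow> False | _ # r \<Rightarrow> r = [])"

definition elem_ok :: "lexeme list \<Rightarrow> bool" where
  "elem_ok L = (case L of [] \<Rightarrow> False | x # r \<Rightarrow> x = (tInf, []) \<and> r = [] \<or>
     x = (tOpen, []) \<and> (case rev r of [] \<Rightarrow> False | z # cs \<Rightarrow>
        z = (tClose, []) \<and> cs \<noteq> [] \<and> list_all (\<lambda>l. fst l = tComma \<and> numeral_ok (snd l)) cs))"

definition gate_ok :: "group \<Rightarrow> bool" where
  "gate_ok g \<longleftrightarrow> snd (fst g) = [] \<and> (if fst (fst g) = tIn then elem_ok (snd g) else
     (fst (fst g) = tInter \<or> fst (fst g) = tPlus \<or> fst (fst g) = tMinus) \<and>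
     (case snd g of [] \<Rightarrow> False | x # r \<Rightarrow> (case r of [] \<Rightarrow> False | y # r' \<Rightarrow>
        r' = [] \<and> fst x = tComma \<and> fst y = tEnd \<and> numeral_ok (snd x) \<and> numeral_ok (snd y))))"

text \<open>Reduces comparing lengths to the equality test on bit lists. The entries
  \<open>False\<close> also serve as the zero digits used for padding.\<close>

definition unary_length :: "'a list \<Rightarrow> bool list" where
  "unary_length xs = map (\<lambda>_. False) xs"

text \<open>An encoded \<open>\<infinity>\<close> consists of a single lexeme and fits every dimension.\<close>

definition dims_ok :: "group list \<Rightarrow> bool" where
  "dims_ok R = list_all (\<lambda>g. list_all (\<lambda>g'.
     \<not> (fst (fst g) = tIn \<or> fst (fst g) = tSep) \<or> \<not> (fst (fst g') = tIn \<or> fst (fst g') = tSep) \<or>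
     unary_length (snd g) = unary_length (snd g') \<or> unary_length (snd g) = [False] \<or>
     unary_length (snd g') = [False]) R) R"

text \<open>The list \<open>W\<close> below only matters through its length. It caps the number of digits and
  of components, so that the sizes of all intermediate results are polynomial for every
  input, well-formed or not.\<close>

definition cap :: "bool list \<Rightarrow> 'a list \<Rightarrow> 'a list" where
  "cap W xs = map snd (zip W xs)"

definition pad :: "bool list \<Rightarrow> bool list \<Rightarrow> bool list" where
  "pad W ds = cap W (ds @ unary_length W)"

text \<open>Values of gates are lists: \<open>[]\<close> is the empty set and \<open>[e]\<close> the set with the element
  \<open>e\<close>; an element is the list of its components, the empty list standing for \<open>\<infinity>\<close>.\<close>

type_synonym evalue = "bool list list list"

text \<open>Applied to every gate value before it is stored, so that the size of stored values
  depends on \<open>W\<close> alone.\<close>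

definition normal :: "bool list \<Rightarrow> evalue \<Rightarrow> evalue" where
  "normal W v = (case v of [] \<Rightarrow> [] | e # _ \<Rightarrow> [map (pad W) (cap W e)])"

definition tail :: "'a list \<Rightarrow> 'a list" where
  "tail xs = (case xs of [] \<Rightarrow> [] | _ # r \<Rightarrow> r)"

definition components :: "lexeme list \<Rightarrow> bool list list" where
  "components L = map snd (rev (tail (rev (tail L))))"

text \<open>Addition (\<open>s = False\<close>) and subtraction (\<open>s = True\<close>) of digit lists of equal length
  only differ in the rule for the carry.\<close>

definition addsub_step :: "bool \<Rightarrow> bool \<times> bool \<Rightarrow> bool \<times> bool list \<Rightarrow> bool \<times> bool list" where
  "addsub_step s p st = (if fst p = s then snd p \<and> fst st else snd p \<or> fst st,
     ((fst p = snd p) = fst st) # snd st)"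

definition addsub :: "bool \<Rightarrow> bool list \<Rightarrow> bool list \<Rightarrow> bool \<times> bool list" where
  "addsub s x y = (let r = fold (addsub_step s) (zip x y) (False, []) in (fst r, rev (snd r)))"

definition vec_addsub :: "bool \<Rightarrow> bool list list \<Rightarrow> bool list list \<Rightarrow> evalue" where
  "vec_addsub s u v = (let r = map (\<lambda>p. addsub s (fst p) (snd p)) (zip u v) in
     if list_all (\<lambda>p. \<not> fst p) r then [map snd r] else [])"

text \<open>With at most one element on each side, intersection is an equality test. In a difference
  the subtrahend is tested first, since subtracting infinity is undefined even from infinity, while
  infinity minus a vector is infinity.\<close>

definition combine :: "tok \<Rightarrow> evalue \<Rightarrow> evalue \<Rightarrow> evalue" where
  "combine h a b = (if h = tInter then (if a = b then a else []) else
     (case a of [] \<Rightarrow> [] | x # _ \<Rightarrow> (case b of [] \<Rightarrow> [] | y # _ \<Rightarrow>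
        if h = tPlus then (if x = [] \<or> y = [] then [[]] else vec_addsub False x y)
        else if y = [] then [] else if x = [] then [[]] else vec_addsub True x y)))"

definition lookup :: "bool list \<Rightarrow> (bool list \<times> evalue) list \<Rightarrow> evalue list" where
  "lookup l vs = fold (\<lambda>p acc. if fst p = l then [snd p] else acc) vs []"

definition inc :: "bool list \<Rightarrow> bool list" where
  "inc ds = (let r = fold (\<lambda>d st. (d \<and> fst st, (\<not> (d = fst st)) # snd st)) ds (True, []) in
     rev (if fst r then True # snd r else snd r))"

text \<open>The accumulator reverses the list: on an instance the group holding the tested element
  comes first, then the gates by decreasing index, so predecessors precede the gates that use
  them.\<close>

definition numbering :: "bool list \<Rightarrow> group list \<Rightarrow> (bool list \<times> group) list" where
  "numbering W R = snd (fold (\<lambda>g st. (cap W (inc (fst st)), (cap W (fst st), g) # snd st)) R ([False], []))"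

text \<open>A reference not found among the gates evaluated so far clears the flag for good. As
  these gates have larger indices, the flag checks that predecessors exist and are listed
  later.\<close>

definition eval_step ::
  "bool list \<Rightarrow> bool list \<times> group \<Rightarrow> bool \<times> (bool list \<times> evalue) list \<Rightarrow> bool \<times> (bool list \<times> evalue) list" where
  "eval_step W x st = (if fst (fst (snd x)) = tIn
     then (fst st, (fst x, normal W [components (snd (snd x))]) # snd st)
     else (case snd (snd x) of [] \<Rightarrow> (False, snd st) | a # r \<Rightarrow> (case r of [] \<Rightarrow> (False, snd st) | b # _ \<Rightarrow>
       (case lookup (snd a) (snd st) of [] \<Rightarrow> (False, snd st) | u # _ \<Rightarrow>
       (case lookup (snd b) (snd st) of [] \<Rightarrow> (False, snd st) | v # _ \<Rightarrow>
         (fst st, (fst x, normal W (combine (fst (fst (snd x))) u v)) # snd st))))))"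

definition eval_groups ::
  "bool list \<Rightarrow> (bool list \<times> group) list \<Rightarrow> bool \<times> (bool list \<times> evalue) list" where
  "eval_groups W xs = fold (eval_step W) xs (True, [])"

definition accepts :: "bool list \<Rightarrow> group list \<Rightarrow> bool" where
  "accepts W G = (case G of [] \<Rightarrow> False | o' # R \<Rightarrow> (case numbering W R of [] \<Rightarrow> False | t # xs \<Rightarrow>
       fst (fst o') = tSep \<and> numeral_ok (snd (fst o')) \<and> snd o' = [] \<and>
       fst (fst (snd t)) = tSep \<and> snd (fst (snd t)) = [] \<and> elem_ok (snd (snd t)) \<and>
       list_all (\<lambda>x. gate_ok (snd x)) xs \<and> dims_ok R \<and>
       (let E = eval_groups W xs in fst E \<and>
         lookup (snd (fst o')) (snd E) = [normal W [components (snd (snd t))]])))"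

text \<open>\<open>w @ w\<close> supplies \<open>2 * length w\<close> digits: one half for the input
  components, the other for one doubling per gate.\<close>

definition decide :: "bool list \<Rightarrow> bool" where
  "decide w = (let p = parse w in fst p \<and> accepts (w @ w) (snd p))"

section \<open>Polynomial running time of the decision procedure\<close>

lemma eq_FP_tok: "eq_FP TYPE(tok)"
  by (intro eq_FP_prod eq_FP_bool)

lemma eq_FP_bits: "eq_FP TYPE(bool list)"
  by (intro eq_FP_list eq_FP_bool)

lemmas FP_eqs = FP_eq[OF eq_FP_tok] FP_eq[OF eq_FP_bits] FP_eq[OF eq_FP_bool]
  FP_eq[OF eq_FP_prod[OF eq_FP_tok eq_FP_bits]]
  FP_eq[OF eq_FP_list[OF eq_FP_list[OF eq_FP_bits]]]
  FP_eq[OF eq_FP_list[OF eq_FP_list[OF eq_FP_list[OF eq_FP_bits]]]]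

lemma FP_is_Nil:
  assumes "FP f"
  shows "FP (\<lambda>x. f x = [])"
  by (rule FP_cong_tr[OF FP_case_list[OF assms FP_const[of True] FP_const[of False]]])
    (auto simp: neq_Nil_conv split: list.split)

lemmas FP_all = FP_basic FP_is_Nil FP_eqs

lemma FP_nondigit: "FP f \<Longrightarrow> FP (\<lambda>x. nondigit (f x))"
  unfolding nondigit_def by (intro FP_all)

lemma FP_head_tok: "FP f \<Longrightarrow> FP (\<lambda>x. head_tok (f x))"
  unfolding head_tok_def by (intro FP_all)

lemma FP_split_heads:
  fixes P :: "'a::enc \<Rightarrow> bool"
  assumes "FP P" "FP f"
  shows "FP (\<lambda>x. split_heads P (f x))"
proof -
  have P: "FP (\<lambda>z. P (f z))" if "FP f" for f :: "'z::enc \<Rightarrow> 'a" by (rule FP_comp[OF assms(1) that])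
  show ?thesis
    unfolding split_heads_def
    by (rule FP_fold[where q = "\<lambda>n. n + 3"]) (auto intro!: FP_all P assms(2) polyb_rules)
qed

lemma FP_parse: "FP parse"
proof -
  have bound: "sz (tok_step x acc) \<le> sz acc + (sz c + sz x + 10)" for c :: "bool list" and x acc
    by (cases acc) (auto simp: tok_step_def split: list.split)
  have "FP (\<lambda>w. fold tok_step w ([], []))"
    by (rule FP_fold[where q = "\<lambda>n. n + 10", OF _ _ _ _ bound]; (unfold tok_step_def)?)
      (intro FP_all polyb_rules)+
  then show ?thesis
    unfolding parse_def
    by (intro FP_let FP_all FP_split_heads FP_nondigit FP_head_tok FP_fst FP_snd)
qed

lemma FP_numeral_ok:
  assumes "FP f"
  shows "FP (\<lambda>x. numeral_ok (f x))"
  unfolding numeral_ok_def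
  by (intro FP_disj, rule FP_fold[where q = "\<lambda>n. n"]) (auto intro!: FP_all FP_comp[OF assms] polyb_rules)

lemma FP_elem_ok:
  assumes "FP f"
  shows "FP (\<lambda>x. elem_ok (f x))"
  unfolding elem_ok_def by (intro FP_all FP_comp[OF assms] FP_numeral_ok)

lemma FP_gate_ok:
  assumes "FP f"
  shows "FP (\<lambda>x. gate_ok (f x))"
  unfolding gate_ok_def by (intro FP_all FP_comp[OF assms] FP_numeral_ok FP_elem_ok)

lemma FP_unary_length: "FP f \<Longrightarrow> FP (\<lambda>x. unary_length (f x))"
  unfolding unary_length_def by (intro FP_all)

lemma FP_dims_ok:
  assumes "FP f"
  shows "FP (\<lambda>x. dims_ok (f x))"
  unfolding dims_ok_def by (intro FP_all FP_comp[OF assms] FP_unary_length)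

lemma FP_cap:
  assumes "FP f" "FP g"
  shows "FP (\<lambda>x. cap (f x) (g x))"
  unfolding cap_def by (intro FP_all FP_comp[OF assms(1)] FP_comp[OF assms(2)])

lemma FP_pad:
  assumes "FP f" "FP g"
  shows "FP (\<lambda>x. pad (f x) (g x))"
  unfolding pad_def by (intro FP_all FP_comp[OF assms(1)] FP_comp[OF assms(2)] FP_cap FP_unary_length)

lemma FP_normal:
  assumes "FP f" "FP g"
  shows "FP (\<lambda>x. normal (f x) (g x))"
  unfolding normal_def by (intro FP_all FP_comp[OF assms(1)] FP_comp[OF assms(2)] FP_cap FP_pad)

lemma FP_components:
  assumes "FP f"
  shows "FP (\<lambda>x. components (f x))"
  unfolding components_def tail_def by (intro FP_all FP_comp[OF assms])

lemma FP_addsub: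
  assumes "FP f" "FP g"
  shows "FP (\<lambda>x. addsub s (f x) (g x))"
proof -
  have bound: "sz (addsub_step s x acc) \<le> sz acc + (\<lambda>_. 10) (sz c + sz x)" for c :: 'a and x acc
    by (cases acc) (auto simp: addsub_step_def intro!: order_trans[OF add_mono[OF sz_bool sz_bool]])
  have "FP (\<lambda>x. fold (addsub_step s) (zip (f x) (g x)) (False, []))"
    by (rule FP_fold[where q = "\<lambda>_. 10", OF _ _ _ _ bound]; (unfold addsub_step_def)?)
      (intro FP_all assms polyb_rules)+
  then show ?thesis
    unfolding addsub_def by (intro FP_let FP_all)
qed

lemma FP_vec_addsub:
  assumes "FP f" "FP g"
  shows "FP (\<lambda>x. vec_addsub s (f x) (g x))"
  unfolding vec_addsub_def by (intro FP_let FP_all FP_comp[OF assms(1)] FP_comp[OF assms(2)] FP_addsub)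

lemma FP_combine:
  assumes "FP h" "FP f" "FP g"
  shows "FP (\<lambda>x. combine (h x) (f x) (g x))"
  unfolding combine_def by (intro FP_all FP_comp[OF assms(1)] FP_comp[OF assms(2)] FP_comp[OF assms(3)] FP_vec_addsub)

lemma FP_lookup:
  assumes "FP f" "FP g"
  shows "FP (\<lambda>x. lookup (f x) (g x))"
  unfolding lookup_def
  by (rule FP_fold[where q = "\<lambda>n. n + 2"]) (auto intro!: FP_all FP_comp[OF assms(1)] FP_comp[OF assms(2)] polyb_rules simp: sz_snd le_SucI trans_le_add2)

lemma FP_inc:
  assumes "FP f"
  shows "FP (\<lambda>x. inc (f x))"
proof -
  define g where "g d st = (d \<and> fst st, (\<not> (d = fst st)) # snd st)" for d and st :: "bool \<times> bool list"
  have bound: "sz (g x acc) \<le> sz acc + (\<lambda>_. 10) (sz c + sz x)" for c :: 'a and x acc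
    by (cases acc) (auto simp: g_def intro!: order_trans[OF add_mono[OF sz_bool sz_bool]])
  have "FP (\<lambda>x. fold g (f x) (True, []))"
    by (rule FP_fold[where q = "\<lambda>_. 10", OF _ _ _ _ bound]; (unfold g_def)?)
      (intro FP_all assms polyb_rules)+
  then show ?thesis
    unfolding inc_def g_def by (intro FP_let FP_all)
qed

lemma length_cap: "length (cap W xs) \<le> length W"
  by (simp add: cap_def)

lemma sz_cap_bits: "sz (cap W (xs :: bool list)) \<le> 4 * sz W + 1"
  using sz_bits[of "cap W xs"] length_cap[of W xs] length_le_sz[of W] by simp

lemma FP_comp2: "FP (\<lambda>z. F (fst z) (snd z)) \<Longrightarrow> FP f \<Longrightarrow> FP g \<Longrightarrow> FP (\<lambda>x. F (f x) (g x))"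
  using FP_comp[OF _ FP_Pair, of "\<lambda>z. F (fst z) (snd z)" f g] by simp

lemma FP_numbering:
  assumes "FP f" "FP g"
  shows "FP (\<lambda>x. numbering (f x) (g x))"
proof (rule FP_comp2[where F = numbering, OF _ assms])
  \<comment> \<open>\<open>cap\<close> limits each of the two labels to size
    \<open>4 * sz (fst c) + 1\<close>; together with the group this gives the factor 9.\<close>
  have bound: "sz (cap (fst c) (inc (fst st)), (cap (fst c) (fst st), g) # snd st)
      \<le> sz st + (\<lambda>n. 9 * n + 10) (sz c + sz g)" for c :: "bool list \<times> group list" and st g
    using sz_cap_bits[of "fst c" "fst st"] sz_cap_bits[of "fst c" "inc (fst st)"] sz_fst[of c]
    by (cases st) simp
  show "FP (\<lambda>z. numbering (fst z) (snd z))"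
    unfolding numbering_def
    by (rule FP_snd_of, rule FP_fold[where q = "\<lambda>n. 9 * n + 10", OF _ _ _ _ bound])
      (intro FP_all FP_cap FP_inc FP_fst FP_snd polyb_rules)+
qed

lemma sz_list_le: "(\<And>x. x \<in> set xs \<Longrightarrow> sz x \<le> m) \<Longrightarrow> sz xs \<le> length xs * (m + 1) + 1"
proof (induction xs)
  case (Cons x xs)
  then have "sz x \<le> m" "sz xs \<le> length xs * (m + 1) + 1" by auto
  then show ?case by simp
qed simp

text \<open>At most \<open>sz W\<close> components of size at most \<open>4 * sz W + 1\<close>
  survive, whatever \<open>v\<close> is. This independence of \<open>v\<close> makes evaluation an
  admissible fold.\<close>

lemma sz_normal: "sz (normal W v) \<le> sz W * (4 * sz W + 2) + 3"
proof (cases v)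
  case (Cons e r)
  have "sz (map (pad W) (cap W e)) \<le> length (map (pad W) (cap W e)) * ((4 * sz W + 1) + 1) + 1"
    by (rule sz_list_le) (auto simp: pad_def intro: sz_cap_bits[simplified])
  moreover have "length (map (pad W) (cap W e)) * ((4 * sz W + 1) + 1) \<le> sz W * ((4 * sz W + 1) + 1)"
    using length_cap[of W e] length_le_sz[of W] by (intro mult_le_mono1) simp
  ultimately show ?thesis using Cons by (simp add: normal_def)
qed (simp add: normal_def)

lemma FP_eval_groups:
  assumes "FP f" "FP g"
  shows "FP (\<lambda>x. eval_groups (f x) (g x))"
proof (rule FP_comp2[where F = eval_groups, OF _ assms])
  have bound: "sz (eval_step (fst c) x st) \<le> sz st + (\<lambda>n. n * (4 * n + 2) + n + 20) (sz c + sz x)"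
    for c :: "bool list \<times> (bool list \<times> group) list" and st x
  proof -
    have n: "sz (normal (fst c) v) \<le> (sz c + sz x) * (4 * (sz c + sz x) + 2) + 3" for v
      using sz_fst[of c] by (intro order_trans[OF sz_normal] add_mono mult_mono) auto
    obtain ok vs lab g where st: "st = (ok, vs)" and x: "x = (lab, g)" by (cases st, cases x) blast
    have 1: "sz (ok, (lab, normal (fst c) v) # vs) \<le> sz st + (\<lambda>n. n * (4 * n + 2) + n + 20) (sz c + sz x)" for v
      using n[of v] unfolding st x by simp
    have 2: "sz (False, vs) \<le> sz st + (\<lambda>n. n * (4 * n + 2) + n + 20) (sz c + sz x)"
      unfolding st by simp
    show ?thesis
      using 1 2 unfolding st x eval_step_def by (simp only: fst_conv snd_conv split: list.split if_split) blast
  qed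
  show "FP (\<lambda>z. eval_groups (fst z) (snd z))"
    unfolding eval_groups_def
    by (rule FP_fold[where q = "\<lambda>n. n * (4 * n + 2) + n + 20", OF _ _ _ _ bound]; (unfold eval_step_def)?)
      (intro FP_all FP_normal FP_components FP_lookup FP_combine FP_fst FP_snd polyb_rules)+
qed

lemma FP_accepts:
  assumes "FP f" "FP g"
  shows "FP (\<lambda>x. accepts (f x) (g x))"
  unfolding accepts_def
  by (intro FP_all FP_comp[OF assms(1)] FP_comp[OF assms(2)] FP_numbering FP_numeral_ok FP_elem_ok FP_gate_ok FP_dims_ok FP_eval_groups FP_lookup
      FP_normal FP_components)

lemma FP_decide: "FP decide"
  unfolding decide_def by (intro FP_let FP_all FP_accepts FP_parse)

section \<open>Parsing\<close>

fun tok_bits :: "tok \<Rightarrow> bool list" where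
  "tok_bits (a, b, c, d) = [a, b, c, d]"

definition bits :: "tok list \<Rightarrow> bool list" where
  "bits ts = concat (map tok_bits ts)"

lemma bits_simps [simp]: "bits [] = []" "bits (t # ts) = tok_bits t @ bits ts" "bits (ts @ us) = bits ts @ bits us"
  by (simp_all add: bits_def)

lemma fold_tok_step_bits: "fold tok_step (bits ts) ([], out) = ([], rev ts @ out)"
proof (induction ts arbitrary: out)
  case (Cons t ts)
  then show ?case by (cases t) (simp add: tok_step_def)
qed simp

lemma fold_tok_step_inv:
  "fold tok_step w ([], []) = (buf, out) \<Longrightarrow> w = bits (rev out) @ rev buf \<and> length buf < 4"
proof (induction w arbitrary: buf out rule: rev_induct)
  case (snoc x w)
  obtain buf' out' where 1: "fold tok_step w ([], []) = (buf', out')" by fastforce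
  then have "tok_step x (buf', out') = (buf, out)" using snoc.prems by simp
  then show ?case using snoc.IH[OF 1]
    by (auto simp: tok_step_def split: list.splits)
qed simp

definition ungroup :: "('a \<times> 'a list) list \<Rightarrow> 'a list" where
  "ungroup gs = concat (map (\<lambda>g. fst g # snd g) gs)"

lemma ungroup_simps [simp]: "ungroup [] = []" "ungroup (g # gs) = fst g # snd g @ ungroup gs"
  "ungroup (gs @ hs) = ungroup gs @ ungroup hs"
  by (simp_all add: ungroup_def)

lemma split_heads_sound:
  "split_heads P xs = (buf, gs) \<Longrightarrow> xs = rev (buf @ ungroup gs) \<and> (\<forall>x \<in> set buf. \<not> P x) \<and>
     (\<forall>g \<in> set gs. P (fst g) \<and> (\<forall>x \<in> set (snd g). \<not> P x))"
proof (induction xs arbitrary: buf gs rule: rev_induct)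
  case Nil
  then show ?case by (auto simp: split_heads_def)
next
  case (snoc x xs)
  obtain buf' gs' where 1: "split_heads P xs = (buf', gs')" by fastforce
  have "(if P x then ([], (x, buf') # gs') else (x # buf', gs')) = (buf, gs)"
    using snoc.prems 1 by (cases "P x") (simp_all add: split_heads_def)
  then show ?case using snoc.IH[OF 1] by (auto split: if_splits)
qed

lemma split_heads_complete:
  "(\<And>g. g \<in> set gs \<Longrightarrow> P (fst g) \<and> (\<forall>x \<in> set (snd g). \<not> P x)) \<Longrightarrow>
   split_heads P (rev (ungroup gs)) = ([], gs)"
proof (induction gs)
  case Nil
  then show ?case by (simp add: split_heads_def)
next
  case (Cons g gs)
  define f where "f = (\<lambda>x st. if P x then ([], (x, fst st) # snd st) else (x # fst st, snd st))"
  have sh: "split_heads P xs = fold f xs ([], [])" for xs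
    by (simp add: split_heads_def f_def)
  have tl: "fold f xs (buf, G) = (rev xs @ buf, G)" if "\<forall>x \<in> set xs. \<not> P x" for xs buf G
    using that by (induction xs arbitrary: buf) (auto simp: f_def)
  have "fold f (rev (ungroup gs)) ([], []) = ([], gs)"
    unfolding sh[symmetric] by (rule Cons.IH) (use Cons.prems in auto)
  moreover have "fold f (rev (snd g)) ([], gs) = (snd g, gs)"
    using Cons.prems[of g] tl[of "rev (snd g)"] by simp
  moreover have "f (fst g) (snd g, gs) = ([], g # gs)"
    using Cons.prems[of g] by (simp add: f_def)
  ultimately show ?case by (simp add: sh)
qed

definition digit_tok :: "bool \<Rightarrow> tok" where
  "digit_tok b = (False, False, False, b)"

definition unlex :: "lexeme list \<Rightarrow> tok list" where
  "unlex L = concat (map (\<lambda>l. map digit_tok (rev (snd l)) @ [fst l]) L)"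

lemma unlex_simps [simp]: "unlex [] = []" "unlex (l # L) = map digit_tok (rev (snd l)) @ fst l # unlex L"
  "unlex (L @ M) = unlex L @ unlex M"
  by (simp_all add: unlex_def)

definition render :: "group list \<Rightarrow> bool list" where
  "render G = bits (unlex (ungroup G))"

text \<open>Ungrouping lists each delimiter before its digits, least significant first; reversal
  restores the textual order, most significant digit first and delimiter last.\<close>

lemma rev_ungroup_tokens:
  "rev (ungroup (map (\<lambda>l. (fst l, map digit_tok (snd l))) L)) = unlex (rev L)"
  by (induction L) (auto simp: rev_map)

lemma nondigit_iff: "nondigit t \<longleftrightarrow> (\<forall>b. t \<noteq> digit_tok b)"
  by (cases t) (auto simp: nondigit_def digit_tok_def)

lemma digit_tok_last: "\<not> nondigit t \<Longrightarrow> digit_tok (snd (snd (snd t))) = t"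
  by (cases t) (auto simp: nondigit_def digit_tok_def)

text \<open>Lexing and grouping lose no information when nothing is left over, so an accepted string
  can be recovered from its groups and all further checks may be made on groups.\<close>

lemma parse_sound:
  assumes "fst (parse w)"
  shows "w = render (snd (parse w))"
proof -
  define val :: "tok \<times> tok list \<Rightarrow> lexeme" where
    "val = (\<lambda>l. (fst l, map (\<lambda>t. snd (snd (snd t))) (snd l)))"
  obtain ts where T: "fold tok_step w ([], []) = ([], ts)"
    using assms by (cases "fold tok_step w ([], [])") (auto simp: parse_def Let_def)
  obtain ls where L: "split_heads nondigit (rev ts) = ([], ls)"
    using assms T by (cases "split_heads nondigit (rev ts)") (auto simp: parse_def Let_def)
  obtain G where G: "split_heads (\<lambda>l. head_tok (fst l)) (map val ls) = ([], G)"
    using assms T L by (cases "split_heads (\<lambda>l. head_tok (fst l)) (map val ls)") (auto simp: parse_def Let_def val_def)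
  have eq: "map (\<lambda>l. (fst l, map digit_tok (snd l))) (map val ls) = ls"
    using split_heads_sound[OF L] by (auto simp: val_def digit_tok_last map_idI intro!: map_idI)
  have "w = bits (rev ts)" using fold_tok_step_inv[OF T] by simp
  also have "rev ts = rev (ungroup ls)" using split_heads_sound[OF L] by simp
  also have "\<dots> = unlex (rev (map val ls))"
    using rev_ungroup_tokens[of "map val ls"] eq by simp
  also have "rev (map val ls) = ungroup G" using split_heads_sound[OF G] by simp
  finally have "w = render G" by (simp add: render_def)
  moreover have "snd (parse w) = G" using T L G by (simp add: parse_def Let_def val_def)
  ultimately show ?thesis by simp
qed

lemma head_tok_nondigit: "head_tok t \<Longrightarrow> nondigit t"
  by (auto simp: head_tok_def nondigit_def)

lemma parse_render:
  assumes "\<And>g. g \<in> set G \<Longrightarrow> head_tok (fst (fst g)) \<and> (\<forall>l \<in> set (snd g). nondigit (fst l) \<and> \<not> head_tok (fst l))"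
  shows "parse (render G) = (True, G)"
proof -
  define L where "L = rev (ungroup G)"
  define ls where "ls = map (\<lambda>l. (fst l, map digit_tok (snd l))) L"
  have T: "fold tok_step (render G) ([], []) = ([], rev (unlex (ungroup G)))"
    by (simp add: render_def fold_tok_step_bits)
  have ts: "unlex (ungroup G) = rev (ungroup ls)"
    using rev_ungroup_tokens[of L] by (simp add: ls_def L_def)
  have "nondigit (fst l)" if "l \<in> set (ungroup G)" for l
    using that assms head_tok_nondigit unfolding ungroup_def by fastforce
  then have S: "split_heads nondigit (rev (ungroup ls)) = ([], ls)"
    by (intro split_heads_complete) (auto simp: ls_def L_def nondigit_iff)
  have val: "map (\<lambda>l. (fst l, map (\<lambda>t. snd (snd (snd t))) (snd l))) ls = L"
    by (simp add: ls_def digit_tok_def comp_def)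
  have G: "split_heads (\<lambda>l. head_tok (fst l)) L = ([], G)"
    unfolding L_def by (rule split_heads_complete) (use assms in auto)
  show ?thesis
    using T S G val by (simp add: parse_def Let_def ts)
qed

section \<open>Binary numbers\<close>

function nat_bits :: "nat \<Rightarrow> bool list" where
  "nat_bits n = (if n < 2 then [n = 1] else odd n # nat_bits (n div 2))"
  by pat_completeness auto
termination by (relation "measure id") auto

declare nat_bits.simps [simp del] nat_bin.simps [simp del] gval.simps [simp del]

lemma nat_bits_less_two: "nat_bits 0 = [False]" "nat_bits (Suc 0) = [True]"
  by (simp_all add: nat_bits.simps)

lemma nat_bits_ge_two: "n \<ge> 2 \<Longrightarrow> nat_bits n = odd n # nat_bits (n div 2)"
  by (subst nat_bits.simps) simp

lemma nat_bin_eq: "nat_bin n = bits (map digit_tok (rev (nat_bits n)))"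
proof (induction n rule: nat_bits.induct)
  case (1 n)
  then show ?case
    by (subst nat_bin.simps, subst nat_bits.simps)
      (auto simp: digit_tok_def[abs_def] S0_def S1_def less_2_cases_iff odd_iff_mod_2_eq_one)
qed

fun bits_nat :: "bool list \<Rightarrow> nat" where
  "bits_nat [] = 0"
| "bits_nat (d # ds) = of_bool d + 2 * bits_nat ds"

lemma bits_nat_nat_bits: "bits_nat (nat_bits n) = n"
proof (induction n rule: nat_bits.induct)
  case (1 n)
  then show ?case
    by (subst nat_bits.simps) (auto simp: less_2_cases_iff odd_iff_mod_2_eq_one[symmetric] elim: oddE)
qed

lemma nat_bits_inject: "nat_bits m = nat_bits n \<longleftrightarrow> m = n"
  by (metis bits_nat_nat_bits)

lemma bits_nat_less: "bits_nat ds < 2 ^ length ds"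
  by (induction ds) (auto simp: of_bool_def)

lemma nat_bits_nonempty: "nat_bits n \<noteq> []"
  by (subst nat_bits.simps) simp

lemma length_nat_bits: "length (nat_bits n) \<le> Suc n"
proof (induction n rule: nat_bits.induct)
  case (1 n)
  then show ?case by (subst nat_bits.simps) auto
qed

lemma last_nat_bits: "last (nat_bits n) \<longleftrightarrow> n \<noteq> 0"
proof (induction n rule: nat_bits.induct)
  case (1 n)
  then show ?case by (subst nat_bits.simps) (auto simp: nat_bits_nonempty)
qed

lemma numeral_ok_iff: "numeral_ok ds \<longleftrightarrow> (\<exists>n. ds = nat_bits n)"
proof -
  have "fold (\<lambda>d _. d) ds b \<longleftrightarrow> (if ds = [] then b else last ds)" for b
    by (induction ds arbitrary: b) auto
  then have ok: "numeral_ok ds \<longleftrightarrow> ds \<noteq> [] \<and> (last ds \<or> length ds = 1)"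
    by (auto simp: numeral_ok_def split: list.splits)
  have "ds \<noteq> [] \<Longrightarrow> last ds \<Longrightarrow> \<exists>n. ds = nat_bits n"
  proof (induction ds)
    case (Cons d ds)
    show ?case
    proof (cases ds)
      case Nil
      then show ?thesis using Cons.prems by (auto intro!: exI[of _ 1] simp: nat_bits_less_two)
    next
      case (Cons d' ds')
      then obtain n where n: "ds = nat_bits n" using Cons.IH Cons.prems by auto
      have "last ds" using Cons Cons.prems by simp
      then have "n \<noteq> 0" using n last_nat_bits[of n] by simp
      then have "d # ds = nat_bits (of_bool d + 2 * n)" using n by (subst nat_bits_ge_two) auto
      then show ?thesis by blast
    qed
  qed simp
  moreover have "length ds = 1 \<Longrightarrow> \<exists>n. ds = nat_bits n"
  proof -
    assume "length ds = 1"
    then obtain d where "ds = [d]" by (auto simp: length_Suc_conv)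
    then show ?thesis using nat_bits_less_two by (cases d) metis+
  qed
  moreover have "ds = nat_bits n \<Longrightarrow> ds \<noteq> [] \<and> (last ds \<or> length ds = 1)" for n
    using last_nat_bits[of n] nat_bits_nonempty[of n] nat_bits_less_two by (cases "n = 0") auto
  ultimately show ?thesis using ok by blast
qed

fun add_carry :: "bool \<Rightarrow> bool list \<Rightarrow> bool list" where
  "add_carry c [] = (if c then [True] else [])"
| "add_carry c (d # ds) = (d \<noteq> c) # add_carry (d \<and> c) ds"

lemma add_carry_False: "add_carry False ds = ds"
  by (induction ds) auto

lemma add_carry_True: "add_carry True (nat_bits n) = nat_bits (Suc n)"
proof (induction n rule: nat_bits.induct)
  case (1 n)
  show ?case
  proof (cases "n < 2")
    case True
    then show ?thesis
      by (auto simp: less_2_cases_iff nat_bits_less_two nat_bits_ge_two)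
  next
    case False
    then show ?thesis using 1 by (cases "odd n") (auto simp: nat_bits_ge_two add_carry_False elim!: oddE)
  qed
qed

lemma inc_nat_bits: "inc (nat_bits n) = nat_bits (Suc n)"
proof -
  define f where "f d st = (d \<and> fst st, (\<not> (d = fst st)) # snd st)" for d and st :: "bool \<times> bool list"
  have "(let r = fold f ds (c, out) in rev (if fst r then True # snd r else snd r)) = rev out @ add_carry c ds"
    for ds c out
    by (induction ds arbitrary: c out) (auto simp: f_def)
  from this[of "nat_bits n" True "[]", unfolded f_def[abs_def]] show ?thesis
    unfolding inc_def by (simp only: add_carry_True rev.simps append_Nil)
qed

section \<open>Numerals of fixed width\<close>

fun digits :: "nat \<Rightarrow> nat \<Rightarrow> bool list" where
  "digits 0 x = []"
| "digits (Suc m) x = odd x # digits m (x div 2)"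

lemma length_digits [simp]: "length (digits m x) = m"
  by (induction m arbitrary: x) auto

lemma take_padded: "m \<le> k \<Longrightarrow> take m (ds @ replicate k False) = digits m (bits_nat ds)"
proof (induction m arbitrary: ds k)
  case (Suc m)
  show ?case
  proof (cases ds)
    case Nil
    then show ?thesis using Suc.prems Suc.IH[of "k - 1" "[]"] by (cases k) auto
  next
    case (Cons d ds')
    then show ?thesis using Suc.prems Suc.IH[of k ds'] by auto
  qed
qed simp

lemma bits_nat_digits: "x < 2 ^ m \<Longrightarrow> bits_nat (digits m x) = x"
  by (induction m arbitrary: x) (auto simp: of_bool_def)

lemma digits_inject: "x < 2 ^ m \<Longrightarrow> y < 2 ^ m \<Longrightarrow> digits m x = digits m y \<longleftrightarrow> x = y"
  by (metis bits_nat_digits)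

lemma cap_eq: "cap W xs = take (length W) xs"
  by (auto simp: cap_def map_snd_zip_take min_def)

lemma unary_length_eq: "unary_length xs = replicate (length xs) False"
  by (simp add: unary_length_def map_replicate_const)

lemma pad_eq: "pad W ds = digits (length W) (bits_nat ds)"
  by (simp add: pad_def cap_eq unary_length_eq take_padded del: take_append)

lemma pad_digits: "pad W (digits (length W) x) = digits (length W) x"
  by (simp add: pad_def cap_eq)

text \<open>Ripple-carry addition: the new carry \<open>c'\<close> is the majority of the two lowest
  digits and \<open>c\<close>; the final carry reports overflow.\<close>

lemma fold_add:
  "x < 2 ^ m \<Longrightarrow> y < 2 ^ m \<Longrightarrow> fold (addsub_step False) (zip (digits m x) (digits m y)) (c, out) =
     (x + y + of_bool c \<ge> 2 ^ m, rev (digits m (x + y + of_bool c)) @ out)"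
proof (induction m arbitrary: x y c out)
  case (Suc m)
  define c' where "c' = (if odd x then odd y \<or> c else odd y \<and> c)"
  have half: "(x + y + of_bool c) div 2 = x div 2 + y div 2 + of_bool c'"
    by (cases "odd x"; cases "odd y"; cases c) (auto simp: c'_def elim!: oddE evenE)
  have bit: "odd (x + y + of_bool c) \<longleftrightarrow> ((odd x = odd y) = c)"
    by (cases "odd x"; cases "odd y"; cases c) auto
  have ge: "(x + y + of_bool c) \<ge> 2 ^ Suc m \<longleftrightarrow> (x + y + of_bool c) div 2 \<ge> 2 ^ m"
    by (simp add: less_eq_div_iff_mult_less_eq mult.commute)
  have "addsub_step False (odd x, odd y) (c, out) = (c', odd (x + y + of_bool c) # out)"
    unfolding bit by (auto simp: addsub_step_def c'_def)
  then show ?case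
    using Suc.IH[of "x div 2" "y div 2" c' "odd (x + y + of_bool c) # out"] Suc.prems half ge by simp
qed (auto simp: of_bool_def)

text \<open>The final borrow is set iff the difference would be negative, so one pass decides
  whether the difference is defined and computes it.\<close>

lemma fold_sub:
  "x < 2 ^ m \<Longrightarrow> y < 2 ^ m \<Longrightarrow>
   fst (fold (addsub_step True) (zip (digits m x) (digits m y)) (c, out)) = (x < y + of_bool c) \<and>
   (x \<ge> y + of_bool c \<longrightarrow>
     snd (fold (addsub_step True) (zip (digits m x) (digits m y)) (c, out)) = rev (digits m (x - (y + of_bool c))) @ out)"
proof (induction m arbitrary: x y c out)
  case (Suc m)
  define c' where "c' = (if odd x then odd y \<and> c else odd y \<or> c)"
  have less: "x < y + of_bool c \<longleftrightarrow> x div 2 < y div 2 + of_bool c'"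
    by (cases "odd x"; cases "odd y"; cases c) (auto simp: c'_def elim!: oddE evenE)
  have half: "x \<ge> y + of_bool c \<Longrightarrow> (x - (y + of_bool c)) div 2 = x div 2 - (y div 2 + of_bool c')"
    by (cases "odd x"; cases "odd y"; cases c) (auto simp: c'_def elim!: oddE evenE)
  have bit: "x \<ge> y + of_bool c \<Longrightarrow> odd (x - (y + of_bool c)) \<longleftrightarrow> ((odd x = odd y) = c)"
    by (cases "odd x"; cases "odd y"; cases c) (auto simp: even_diff_nat)
  define e where "e \<longleftrightarrow> ((odd x = odd y) = c)"
  define F where "F = fold (addsub_step True) (zip (digits m (x div 2)) (digits m (y div 2))) (c', e # out)"
  have F: "fold (addsub_step True) (zip (digits (Suc m) x) (digits (Suc m) y)) (c, out) = F"
    by (auto simp: addsub_step_def c'_def e_def F_def)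
  have "x div 2 < 2 ^ m" "y div 2 < 2 ^ m" using Suc.prems by auto
  from Suc.IH[OF this, of c' "e # out"]
  have IH: "fst F \<longleftrightarrow> x div 2 < y div 2 + of_bool c'"
    "x div 2 \<ge> y div 2 + of_bool c' \<Longrightarrow> snd F = rev (digits m (x div 2 - (y div 2 + of_bool c'))) @ e # out"
    unfolding F_def by blast+
  have "snd F = rev (digits (Suc m) (x - (y + of_bool c))) @ out" if "x \<ge> y + of_bool c"
    using IH(2) less half[OF that] bit[OF that] that unfolding e_def by (simp only: digits.simps) simp
  then show ?case unfolding F using IH(1) less by blast
qed (auto simp: of_bool_def)

lemma addsub_False:
  "x + y < 2 ^ m \<Longrightarrow> addsub False (digits m x) (digits m y) = (False, digits m (x + y))"
  using fold_add[of x m y False "[]"] by (simp add: addsub_def)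

lemma addsub_True:
  assumes "x < 2 ^ m" "y < 2 ^ m"
  shows "fst (addsub True (digits m x) (digits m y)) \<longleftrightarrow> x < y"
    "y \<le> x \<Longrightarrow> snd (addsub True (digits m x) (digits m y)) = digits m (x - y)"
  using fold_sub[OF assms, of False "[]"] by (auto simp: addsub_def Let_def)

section \<open>Encodings of circuits\<close>

fun elem_lexemes :: "elem \<Rightarrow> lexeme list" where
  "elem_lexemes Infty = [(tInf, [])]"
| "elem_lexemes (Fin v) = (tOpen, []) # map (\<lambda>x. (tComma, nat_bits x)) v @ [(tClose, [])]"

text \<open>The next two functions are undefined on union and complement gates, which
  \<open>plain_gate\<close> excludes.\<close>

fun op_tok :: "op \<Rightarrow> tok" where
  "op_tok OInter = tInter"
| "op_tok OPlus = tPlus"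
| "op_tok OMinus = tMinus"

fun gate_group :: "gate \<Rightarrow> group" where
  "gate_group (GIn a) = ((tIn, []), elem_lexemes a)"
| "gate_group (GBin f j l) = ((op_tok f, []), [(tComma, nat_bits j), (tEnd, nat_bits l)])"

definition circuit_groups :: "nat \<Rightarrow> gate list \<Rightarrow> elem \<Rightarrow> group list" where
  "circuit_groups out gs b =
     ((tSep, nat_bits out), []) # map gate_group gs @ [((tSep, []), elem_lexemes b)]"

abbreviation (input) ops :: "op set" where
  "ops \<equiv> {OInter, OPlus, OMinus}"

text \<open>\<open>Fin []\<close> lies only in dimension 0. Excluding it frees the empty list to
  stand for infinity.\<close>

definition plain_gate :: "gate \<Rightarrow> bool" where
  "plain_gate g \<longleftrightarrow> (case g of GIn a \<Rightarrow> a \<noteq> Fin [] | GCompl j \<Rightarrow> False | GBin f j l \<Rightarrow> f \<in> ops)"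

lemma plain_gateE:
  assumes "plain_gate g"
  obtains a where "g = GIn a" "a \<noteq> Fin []" | f j l where "g = GBin f j l" "f \<in> ops"
  using assms by (cases g) (auto simp: plain_gate_def)

lemma enc_elem_lexemes: "enc_elem a = bits (unlex (elem_lexemes a))"
proof (cases a)
  case (Fin v)
  have "concat (map (\<lambda>x. nat_bin x @ SComma) v) = bits (unlex (map (\<lambda>x. (tComma, nat_bits x)) v))"
    by (induction v) (auto simp: nat_bin_eq SComma_def)
  then show ?thesis using Fin by (simp add: SOpen_def SClose_def)
qed (simp add: SInf_def)

lemma enc_gate_group: "plain_gate g \<Longrightarrow> enc_gate g = bits (unlex (fst (gate_group g) # snd (gate_group g)))"
  by (erule plain_gateE)
    (auto simp: enc_elem_lexemes nat_bin_eq SIn_def SIs_def SPl_def SMi_def SComma_def SEnd_def)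

lemma enc_instance_render:
  assumes "\<And>g. g \<in> set gs \<Longrightarrow> plain_gate g"
  shows "enc_instance (out, gs) b = render (circuit_groups out gs b)"
proof -
  have "concat (map enc_gate gs) = bits (unlex (ungroup (map gate_group gs)))"
    using assms by (induction gs) (auto simp: enc_gate_group)
  then show ?thesis
    by (simp add: enc_instance_def enc_circuit_def circuit_groups_def render_def enc_elem_lexemes
        nat_bin_eq SSep_def)
qed

lemma elem_ok_iff: "elem_ok L \<longleftrightarrow> (\<exists>a. a \<noteq> Fin [] \<and> L = elem_lexemes a)"
proof
  assume ok: "elem_ok L"
  then obtain x r where L: "L = x # r" by (cases L) (auto simp: elem_ok_def)
  show "\<exists>a. a \<noteq> Fin [] \<and> L = elem_lexemes a"
  proof (cases "x = (tInf, [])")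
    case True
    then show ?thesis using ok L by (intro exI[of _ Infty]) (auto simp: elem_ok_def)
  next
    case False
    then have x: "x = (tOpen, [])" using ok L by (auto simp: elem_ok_def)
    obtain z cs where r: "rev r = z # cs" using ok L False by (cases "rev r") (auto simp: elem_ok_def)
    have z: "z = (tClose, [])" "cs \<noteq> []" "\<And>l. l \<in> set cs \<Longrightarrow> fst l = tComma \<and> numeral_ok (snd l)"
      using ok L False r by (auto simp: elem_ok_def list_all_iff)
    have "\<exists>v. cs = map (\<lambda>x. (tComma, nat_bits x)) v"
      using z(3)
    proof (induction cs)
      case (Cons l cs)
      then obtain v where "cs = map (\<lambda>x. (tComma, nat_bits x)) v" by fastforce
      moreover obtain n where "l = (tComma, nat_bits n)"
        using Cons.prems[of l] by (cases l) (auto simp: numeral_ok_iff)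
      ultimately show ?case by (intro exI[of _ "n # v"]) simp
    qed simp
    then obtain v where "cs = map (\<lambda>x. (tComma, nat_bits x)) v" by blast
    moreover have "r = rev cs @ [z]" using r by (metis rev.simps(2) rev_rev_ident)
    ultimately show ?thesis
      using x z L by (intro exI[of _ "Fin (rev v)"]) (auto simp: rev_map)
  qed
next
  assume "\<exists>a. a \<noteq> Fin [] \<and> L = elem_lexemes a"
  then obtain a where "a \<noteq> Fin []" "L = elem_lexemes a" by blast
  then show "elem_ok L"
    by (cases a) (auto simp: elem_ok_def list_all_iff rev_map[symmetric] numeral_ok_iff)
qed

lemma gate_ok_iff: "gate_ok g \<longleftrightarrow> (\<exists>x. plain_gate x \<and> g = gate_group x)"
proof
  assume ok: "gate_ok g"
  obtain t ds body where g: "g = ((t, ds), body)" by (metis surj_pair)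
  show "\<exists>x. plain_gate x \<and> g = gate_group x"
  proof (cases "t = tIn")
    case True
    then obtain a where "a \<noteq> Fin []" "body = elem_lexemes a"
      using ok g by (auto simp: gate_ok_def elem_ok_iff)
    then show ?thesis using True ok g by (intro exI[of _ "GIn a"]) (auto simp: plain_gate_def gate_ok_def)
  next
    case False
    then have "t = tInter \<or> t = tPlus \<or> t = tMinus" using ok g by (auto simp: gate_ok_def)
    then obtain f where f: "f \<in> ops" "t = op_tok f" by (metis insertCI op_tok.simps)
    from False ok g obtain x y where "body = [x, y]" "fst x = tComma" "fst y = tEnd"
        "numeral_ok (snd x)" "numeral_ok (snd y)" "ds = []"
      by (auto simp: gate_ok_def split: list.splits)
    then obtain j l where "body = [(tComma, nat_bits j), (tEnd, nat_bits l)]" "ds = []"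
      by (cases x, cases y) (auto simp: numeral_ok_iff)
    then show ?thesis using f g by (intro exI[of _ "GBin f j l"]) (auto simp: plain_gate_def)
  qed
next
  assume "\<exists>x. plain_gate x \<and> g = gate_group x"
  then obtain x where "plain_gate x" "g = gate_group x" by blast
  then show "gate_ok g"
    by (elim plain_gateE) (auto simp: gate_ok_def elem_ok_iff numeral_ok_iff)
qed

lemma elem_lexemes_tok: "l \<in> set (elem_lexemes a) \<Longrightarrow> nondigit (fst l) \<and> \<not> head_tok (fst l)"
  by (cases a) (auto simp: nondigit_def head_tok_def)

lemma parse_circuit:
  assumes "\<And>g. g \<in> set gs \<Longrightarrow> plain_gate g"
  shows "parse (render (circuit_groups out gs b)) = (True, circuit_groups out gs b)"
proof (rule parse_render)
  fix g assume "g \<in> set (circuit_groups out gs b)"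
  then consider "g = ((tSep, nat_bits out), [])" | x where "x \<in> set gs" "g = gate_group x"
    | "g = ((tSep, []), elem_lexemes b)"
    by (auto simp: circuit_groups_def)
  then show "head_tok (fst (fst g)) \<and> (\<forall>l \<in> set (snd g). nondigit (fst l) \<and> \<not> head_tok (fst l))"
  proof cases
    case 2
    then show ?thesis using assms[OF 2(1)] elem_lexemes_tok
      by (elim plain_gateE) (auto simp: head_tok_def nondigit_def)
  qed (use elem_lexemes_tok in \<open>auto simp: head_tok_def\<close>)
qed

section \<open>Evaluation of gates\<close>

fun elem_digits :: "nat \<Rightarrow> elem \<Rightarrow> bool list list" where
  "elem_digits m Infty = []"
| "elem_digits m (Fin v) = map (digits m) v"

fun elem_less :: "nat \<Rightarrow> elem \<Rightarrow> bool" where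
  "elem_less B Infty \<longleftrightarrow> True"
| "elem_less B (Fin v) \<longleftrightarrow> (\<forall>x \<in> set v. x < B)"

text \<open>The evaluation invariant. The bound \<open>B\<close> is kept apart from the width
  \<open>m\<close>, since it may double from gate to gate while the width stays fixed.\<close>

definition denotes :: "nat \<Rightarrow> nat \<Rightarrow> nat \<Rightarrow> evalue \<Rightarrow> elem set \<Rightarrow> bool" where
  "denotes m k B v S \<longleftrightarrow> v = [] \<and> S = {} \<or>
     (\<exists>a. v = [elem_digits m a] \<and> S = {a} \<and> a \<in> dimset k \<and> elem_less B a)"

lemma denotes_empty: "denotes m k B [] {}"
  by (simp add: denotes_def)

lemma denotes_single: "a \<in> dimset k \<Longrightarrow> elem_less B a \<Longrightarrow> denotes m k B [elem_digits m a] {a}"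
  by (simp add: denotes_def)

lemma components_elem: "components (elem_lexemes a) = (case a of Infty \<Rightarrow> [] | Fin v \<Rightarrow> map nat_bits v)"
  by (cases a) (auto simp: components_def tail_def rev_map[symmetric] comp_def split: list.split)

lemma normal_components:
  assumes "a \<in> dimset k" "k \<le> length W"
  shows "normal W [components (elem_lexemes a)] = [elem_digits (length W) a]"
  using assms unfolding components_elem
  by (cases a) (auto simp: normal_def cap_eq pad_eq bits_nat_nat_bits dimset_def)

lemma normal_elem_digits:
  assumes "a \<in> dimset k" "k \<le> length W"
  shows "normal W [elem_digits (length W) a] = [elem_digits (length W) a]"
  using assms by (cases a) (auto simp: normal_def cap_eq pad_digits dimset_def)

lemma map_digits_inject:
  "length u = length v \<Longrightarrow> \<forall>x \<in> set u. x < 2 ^ m \<Longrightarrow> \<forall>x \<in> set v. x < 2 ^ m \<Longrightarrow>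
   map (digits m) u = map (digits m) v \<longleftrightarrow> u = v"
  by (induction u v rule: list_induct2) (auto simp: digits_inject)

text \<open>\<open>1 \<le> k\<close> keeps the digit lists of vectors nonempty, hence apart from
  that of infinity; the size bounds keep vectors apart from each other.\<close>

lemma elem_digits_inject:
  assumes "a \<in> dimset k" "b \<in> dimset k" "1 \<le> k" "elem_less (2 ^ m) a" "elem_less (2 ^ m) b"
  shows "elem_digits m a = elem_digits m b \<longleftrightarrow> a = b"
  using assms by (cases a; cases b) (auto simp: dimset_def map_digits_inject)

lemma vec_add:
  assumes "length u = length v" "\<forall>x \<in> set (map2 (+) u v). x < 2 ^ m"
  shows "vec_addsub False (map (digits m) u) (map (digits m) v) = [map (digits m) (map2 (+) u v)]"
proof -
  have "map (\<lambda>p. addsub False (fst p) (snd p)) (zip (map (digits m) u) (map (digits m) v))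
      = map (\<lambda>z. (False, digits m z)) (map2 (+) u v)"
    using assms by (induction u v rule: list_induct2) (auto simp: addsub_False)
  then show ?thesis
    by (simp add: vec_addsub_def Let_def list_all_iff comp_def)
qed

lemma vec_sub:
  assumes "length u = length v" "\<forall>x \<in> set u. x < 2 ^ m" "\<forall>x \<in> set v. x < 2 ^ m"
  shows "vec_addsub True (map (digits m) u) (map (digits m) v) =
     (if list_all2 (\<ge>) u v then [map (digits m) (map2 (-) u v)] else [])"
proof -
  define r where "r = map (\<lambda>p. addsub True (fst p) (snd p)) (zip (map (digits m) u) (map (digits m) v))"
  have "list_all (\<lambda>p. \<not> fst p) r \<longleftrightarrow> list_all2 (\<ge>) u v"
    unfolding r_def using assms by (induction u v rule: list_induct2) (auto simp: addsub_True)
  moreover have "list_all2 (\<ge>) u v \<Longrightarrow> map snd r = map (digits m) (map2 (-) u v)"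
    unfolding r_def using assms by (induction u v rule: list_induct2) (auto simp: addsub_True)
  ultimately show ?thesis by (simp add: vec_addsub_def Let_def r_def[symmetric])
qed

lemma set_add_single: "set_add {a} {b} = {elem_add a b}" "set_add {} B = {}" "set_add A {} = {}"
  by (auto simp: set_add_def)

lemma set_sub_single: "set_sub {a} {b} = (case elem_sub a b of None \<Rightarrow> {} | Some c \<Rightarrow> {c})"
  "set_sub {} B = {}" "set_sub A {} = {}"
  by (auto simp: set_sub_def split: option.split)

lemma elem_add_dimset:
  assumes "a \<in> dimset k" "b \<in> dimset k" "elem_less B a" "elem_less B b"
  shows "elem_add a b \<in> dimset k" "elem_less (2 * B) (elem_add a b)"
proof -
  have "x + y < 2 * B" if "(x, y) \<in> set (zip u v)" "\<forall>x \<in> set u. x < B" "\<forall>x \<in> set v. x < B" for x y u v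
    using that set_zip_leftD[OF that(1)] set_zip_rightD[OF that(1)] by fastforce
  then show "elem_add a b \<in> dimset k" "elem_less (2 * B) (elem_add a b)"
    using assms by (cases a; cases b; auto simp: dimset_def)+
qed

lemma elem_sub_dimset:
  assumes "a \<in> dimset k" "elem_less B a" "elem_sub a b = Some c"
  shows "c \<in> dimset k" "elem_less B c"
proof -
  have "x - y < B" if "(x, y) \<in> set (zip u v)" "\<forall>x \<in> set u. x < B" for x y u v
    using that set_zip_leftD by (metis diff_le_self le_less_trans)
  then show "c \<in> dimset k" "elem_less B c"
    using assms by (cases a; cases b; auto simp: dimset_def split: if_splits)+
qed

text \<open>Only addition can enlarge components, at most doubling the bound, and
  \<open>2 * B \<le> 2 ^ m\<close> excludes overflow there.\<close>

lemma combine_correct: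
  assumes u: "denotes m k B u S" and v: "denotes m k B v T"
    and "2 * B \<le> 2 ^ m" "1 \<le> k" "f \<in> ops" "k \<le> length W" "m = length W"
  shows "denotes m k (2 * B) (normal W (combine (op_tok f) u v)) (binop f S T)"
proof -
  consider "u = []" "S = {}" | "v = []" "T = {}"
    | a b where "u = [elem_digits m a]" "S = {a}" "v = [elem_digits m b]" "T = {b}"
      "a \<in> dimset k" "b \<in> dimset k" "elem_less B a" "elem_less B b"
    using u v unfolding denotes_def by blast
  then show ?thesis
  proof cases
    case 1
    then have "binop f S T = {}" "combine (op_tok f) u v = []"
      using \<open>f \<in> ops\<close> by (auto simp: combine_def set_add_single set_sub_single)
    then show ?thesis by (simp add: normal_def denotes_empty)
  next
    case 2
    then have "binop f S T = {}" "combine (op_tok f) u v = []"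
      using \<open>f \<in> ops\<close> by (auto simp: combine_def set_add_single set_sub_single split: list.split)
    then show ?thesis by (simp add: normal_def denotes_empty)
  next
    case 3
    note ab = 3
    have mono: "elem_less B' c" if "elem_less B c" "B \<le> B'" for B' c
      using that by (cases c) auto
    have less: "elem_less (2 ^ m) a" "elem_less (2 ^ m) b"
      using mono[OF ab(7)] mono[OF ab(8)] assms(3) by auto
    have single: "denotes m k (2 * B) (normal W [elem_digits m c]) {c}"
      if "c \<in> dimset k" "elem_less (2 * B) c" for c
      using that normal_elem_digits[OF that(1) \<open>k \<le> length W\<close>] assms(7) by (simp add: denotes_single)
    have nil: "elem_digits m c = [] \<longleftrightarrow> c = Infty" if "c \<in> dimset k" for c
      using that \<open>1 \<le> k\<close> by (cases c) (auto simp: dimset_def)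
    consider "f = OInter" | "f = OPlus" | "f = OMinus" using \<open>f \<in> ops\<close> by blast
    then show ?thesis
    proof cases
      case 1
      have "u = v \<longleftrightarrow> a = b"
        using elem_digits_inject[OF ab(5,6) \<open>1 \<le> k\<close> less] ab by simp
      then show ?thesis
        using 1 ab single[OF ab(5)] mono[OF ab(7), of "2 * B"]
        by (cases "a = b") (auto simp: combine_def normal_def denotes_empty)
    next
      case 2
      have "combine tPlus u v = [elem_digits m (elem_add a b)]"
      proof (cases "a = Infty \<or> b = Infty")
        case True
        then show ?thesis using ab(1,3) nil[OF ab(5)] nil[OF ab(6)]
          by (cases a; cases b) (auto simp: combine_def)
      next
        case False
        then obtain x y where xy: "a = Fin x" "b = Fin y" by (metis elem.exhaust)
        have "elem_less (2 ^ m) (elem_add a b)"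
          using elem_add_dimset(2)[OF ab(5-8)] assms(3) unfolding xy by (auto simp del: split_paired_All)
        then show ?thesis using ab(1,3) nil[OF ab(5)] nil[OF ab(6)] xy vec_add[of x y m] ab(5,6)
          by (simp add: combine_def dimset_def)
      qed
      then show ?thesis using 2 ab single elem_add_dimset[OF ab(5-8)] by (simp add: set_add_single)
    next
      case 3
      have "combine tMinus u v = (case elem_sub a b of None \<Rightarrow> [] | Some c \<Rightarrow> [elem_digits m c])"
      proof (cases "a = Infty \<or> b = Infty")
        case True
        then show ?thesis using ab(1,3) nil[OF ab(5)] nil[OF ab(6)]
          by (cases a; cases b) (auto simp: combine_def)
      next
        case False
        then obtain x y where xy: "a = Fin x" "b = Fin y" by (metis elem.exhaust)
        then show ?thesis using ab(1,3) nil[OF ab(5)] nil[OF ab(6)] vec_sub[of x y m] ab(5,6) less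
          by (simp add: combine_def dimset_def)
      qed
      then show ?thesis
        using 3 ab single elem_sub_dimset[OF ab(5,7)] mono[of _ "2 * B"]
        by (cases "elem_sub a b") (auto simp: set_sub_single normal_def denotes_empty)
    qed
  qed
qed

lemma lookup_eq:
  assumes "distinct is"
  shows "lookup (nat_bits j) (map (\<lambda>i. (nat_bits i, f i)) is) = (if j \<in> set is then [f j] else [])"
proof -
  have "fold (\<lambda>p acc. if fst p = nat_bits j then [snd p] else acc) (map (\<lambda>i. (nat_bits i, f i)) is) acc
      = (if j \<in> set is then [f j] else acc)" for acc
    using assms by (induction "is" arbitrary: acc) (auto simp: nat_bits_inject)
  then show ?thesis by (simp add: lookup_def)
qed

lemma numbering_eq:
  assumes "length R \<le> length W"
  shows "numbering W R = rev (map (\<lambda>i. (nat_bits i, R ! i)) [0..<length R])"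
proof -
  define f :: "group \<Rightarrow> bool list \<times> (bool list \<times> group) list \<Rightarrow> bool list \<times> (bool list \<times> group) list"
    where "f = (\<lambda>g st. (cap W (inc (fst st)), (cap W (fst st), g) # snd st))"
  have cap: "cap W (nat_bits i) = nat_bits i" if "Suc i \<le> length W" for i
    using length_nat_bits[of i] that by (simp add: cap_eq)
  \<comment> \<open>The counter left after the last group may be cut by \<open>cap\<close>, as
    \<open>length_nat_bits\<close> allows it one digit more than \<open>W\<close> is known to have;
    it labels no group.\<close>
  have "length R \<le> length W \<Longrightarrow> fold f R ([False], []) =
      ((if R = [] then [False] else cap W (nat_bits (length R))), rev (map (\<lambda>i. (nat_bits i, R ! i)) [0..<length R]))"
  proof (induction R rule: rev_induct)
    case (snoc g R)
    have "fold f (R @ [g]) ([False], []) = f g (nat_bits (length R), rev (map (\<lambda>i. (nat_bits i, R ! i)) [0..<length R]))"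
      using snoc cap[of "length R"] by (cases "R = []") (auto simp: nat_bits_less_two)
    then show ?case
      using cap[of "length R"] snoc.prems by (auto simp: f_def inc_nat_bits nth_append)
  qed simp
  then show ?thesis using assms by (simp add: numbering_def f_def)
qed

lemma map_snd_numbering: "map snd (numbering W R) = rev R"
proof -
  have "map snd (snd (fold (\<lambda>g st. (cap W (inc (fst st)), (cap W (fst st), g) # snd st)) R (l, acc))) = rev R @ map snd acc"
    for l acc
    by (induction R arbitrary: l acc) auto
  then show ?thesis by (simp add: numbering_def)
qed

definition refs_ok :: "nat \<Rightarrow> nat \<Rightarrow> gate \<Rightarrow> bool" where
  "refs_ok n i g \<longleftrightarrow> (case g of GBin f j l \<Rightarrow> i < j \<and> j < n \<and> i < l \<and> l < n | _ \<Rightarrow> True)"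

lemma denotes_mono:
  assumes "denotes m k B v S" "B \<le> B'"
  shows "denotes m k B' v S"
proof -
  have "elem_less B' a" if "elem_less B a" for a
    using that assms(2) by (cases a) auto
  then show ?thesis using assms(1) unfolding denotes_def by blast
qed

lemma eval_step_fst: "fst (eval_step W x st) \<Longrightarrow> fst st"
  by (auto simp: eval_step_def split: if_splits list.splits)

text \<open>Operands have larger indices, so the exponent \<open>D + length gs - j\<close> grows by
  at least one from an operand to its gate, enough for one doubling. The induction goes down from
  the end of the list, in evaluation order, and treats the flag together with the values, which are
  meaningful only when all references resolve.\<close>

lemma eval_correct:
  assumes plain: "\<And>g. g \<in> set gs \<Longrightarrow> plain_gate g"
    and inputs: "\<And>a. GIn a \<in> set gs \<Longrightarrow> a \<in> dimset k \<and> elem_less (2 ^ D) a"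
    and "1 \<le> k" "k \<le> length W" "D + length gs \<le> length W"
    and "i \<le> length gs"
    and E: "E = eval_groups W (map (\<lambda>i. (nat_bits i, gate_group (gs ! i))) (rev [i..<length gs]))"
  shows "(fst E \<longleftrightarrow> (\<forall>j \<in> {i..<length gs}. refs_ok (length gs) j (gs ! j))) \<and>
    (fst E \<longrightarrow> (\<exists>f. snd E = map (\<lambda>j. (nat_bits j, f j)) [i..<length gs] \<and>
       (\<forall>j \<in> {i..<length gs}. denotes (length W) k (2 ^ (D + length gs - j)) (f j) (gval k gs j))))"
  using \<open>i \<le> length gs\<close> E
proof (induction i arbitrary: E rule: inc_induct)
  case base
  then show ?case by (simp add: eval_groups_def)
next
  case (step i)
  define n where "n = length gs"
  define E' where "E' = eval_groups W (map (\<lambda>i. (nat_bits i, gate_group (gs ! i))) (rev [Suc i..<length gs]))"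
  note IH = step.IH[OF E'_def, folded n_def]
  have i: "i < n" using step by (simp add: n_def)
  have "[i..<n] = i # [Suc i..<n]" using i by (rule upt_conv_Cons)
  then have E: "E = eval_step W (nat_bits i, gate_group (gs ! i)) E'"
    unfolding step.prems E'_def n_def eval_groups_def by simp
  have range: "{i..<n} = insert i {Suc i..<n}" using i by auto
  have upt: "[i..<n] = i # [Suc i..<n]" by fact
  show ?case
  proof (cases "fst E'")
    case False
    then have "\<not> fst E" using eval_step_fst E by blast
    then show ?thesis using IH False range unfolding n_def[symmetric] by auto
  next
    case True
    then obtain f where f: "snd E' = map (\<lambda>j. (nat_bits j, f j)) [Suc i..<n]"
      "\<And>j. j \<in> {Suc i..<n} \<Longrightarrow> denotes (length W) k (2 ^ (D + n - j)) (f j) (gval k gs j)"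
      using IH by blast
    have refs: "\<forall>j \<in> {Suc i..<n}. refs_ok n j (gs ! j)" using IH True by blast
    have extend: ?thesis
      if "E = (True, (nat_bits i, v) # snd E')" "denotes (length W) k (2 ^ (D + n - i)) v (gval k gs i)"
        "refs_ok n i (gs ! i)" for v
    proof -
      have "snd E = map (\<lambda>j. (nat_bits j, (f(i := v)) j)) [i..<n]"
        using that(1) f(1) by (simp add: upt)
      moreover have "\<forall>j \<in> {i..<n}. denotes (length W) k (2 ^ (D + n - j)) ((f(i := v)) j) (gval k gs j)"
        using that(2) f(2) by (auto simp: range)
      ultimately show ?thesis
        using that refs unfolding n_def[symmetric] range by (intro conjI impI exI[of _ "f(i := v)"]) auto
    qed
    have gi: "gs ! i \<in> set gs" using i by (simp add: n_def)
    from plain[OF gi] show ?thesis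
    proof (cases rule: plain_gateE)
      case (1 a)
      have a: "a \<in> dimset k" "elem_less (2 ^ D) a" using inputs gi 1 by auto
      show ?thesis
      proof (rule extend)
        show "E = (True, (nat_bits i, [elem_digits (length W) a]) # snd E')"
          using True 1 normal_components[OF a(1) \<open>k \<le> length W\<close>] by (simp add: E eval_step_def)
        have "gval k gs i = {a}" using i 1 by (subst gval.simps) (simp add: n_def)
        moreover have "(2::nat) ^ D \<le> 2 ^ (D + n - i)" using i by (intro power_increasing) auto
        ultimately show "denotes (length W) k (2 ^ (D + n - i)) [elem_digits (length W) a] (gval k gs i)"
          using denotes_mono denotes_single[OF a] by metis
      qed (simp add: refs_ok_def 1)
    next
      case (2 h j l)
      have tok: "op_tok h \<noteq> tIn" using 2 by auto
      \<comment> \<open>Exactly the gates above \<open>i\<close> are stored, so a lookup succeeds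
        iff the reference meets the index condition of \<open>refs_ok\<close>.\<close>
      have lk: "lookup (nat_bits j) (snd E') = (if j \<in> {Suc i..<n} then [f j] else [])" for j
        unfolding f(1) by (subst lookup_eq) auto
      show ?thesis
      proof (cases "refs_ok n i (gs ! i)")
        case False
        then have "\<not> fst E"
          using lk tok 2 by (auto simp: E eval_step_def refs_ok_def split: if_splits list.split)
        then show ?thesis using False range by (auto simp: n_def[symmetric])
      next
        case ok: True
        then have jl: "j \<in> {Suc i..<n}" "l \<in> {Suc i..<n}" using 2 by (auto simp: refs_ok_def)
        show ?thesis
        proof (rule extend[OF _ _ ok])
          show "E = (True, (nat_bits i, normal W (combine (op_tok h) (f j) (f l))) # snd E')"
            using lk jl tok 2 True by (simp add: E eval_step_def)
          have gv: "gval k gs i = binop h (gval k gs j) (gval k gs l)"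
            using i jl 2 by (subst gval.simps) (simp add: n_def)
          let ?B = "2 ^ (D + n - Suc i) :: nat"
          have B: "2 * ?B = 2 ^ (D + n - i)" using i by (simp add: Suc_diff_Suc flip: power_Suc)
          have Bm: "2 * ?B \<le> 2 ^ length W"
            unfolding B by (rule power_increasing) (use assms(5) in \<open>auto simp: n_def\<close>)
          have "denotes (length W) k ?B (f x) (gval k gs x)" if "x \<in> {Suc i..<n}" for x
          proof -
            have "(2 :: nat) ^ (D + n - x) \<le> ?B"
              by (rule power_increasing) (use that in auto)
            then show ?thesis using denotes_mono[OF f(2)[OF that]] by blast
          qed
          then have "denotes (length W) k (2 * ?B) (normal W (combine (op_tok h) (f j) (f l)))
              (binop h (gval k gs j) (gval k gs l))"
            using jl 2 assms(3,4) Bm by (intro combine_correct) auto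
          then show "denotes (length W) k (2 ^ (D + n - i)) (normal W (combine (op_tok h) (f j) (f l))) (gval k gs i)"
            unfolding gv B .
        qed
      qed
    qed
  qed
qed

section \<open>Consistent dimensions and bounds by the input length\<close>

definition elems :: "gate list \<Rightarrow> elem \<Rightarrow> elem set" where
  "elems gs b = insert b {a. GIn a \<in> set gs}"

text \<open>Pairwise agreement of vector lengths suffices for a common dimension. The witness is
  pinned to \<open>1\<close> or the length of an occurring vector in order to bound it by the input
  length later on.\<close>

lemma dims_ok_iff:
  assumes plain: "\<And>g. g \<in> set gs \<Longrightarrow> plain_gate g" and b: "b \<noteq> Fin []"
  shows "dims_ok (map gate_group gs @ [((tSep, []), elem_lexemes b)]) \<longleftrightarrow>
    (\<exists>k \<ge> 1. (k = 1 \<or> (\<exists>v. Fin v \<in> elems gs b \<and> k = length v)) \<and> elems gs b \<subseteq> dimset k)"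
    (is "?L \<longleftrightarrow> ?R")
proof -
  define compat where "compat a a' \<longleftrightarrow> unary_length (elem_lexemes a) = unary_length (elem_lexemes a') \<or>
     unary_length (elem_lexemes a) = [False] \<or> unary_length (elem_lexemes a') = [False]" for a a'
  have compat: "compat a a' \<longleftrightarrow> (\<forall>u v. a = Fin u \<longrightarrow> a' = Fin v \<longrightarrow> length u = length v)" for a a'
    by (cases a; cases a') (auto simp: compat_def unary_length_eq replicate_eq_replicate)
  let ?G = "set (map gate_group gs @ [((tSep, []), elem_lexemes b)])"
  have groups: "(\<exists>g \<in> ?G. (fst (fst g) = tIn \<or> fst (fst g) = tSep) \<and> P (snd g)) \<longleftrightarrow>
      (\<exists>a \<in> elems gs b. P (elem_lexemes a))" for P
  proof
    assume "\<exists>g \<in> ?G. (fst (fst g) = tIn \<or> fst (fst g) = tSep) \<and> P (snd g)"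
    then obtain g where g: "g \<in> ?G" "fst (fst g) = tIn \<or> fst (fst g) = tSep" "P (snd g)" by blast
    then consider "g = ((tSep, []), elem_lexemes b)" | x where "x \<in> set gs" "g = gate_group x" by auto
    then show "\<exists>a \<in> elems gs b. P (elem_lexemes a)"
    proof cases
      case 1
      then show ?thesis using g by (auto simp: elems_def)
    next
      case 2
      then show ?thesis using g plain[OF 2(1)] by (elim plain_gateE) (auto simp: elems_def)
    qed
  next
    assume "\<exists>a \<in> elems gs b. P (elem_lexemes a)"
    then show "\<exists>g \<in> ?G. (fst (fst g) = tIn \<or> fst (fst g) = tSep) \<and> P (snd g)"
      unfolding elems_def by force
  qed
  define S where "S = {snd g |g. g \<in> ?G \<and> (fst (fst g) = tIn \<or> fst (fst g) = tSep)}"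
  have S: "S = elem_lexemes ` elems gs b"
  proof (rule set_eqI)
    fix y
    show "y \<in> S \<longleftrightarrow> y \<in> elem_lexemes ` elems gs b"
      using groups[of "\<lambda>z. y = z"] unfolding S_def image_iff mem_Collect_eq by blast
  qed
  have "?L \<longleftrightarrow> (\<forall>x \<in> S. \<forall>y \<in> S. unary_length x = unary_length y \<or>
      unary_length x = [False] \<or> unary_length y = [False])"
    unfolding dims_ok_def list_all_iff S_def by blast
  also have "\<dots> \<longleftrightarrow> (\<forall>a \<in> elems gs b. \<forall>a' \<in> elems gs b. compat a a')"
    unfolding S compat_def by blast
  also have "\<dots> \<longleftrightarrow> ?R"
  proof
    assume c: "\<forall>a \<in> elems gs b. \<forall>a' \<in> elems gs b. compat a a'"
    show ?R
    proof (cases "\<exists>v. Fin v \<in> elems gs b")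
      case True
      then obtain v where v: "Fin v \<in> elems gs b" by blast
      have "v \<noteq> []" using v b plain[of "GIn (Fin [])"] by (auto simp: elems_def plain_gate_def)
      moreover have "a \<in> dimset (length v)" if "a \<in> elems gs b" for a
        using bspec[OF bspec[OF c that] v] unfolding compat by (cases a) (auto simp: dimset_def)
      ultimately show ?thesis using v by (intro exI[of _ "length v"]) (auto simp: Suc_le_eq)
    next
      case False
      then have "a = Infty" if "a \<in> elems gs b" for a using that by (cases a) auto
      then show ?thesis by (intro exI[of _ 1]) (auto simp: dimset_def)
    qed
  next
    assume ?R
    then obtain k where "elems gs b \<subseteq> dimset k" by blast
    then have "length u = k" if "Fin u \<in> elems gs b" for u
      using that by (auto simp: dimset_def)
    then show "\<forall>a \<in> elems gs b. \<forall>a' \<in> elems gs b. compat a a'"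
      unfolding compat by blast
  qed
  finally show ?thesis .
qed

lemma length_concat_ge: "x \<in> set xs \<Longrightarrow> length x \<le> length (concat xs)"
  by (induction xs) auto

lemma length_bits: "length (bits ts) = 4 * length ts"
  by (induction ts) (auto simp: bits_def split: prod.split elim: tok_bits.elims)

text \<open>Every group contains a lexeme, every lexeme and every digit yields a token, and a token
  takes four bits.\<close>

lemma length_render:
  assumes "g \<in> set G"
  shows "length G \<le> length (render G)" "length (snd g) \<le> length (render G)"
    "l \<in> set (snd g) \<Longrightarrow> length (snd l) \<le> length (render G)"
proof -
  have 1: "length L \<le> length (unlex L)" for L by (induction L) auto
  have 2: "length (ungroup G) \<le> length (render G)"
    using 1[of "ungroup G"] by (simp add: render_def length_bits)
  have "length G \<le> length (ungroup G)" by (induction G) auto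
  then show "length G \<le> length (render G)" using 2 by simp
  have "length (fst g # snd g) \<le> length (ungroup G)"
    unfolding ungroup_def using assms by (intro length_concat_ge) auto
  then show "length (snd g) \<le> length (render G)" using 2 by simp
  assume "l \<in> set (snd g)"
  then have "l \<in> set (ungroup G)" using assms by (auto simp: ungroup_def)
  then have "length (map digit_tok (rev (snd l)) @ [fst l]) \<le> length (unlex (ungroup G))"
    unfolding unlex_def by (intro length_concat_ge) auto
  then show "length (snd l) \<le> length (render G)" by (simp add: render_def length_bits)
qed

lemma elem_bounds:
  assumes "a \<in> elems gs b" "w = render (circuit_groups out gs b)"
  shows "elem_less (2 ^ length w) a" "a = Fin v \<Longrightarrow> length v \<le> length w"
proof -
  obtain t where g: "(t, elem_lexemes a) \<in> set (circuit_groups out gs b)"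
  proof (cases "a = b")
    case True
    then show thesis by (intro that[of "(tSep, [])"]) (simp add: circuit_groups_def)
  next
    case False
    then have "GIn a \<in> set gs" using assms(1) by (auto simp: elems_def)
    then have "((tIn, []), elem_lexemes a) \<in> gate_group ` set gs"
      by (rule image_eqI[rotated]) simp
    then show thesis by (intro that[of "(tIn, [])"]) (simp add: circuit_groups_def)
  qed
  have "x < 2 ^ length w" if "a = Fin v" "x \<in> set v" for v x
  proof -
    have "length (snd (tComma, nat_bits x)) \<le> length w"
      unfolding assms(2) by (rule length_render(3)[OF g]) (use that in auto)
    then have "(2::nat) ^ length (nat_bits x) \<le> 2 ^ length w" by (intro power_increasing) auto
    moreover have "x < 2 ^ length (nat_bits x)"
      using bits_nat_less[of "nat_bits x"] by (simp add: bits_nat_nat_bits)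
    ultimately show ?thesis by (rule less_le_trans[rotated])
  qed
  then show "elem_less (2 ^ length w) a" by (cases a) auto
  show "length v \<le> length w" if "a = Fin v"
    using length_render(2)[OF g] that unfolding assms(2) by simp
qed

text \<open>Only complement refers to the dimension, and plain gates exclude it. This permits
  exchanging the dimension of an instance for a small one.\<close>

lemma gval_dim: "(\<And>g. g \<in> set gs \<Longrightarrow> plain_gate g) \<Longrightarrow> gval k gs i = gval k' gs i"
proof (induction k gs i rule: gval.induct)
  case (1 k gs i)
  show ?case
  proof (cases "i < length gs")
    case True
    then have "plain_gate (gs ! i)" using 1 by simp
    then show ?thesis
    proof (cases rule: plain_gateE)
      case (2 f j l)
      then show ?thesis using 1(2,3)[OF True 2(1)] 1(4)
        by (subst (1 2) gval.simps) simp
    qed (subst (1 2) gval.simps, simp)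
  qed (subst (1 2) gval.simps, simp)
qed

text \<open>Separates the conditions on elements from those on references, matching the two
  independent tests: \<open>dims_ok\<close> and the flag of \<open>eval_groups\<close>.\<close>

lemma is_circuit_iff:
  assumes "\<And>g. g \<in> set gs \<Longrightarrow> plain_gate g"
  shows "is_circuit ops k (out, gs) \<and> b \<in> dimset k \<longleftrightarrow>
    out < length gs \<and> elems gs b \<subseteq> dimset k \<and> (\<forall>i \<in> {0..<length gs}. refs_ok (length gs) i (gs ! i))"
proof -
  have "wf_gate ops k n i g \<longleftrightarrow> (\<forall>a. g = GIn a \<longrightarrow> a \<in> dimset k) \<and> refs_ok n i g"
    if "plain_gate g" for n i g
    using that by (elim plain_gateE) (auto simp: wf_gate_def refs_ok_def)
  then have "is_circuit ops k (out, gs) \<longleftrightarrow> out < length gs \<and>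
      (\<forall>i < length gs. (\<forall>a. gs ! i = GIn a \<longrightarrow> a \<in> dimset k) \<and> refs_ok (length gs) i (gs ! i))"
    using assms by (auto simp: is_circuit_def)
  then show ?thesis by (auto simp: elems_def in_set_conv_nth)
qed

lemma accepts_circuit:
  assumes plain: "\<And>g. g \<in> set gs \<Longrightarrow> plain_gate g" and b: "b \<noteq> Fin []"
    and w: "w = render (circuit_groups out gs b)"
  shows "accepts (w @ w) (circuit_groups out gs b) \<longleftrightarrow>
    (\<exists>k \<ge> 1. is_circuit ops k (out, gs) \<and> b \<in> dimset k \<and> b \<in> circ_val k (out, gs))"
proof -
  define W where "W = w @ w"
  define n where "n = length gs"
  define R where "R = map gate_group gs @ [((tSep, []), elem_lexemes b)]"
  define xs where "xs = map (\<lambda>i. (nat_bits i, gate_group (gs ! i))) (rev [0..<n])"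
  define E where "E = eval_groups W xs"
  have len: "n + 2 \<le> length w"
    using length_render(1)[of "((tSep, []), elem_lexemes b)" "circuit_groups out gs b"]
    unfolding w by (simp add: circuit_groups_def n_def)
  have G: "circuit_groups out gs b = ((tSep, nat_bits out), []) # R"
    by (simp add: circuit_groups_def R_def)
  have "length R \<le> length W" using len by (simp add: R_def W_def n_def)
  from numbering_eq[OF this]
  have num: "numbering W R = (nat_bits n, ((tSep, []), elem_lexemes b)) # xs"
    by (simp add: R_def xs_def n_def nth_append rev_map)
  have "gate_ok (gate_group (gs ! i))" if "i < n" for i
    using plain[OF nth_mem] that unfolding gate_ok_iff n_def by blast
  then have "list_all (\<lambda>x. gate_ok (snd x)) xs"
    by (auto simp: list_all_iff xs_def)
  moreover have "elem_ok (elem_lexemes b)" "numeral_ok (nat_bits out)"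
    using b by (auto simp: elem_ok_iff numeral_ok_iff)
  ultimately have acc: "accepts W (circuit_groups out gs b) \<longleftrightarrow>
      dims_ok R \<and> fst E \<and> lookup (nat_bits out) (snd E) = [normal W [components (elem_lexemes b)]]"
    by (simp add: accepts_def G num E_def Let_def)
  have eval: "fst E \<and> lookup (nat_bits out) (snd E) = [normal W [components (elem_lexemes b)]] \<longleftrightarrow>
      (\<forall>i \<in> {0..<n}. refs_ok n i (gs ! i)) \<and> out < n \<and> b \<in> gval k gs out"
    if k: "1 \<le> k" "k \<le> length w" "elems gs b \<subseteq> dimset k" for k
  proof -
    have le: "k \<le> length W" "length w + n \<le> length W" using k len by (auto simp: W_def)
    have inp: "a \<in> dimset k \<and> elem_less (2 ^ length w) a" if "GIn a \<in> set gs" for a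
      using k(3) elem_bounds(1)[OF _ w, of a] that by (auto simp: elems_def)
    have ev: "(fst E \<longleftrightarrow> (\<forall>j \<in> {0..<n}. refs_ok n j (gs ! j))) \<and>
      (fst E \<longrightarrow> (\<exists>f. snd E = map (\<lambda>j. (nat_bits j, f j)) [0..<n] \<and>
       (\<forall>j \<in> {0..<n}. denotes (length W) k (2 ^ (length w + n - j)) (f j) (gval k gs j))))"
      unfolding n_def
      by (rule eval_correct[OF plain inp k(1) le(1)]) (use le in \<open>auto simp: E_def xs_def n_def\<close>)
    show ?thesis
    proof (cases "fst E \<and> out < n")
      case True
      then obtain f where f1: "snd E = map (\<lambda>j. (nat_bits j, f j)) [0..<n]"
        "\<forall>j \<in> {0..<n}. denotes (length W) k (2 ^ (length w + n - j)) (f j) (gval k gs j)"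
        using ev by blast
      note f = f1(1) bspec[OF f1(2), of out, simplified, OF conjunct2[OF True]]
      have bd: "b \<in> dimset k" "elem_less (2 ^ length w) b"
        using k(3) elem_bounds(1)[OF _ w, of b] by (auto simp: elems_def)
      have p: "(2::nat) ^ length w \<le> 2 ^ length W" "(2::nat) ^ (length w + n - out) \<le> 2 ^ length W"
        using le by (auto intro!: power_increasing)
      have less: "elem_less B' a" if "elem_less B a" "B \<le> B'" for B B' a
        using that by (cases a) auto
      from f(2) consider "f out = []" "gval k gs out = {}"
        | a where "f out = [elem_digits (length W) a]" "gval k gs out = {a}" "a \<in> dimset k"
            "elem_less (2 ^ (length w + n - out)) a"
        unfolding denotes_def by blast
      then have "f out = [elem_digits (length W) b] \<longleftrightarrow> b \<in> gval k gs out"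
      proof cases
        case (2 a)
        then show ?thesis
          using elem_digits_inject[OF 2(3) bd(1) k(1) less[OF 2(4) p(2)] less[OF bd(2) p(1)]] by auto
      qed simp
      moreover have "lookup (nat_bits out) (snd E) = [f out]"
        unfolding f(1) using True by (subst lookup_eq) auto
      ultimately show ?thesis
        using True ev normal_components[OF bd(1) le(1)] by auto
    next
      case False
      \<comment> \<open>Only indices below \<open>n\<close> are stored, so an output index out of
        range finds nothing and the final comparison fails.\<close>
      have "lookup (nat_bits out) (snd E) = []" if fE: "fst E"
      proof -
        obtain f where "snd E = map (\<lambda>j. (nat_bits j, f j)) [0..<n]"
          "\<forall>j \<in> {0..<n}. denotes (length W) k (2 ^ (length w + n - j)) (f j) (gval k gs j)"
          using ev fE by blast
        then show ?thesis using False fE by (simp add: lookup_eq)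
      qed
      then show ?thesis using False ev by auto
    qed
  qed
  show ?thesis
    unfolding W_def[symmetric]
  proof
    assume "accepts W (circuit_groups out gs b)"
    then have a: "dims_ok R" "fst E \<and> lookup (nat_bits out) (snd E) = [normal W [components (elem_lexemes b)]]"
      using acc by auto
    from a(1) obtain k where k: "1 \<le> k" "k = 1 \<or> (\<exists>v. Fin v \<in> elems gs b \<and> k = length v)" "elems gs b \<subseteq> dimset k"
      using dims_ok_iff[OF plain b] unfolding R_def by auto
    have "k \<le> length w" using k(2) elem_bounds(2)[OF _ w] len by auto
    from eval[OF k(1) this k(3)] a(2)
    show "\<exists>k \<ge> 1. is_circuit ops k (out, gs) \<and> b \<in> dimset k \<and> b \<in> circ_val k (out, gs)"
      using is_circuit_iff[OF plain, where k = k and out = out and b = b] k by (auto simp: n_def circ_val_def)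
  next
    assume "\<exists>k \<ge> 1. is_circuit ops k (out, gs) \<and> b \<in> dimset k \<and> b \<in> circ_val k (out, gs)"
    then obtain k where k: "1 \<le> k" "is_circuit ops k (out, gs) \<and> b \<in> dimset k" "b \<in> gval k gs out"
      by (auto simp: circ_val_def)
    then have c: "out < n" "elems gs b \<subseteq> dimset k" "\<forall>i \<in> {0..<n}. refs_ok n i (gs ! i)"
      using is_circuit_iff[OF plain, where k = k and out = out and b = b] by (auto simp: n_def)
    \<comment> \<open>If no vector occurs, the given \<open>k\<close> may exceed any bound in terms
      of \<open>w\<close>, so it is replaced by \<open>1\<close>; otherwise a vector forces
      it.\<close>
    obtain k' where k': "1 \<le> k'" "k' = 1 \<or> (\<exists>v. Fin v \<in> elems gs b \<and> k' = length v)" "elems gs b \<subseteq> dimset k'"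
    proof (cases "\<exists>v. Fin v \<in> elems gs b")
      case True
      then obtain v where "Fin v \<in> elems gs b" by blast
      then show ?thesis using that[of k] k(1) c(2) by (auto simp: dimset_def)
    next
      case False
      then have "a = Infty" if "a \<in> elems gs b" for a using that by (cases a) auto
      then show ?thesis using that[of 1] by (auto simp: dimset_def)
    qed
    have "k' \<le> length w" using k'(2) elem_bounds(2)[OF _ w] len by auto
    moreover have "dims_ok R" using dims_ok_iff[OF plain b] k' unfolding R_def by auto
    ultimately show "accepts W (circuit_groups out gs b)"
      using acc eval[OF k'(1) _ k'(3)] c k(3) gval_dim[OF plain, of gs k out k'] by auto
  qed
qed

text \<open>Holds for every \<open>W\<close>: capping may spoil the labels assigned by
  \<open>numbering\<close>, but the groups survive unchanged, and their form is all that matters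
  here.\<close>

lemma accepts_imp_circuit_groups:
  assumes "accepts W G"
  obtains out gs b where "G = circuit_groups out gs b" "\<And>g. g \<in> set gs \<Longrightarrow> plain_gate g" "b \<noteq> Fin []"
proof -
  obtain o' R where G: "G = o' # R" using assms by (cases G) (auto simp: accepts_def)
  obtain t xs where num: "numbering W R = t # xs"
    using assms G by (cases "numbering W R") (auto simp: accepts_def)
  have c: "fst (fst o') = tSep" "numeral_ok (snd (fst o'))" "snd o' = []" "fst (fst (snd t)) = tSep"
      "snd (fst (snd t)) = []" "elem_ok (snd (snd t))" "\<And>x. x \<in> set xs \<Longrightarrow> gate_ok (snd x)"
    using assms by (auto simp: accepts_def G num list_all_iff)
  obtain out where "o' = ((tSep, nat_bits out), [])"
    using c(1-3) by (cases o', cases "fst o'") (auto simp: numeral_ok_iff)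
  moreover obtain b where b: "b \<noteq> Fin []" "snd t = ((tSep, []), elem_lexemes b)"
    using c(4-6) by (cases t, cases "snd t", cases "fst (snd t)") (auto simp: elem_ok_iff)
  moreover have "\<exists>gs. map snd xs = map gate_group gs \<and> (\<forall>g \<in> set gs. plain_gate g)"
    using c(7)
  proof (induction xs)
    case (Cons x xs)
    obtain gs where "map snd xs = map gate_group gs \<and> (\<forall>g \<in> set gs. plain_gate g)"
      using Cons by auto
    moreover obtain g where "plain_gate g" "snd x = gate_group g"
      using Cons.prems[of x] by (auto simp: gate_ok_iff)
    ultimately show ?case by (intro exI[of _ "g # gs"]) auto
  qed simp
  then obtain gs where gs: "map snd xs = map gate_group gs" "\<forall>g \<in> set gs. plain_gate g" by blast
  have "rev R = snd t # map snd xs" using map_snd_numbering[of W R] num by simp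
  then have "R = map gate_group (rev gs) @ [snd t]"
    unfolding gs(1) by (metis rev.simps(2) rev_map rev_rev_ident)
  ultimately show thesis
    using that[of out "rev gs" b] gs(2) G by (simp add: circuit_groups_def)
qed

lemma decide_iff: "decide w \<longleftrightarrow> w \<in> MC_star ops"
proof
  assume "decide w"
  then have "fst (parse w)" "accepts (w @ w) (snd (parse w))" by (auto simp: decide_def Let_def)
  moreover obtain out gs b where G: "snd (parse w) = circuit_groups out gs b"
      "\<And>g. g \<in> set gs \<Longrightarrow> plain_gate g" "b \<noteq> Fin []"
    using accepts_imp_circuit_groups[OF calculation(2)] by metis
  ultimately have w: "w = render (circuit_groups out gs b)" "accepts (w @ w) (circuit_groups out gs b)"
    using parse_sound by metis+
  then obtain k where "k \<ge> 1" "is_circuit ops k (out, gs)" "b \<in> dimset k" "b \<in> circ_val k (out, gs)"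
    using accepts_circuit[OF G(2,3) w(1)] by auto
  moreover have "w = enc_instance (out, gs) b" using enc_instance_render[OF G(2)] w(1) by simp
  ultimately show "w \<in> MC_star ops" unfolding MC_star_def by blast
next
  assume "w \<in> MC_star ops"
  then obtain C b k where C: "k \<ge> 1" "is_circuit ops k C" "b \<in> dimset k" "b \<in> circ_val k C"
    "w = enc_instance C b"
    unfolding MC_star_def by blast
  obtain out gs where "C = (out, gs)" by fastforce
  note k = C(1-4)[unfolded this] and enc = C(5)[unfolded this]
  have ne: "a \<noteq> Fin []" if "a \<in> dimset k" for a using that k(1) by (auto simp: dimset_def)
  have plain: "plain_gate g" if g: "g \<in> set gs" for g
  proof -
    obtain i where "i < length gs" "g = gs ! i" using g by (metis in_set_conv_nth)
    then have "wf_gate ops k (length gs) i g" using k(2) by (auto simp: is_circuit_def)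
    then show ?thesis using ne by (auto simp: wf_gate_def plain_gate_def split: gate.splits)
  qed
  have w: "w = render (circuit_groups out gs b)" using enc enc_instance_render[OF plain] by simp
  have "parse w = (True, circuit_groups out gs b)" using parse_circuit[OF plain] w by simp
  moreover have "accepts (w @ w) (circuit_groups out gs b)"
    using accepts_circuit[OF plain ne[OF k(3)] w] k by blast
  ultimately show "decide w" by (simp add: decide_def)
qed

theorem theorem5:
  shows "in_P (MC_star {OInter, OPlus, OMinus})"
  by (rule in_P_if_FP[OF FP_decide decide_iff])

end
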